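(* Let $\delta\in(0,\alpha)$ and let $a_t>0$ satisfy $a_t=o(t^{-1/4})$ as $t\to\infty$. Divide the interval $[\delta,\alpha]$ into subintervals $I_1,\dots,I_{[\sqrt t/a_t]+1}$ of length at most $\frac{a_t}{\sqrt t}$. Then there is a constant $C(\delta)$ such that, for all sufficiently large $t$, $$P\left(\max_{1\le j\le[\sqrt t/a_t]+1}N_t(I_j)\ge2\right)\le C(\delta)\,a_t^2\,t^{1/2},$$ and the right side tends to $0$ as $t\to\infty$.
   Context: Fix $\alpha\in(0,1)$, $\sigma=\sqrt{\alpha(1-\alpha)}$ and $\sigma_t=\sigma/\sqrt t$. Let $W$ be a standard one-dimensional Brownian motion on $[0,1]$. The scaled one-dimensional Conga line at time $t$ is $$u_t(x)=\int_0^1W(1-z)\frac{1}{\sqrt{2\pi}}\,\frac{x+\alpha z}{2\sigma_t z^{3/2}}\exp\left(-\frac{(x-\alpha z)^2}{2\sigma_t^2z}\right)dz,\qquad 0<x\le 1 .$$ For an interval $I\subseteq[\delta,\alpha]$, $N_t(I)$ is the number of critical points of $u_t$ in $I$ (points where $u_t'=0$). $[\cdot]$ denotes integer part. Constants may depend on the fixed parameter $\alpha$. *)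

theory Defs
  imports
    "HOL-Probability.Probability"
    "HOL-Library.Extended_Nat"
    "HOL-Library.Landau_Symbols"
begin

text \<open>
  Standard one-dimensional Brownian motion on \<open>[0, 1]\<close>; only the values of \<^term>\<open>W\<close> at times in
  \<open>[0, 1]\<close> are constrained. Every path (not just almost every one) is continuous and starts at \<open>0\<close>.
\<close>

locale standard_brownian_motion = prob_space M
  for M :: "'a measure" and W :: "real \<Rightarrow> 'a \<Rightarrow> real" +
  assumes random_variable: "\<And>s. s \<in> {0..1} \<Longrightarrow> random_variable borel (W s)"
    and start: "\<And>\<omega>. \<omega> \<in> space M \<Longrightarrow> W 0 \<omega> = 0"
    and continuous_paths: "\<And>\<omega>. \<omega> \<in> space M \<Longrightarrow> continuous_on {0..1} (\<lambda>s. W s \<omega>)"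
    and gaussian_increments:
      "\<And>r s. 0 \<le> r \<Longrightarrow> r < s \<Longrightarrow> s \<le> 1 \<Longrightarrow>
        distributed M lborel (\<lambda>\<omega>. W s \<omega> - W r \<omega>) (normal_density 0 (sqrt (s - r)))"
    and independent_increments:
      "\<And>(n :: nat) (\<tau> :: nat \<Rightarrow> real).
        (\<And>i. i \<le> n \<Longrightarrow> \<tau> i \<in> {0..1}) \<Longrightarrow> (\<And>i. i < n \<Longrightarrow> \<tau> i \<le> \<tau> (Suc i)) \<Longrightarrow>
        indep_vars (\<lambda>_. borel) (\<lambda>i \<omega>. W (\<tau> (Suc i)) \<omega> - W (\<tau> i) \<omega>) {..<n}"

definition \<sigma>\<^sub>t :: "real \<Rightarrow> real \<Rightarrow> real" where
  "\<sigma>\<^sub>t \<alpha> t = sqrt (\<alpha> * (1 - \<alpha>)) / sqrt t"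

text \<open>
  The scaled Conga line \<open>u\<^sub>t\<close> driven by a single path \<^term>\<open>w\<close>, meaningful for \<^prop>\<open>0 < x\<close>. The integrand
  at the endpoint \<open>z = 0\<close> is a division by zero, but a single point does not affect the integral.
\<close>

definition conga_line :: "real \<Rightarrow> real \<Rightarrow> (real \<Rightarrow> real) \<Rightarrow> real \<Rightarrow> real" where
  "conga_line \<alpha> t w x =
    (LBINT z:{0..1}.
      w (1 - z) * (1 / sqrt (2 * pi)) * ((x + \<alpha> * z) / (2 * \<sigma>\<^sub>t \<alpha> t * z powr (3 / 2))) *
      exp (- ((x - \<alpha> * z)\<^sup>2 / (2 * (\<sigma>\<^sub>t \<alpha> t)\<^sup>2 * z))))"

definition critical_points :: "(real \<Rightarrow> real) \<Rightarrow> real set \<Rightarrow> real set" where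
  "critical_points u I = {x \<in> I. (u has_real_derivative 0) (at x)}"

text \<open>Extended-natural-valued, since \<^const>\<open>card\<close> would count an infinite set as having no points.\<close>

definition num_critical_points :: "(real \<Rightarrow> real) \<Rightarrow> real set \<Rightarrow> enat" where
  "num_critical_points u I =
    (if finite (critical_points u I) then enat (card (critical_points u I)) else \<infinity>)"

text \<open>
  A division of \<open>[a, b]\<close> into \<^term>\<open>n\<close> non-overlapping intervals of length at most \<open>l\<close>. The pieces
  may be closed, open or half-open, so neighbouring ones may or may not share an endpoint.
\<close>

definition divides_interval ::
  "(nat \<Rightarrow> real set) \<Rightarrow> nat \<Rightarrow> real \<Rightarrow> real \<Rightarrow> real \<Rightarrow> bool" where
  "divides_interval I n a b l \<longleftrightarrow>
    (\<forall>j\<in>{1..n}. is_interval (I j) \<and> measure lborel (I j) \<le> l) \<and>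
    disjoint_family_on (\<lambda>j. interior (I j)) {1..n} \<and>
    (\<Union>j\<in>{1..n}. I j) = {a..b}"

definition num_pieces :: "(real \<Rightarrow> real) \<Rightarrow> real \<Rightarrow> nat" where
  "num_pieces a t = nat \<lfloor>sqrt t / a t\<rfloor> + 1"

end

theory Submission
  imports Defs
begin

text \<open>
  Write \<open>\<sigma> = \<sigma>\<^sub>t\<close>. The kernel of \<open>u\<^sub>t\<close> averages the Brownian path over times of order \<open>\<sigma>\<close>,
  so \<open>u'\<close>, \<open>u''\<close>, \<open>u'''\<close> are centred Gaussian of sizes \<open>\<sigma>^(-1/2)\<close>, \<open>\<sigma>^(-3/2)\<close>, \<open>\<sigma>^(-5/2)\<close>,
  and \<open>(u', u'')\<close> at a point has a density of order at most \<open>\<sigma>\<^sup>2\<close>. If \<open>u'\<close> has two zeros in an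
  interval of length \<open>\<epsilon>\<close>, Rolle's theorem gives \<open>|u''| \<le> \<epsilon> R\<close> and \<open>|u'| \<le> \<epsilon>\<^sup>2 R\<close> at its left
  endpoint, where \<open>R\<close> is the mean of \<open>|u'''|\<close> over the interval, of order \<open>\<sigma>^(-5/2)\<close>. Such a
  coincidence has probability of order \<open>\<epsilon>\<^sup>3 \<sigma>^(-5) \<sigma>\<^sup>2 = (\<epsilon>/\<sigma>)\<^sup>3\<close>, which is of order \<open>a\<^sub>t\<^sup>3\<close> for
  \<open>\<epsilon> = a\<^sub>t / \<surd>t\<close>; summing over about \<open>\<surd>t / a\<^sub>t\<close> pieces gives \<open>a\<^sub>t\<^sup>2 \<surd>t\<close>.

  The factor \<open>R\<close> is random and correlated with \<open>(u', u'')\<close>, and bounding it by a high quantile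
  would cost a logarithm. Instead, a small-ball estimate for \<open>(u', u'')\<close> is proved under the
  weight \<open>exp(\<sigma>^(5/2) |u'''|)\<close> (\<open>conga_tilted_small_ball\<close>), so that the contribution of
  \<open>\<sigma>^(5/2) R \<approx> k\<close> decays like \<open>k\<^sup>2 e^(-k)\<close> and the sum over \<open>k\<close> is harmless (\<open>prob_two_zeros_le\<close>).
  The weighted estimate comes from Fourier analysis: the Gaussian weight \<open>exp(- X\<^sup>2 / 2 A\<^sup>2)\<close>
  is a mixture of the characters \<open>exp(i s X)\<close>, and the exponential tilt shifts means without
  affecting the decay of characteristic functions (\<open>tilted_char_normal\<close>, \<open>gaussian_weight_step\<close>).

  The \<open>x\<close>-derivatives of \<open>u\<^sub>t\<close> are limits, path by path, of linear combinations of independent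
  Brownian increments. The estimates are made for these finite sums and passed to the limit by
  Fatou's lemma (\<open>brownian_small_ball\<close>), which requires only bounds on the limiting
  covariances: \<open>variance_lower_bound\<close> for the pair \<open>(u', u'')\<close>, \<open>variance_upper_bound\<close> for \<open>u'''\<close>.
\<close>

section \<open>Differentiating the Conga line\<close>

text \<open>
  Up to constants, the kernel of \<open>u\<^sub>t\<close> and its \<open>x\<close>-derivatives of all orders are combinations of
  these atoms, because differentiating an atom in \<open>x\<close> produces three others. Division by zero
  gives the value \<open>0\<close> at \<open>z = 0\<close> for \<open>m > 0\<close>, which is also the limit for \<open>x > 0\<close>.
\<close>

definition kernel_atom :: "real \<Rightarrow> real \<Rightarrow> nat \<Rightarrow> nat \<Rightarrow> real \<Rightarrow> real \<Rightarrow> real" where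
  "kernel_atom \<alpha> \<sigma> i m x z = x ^ i / sqrt z ^ m * exp (- ((x - \<alpha> * z)\<^sup>2 / (2 * \<sigma>\<^sup>2 * z)))"

text \<open>
  The \<open>r\<close>-th \<open>x\<close>-derivative of an atom. A recursion on the indices, in place of closed formulas,
  lets continuity and differentiability in every order follow by one induction.
\<close>

fun atom_deriv :: "real \<Rightarrow> real \<Rightarrow> nat \<Rightarrow> nat \<Rightarrow> nat \<Rightarrow> real \<Rightarrow> real \<Rightarrow> real" where
  "atom_deriv \<alpha> \<sigma> 0 i m x z = kernel_atom \<alpha> \<sigma> i m x z"
| "atom_deriv \<alpha> \<sigma> (Suc r) i m x z =
     real i * atom_deriv \<alpha> \<sigma> r (i - 1) m x z
     - atom_deriv \<alpha> \<sigma> r (i + 1) (m + 2) x z / \<sigma>\<^sup>2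
     + \<alpha> / \<sigma>\<^sup>2 * atom_deriv \<alpha> \<sigma> r i m x z"

text \<open>
  Expanding the square isolates the factor \<open>exp(- x\<^sup>2 / (2 \<sigma>\<^sup>2 z))\<close>, which beats the singular power
  of \<open>z\<close>. The bound tends to \<open>0\<close> with \<open>z\<close>, locally uniformly in \<open>x > 0\<close>; this is what makes
  differentiation under the integral sign legitimate down to \<open>z = 0\<close>.
\<close>

lemma kernel_atom_bound:
  fixes \<alpha> \<sigma> x z :: real
  assumes "0 < x" "0 \<le> z" "0 < \<sigma>" "0 < m"
  shows "\<bar>kernel_atom \<alpha> \<sigma> i m x z\<bar>
      \<le> x ^ i * exp (\<alpha> * x / \<sigma>\<^sup>2) * (2 * real m * \<sigma>\<^sup>2 / x\<^sup>2) ^ m * sqrt z ^ m"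
proof (cases "z = 0")
  case True
  then show ?thesis using assms by (simp add: kernel_atom_def zero_power)
next
  case False
  with assms have z: "0 < z" by simp
  define y where "y = x\<^sup>2 / (2 * \<sigma>\<^sup>2 * z)"
  have y: "0 < y" using assms z by (simp add: y_def)
  have "(y / m) ^ m \<le> (1 + y / m) ^ m"
    using y assms by (intro power_mono) auto
  also have "\<dots> \<le> exp y"
    using y assms by (intro exp_ge_one_plus_x_over_n_power_n) auto
  finally have e: "exp (- y) \<le> (m / y) ^ m"
    using y assms by (simp add: exp_minus field_simps power_divide)
  have "(x - \<alpha> * z)\<^sup>2 / (2 * \<sigma>\<^sup>2 * z) = y - \<alpha> * x / \<sigma>\<^sup>2 + \<alpha>\<^sup>2 * z / (2 * \<sigma>\<^sup>2)"
    using z assms by (simp add: y_def field_simps power2_eq_square)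
  also have "\<dots> \<ge> y - \<alpha> * x / \<sigma>\<^sup>2" using z by simp
  finally have "exp (- ((x - \<alpha> * z)\<^sup>2 / (2 * \<sigma>\<^sup>2 * z))) \<le> exp (\<alpha> * x / \<sigma>\<^sup>2 + - y)"
    by simp
  also have "\<dots> = exp (\<alpha> * x / \<sigma>\<^sup>2) * exp (- y)" by (rule exp_add)
  also have "\<dots> \<le> exp (\<alpha> * x / \<sigma>\<^sup>2) * (m / y) ^ m" using e by simp
  finally have 1: "exp (- ((x - \<alpha> * z)\<^sup>2 / (2 * \<sigma>\<^sup>2 * z))) \<le> exp (\<alpha> * x / \<sigma>\<^sup>2) * (m / y) ^ m" .
  have my: "m / y = (2 * real m * \<sigma>\<^sup>2 / x\<^sup>2) * (sqrt z * sqrt z)"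
    using z assms by (simp add: y_def field_simps)
  have "\<bar>kernel_atom \<alpha> \<sigma> i m x z\<bar>
      = x ^ i / sqrt z ^ m * exp (- ((x - \<alpha> * z)\<^sup>2 / (2 * \<sigma>\<^sup>2 * z)))"
    using assms z by (simp add: kernel_atom_def abs_mult)
  also have "\<dots> \<le> x ^ i / sqrt z ^ m * (exp (\<alpha> * x / \<sigma>\<^sup>2) * (m / y) ^ m)"
    using 1 assms z by (intro mult_left_mono) auto
  also have "\<dots> = x ^ i * exp (\<alpha> * x / \<sigma>\<^sup>2) * (2 * real m * \<sigma>\<^sup>2 / x\<^sup>2) ^ m * sqrt z ^ m"
    unfolding my power_mult_distrib using z assms by (simp add: field_simps)
  finally show ?thesis .
qed

lemma continuous_on_kernel_atom:
  assumes "0 < \<sigma>" "0 < m"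
  shows "continuous_on ({0<..} \<times> {0..1}) (\<lambda>(x, z). kernel_atom \<alpha> \<sigma> i m x z)"
  unfolding continuous_on_def
proof (clarsimp)
  fix x z :: real
  assume x: "0 < x" and z: "0 \<le> z" "z \<le> 1"
  let ?S = "{0<..} \<times> {0..1::real}" 
  let ?f = "\<lambda>p. kernel_atom \<alpha> \<sigma> i m (fst p) (snd p)"
  have "(?f \<longlongrightarrow> ?f (x, z)) (at (x, z) within ?S)"
  proof (cases "z = 0")
    case True
    let ?B = "\<lambda>p. fst p ^ i * exp (\<alpha> * fst p / \<sigma>\<^sup>2) * (2 * real m * \<sigma>\<^sup>2 / (fst p)\<^sup>2) ^ m * sqrt (snd p) ^ m"
    have "(?B \<longlongrightarrow> ?B (x, z)) (at (x, z) within ?S)"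
      using x assms by (intro tendsto_intros) auto
    then have B: "(?B \<longlongrightarrow> 0) (at (x, z) within ?S)"
      using assms True by (simp add: zero_power)
    have "(?f \<longlongrightarrow> 0) (at (x, z) within ?S)"
    proof (rule Lim_null_comparison[OF _ B])
      show "\<forall>\<^sub>F p in at (x, z) within ?S. norm (?f p) \<le> ?B p"
        unfolding eventually_at_filter
        by (rule always_eventually) (use assms in \<open>auto intro!: kernel_atom_bound\<close>)
    qed
    then show ?thesis using True assms by (simp add: kernel_atom_def zero_power)
  next
    case False
    then show ?thesis using x z assms
      unfolding kernel_atom_def by (intro tendsto_intros) auto
  qed
  then show "((\<lambda>(x, z). kernel_atom \<alpha> \<sigma> i m x z) \<longlongrightarrow> kernel_atom \<alpha> \<sigma> i m x z) (at (x, z) within ?S)"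
    by (simp add: case_prod_beta')
qed

lemma continuous_on_atom_deriv:
  assumes "0 < \<sigma>" "0 < m"
  shows "continuous_on ({0<..} \<times> {0..1}) (\<lambda>(x, z). atom_deriv \<alpha> \<sigma> r i m x z)"
  using assms(2)
proof (induction r arbitrary: i m)
  case 0
  then show ?case using continuous_on_kernel_atom[OF assms(1)] by simp
next
  case (Suc r)
  have "0 < m + 2" by simp
  note c = Suc.IH[OF Suc.prems] Suc.IH[OF this]
  show ?case
    unfolding atom_deriv.simps case_prod_beta'
    by (intro continuous_intros c[unfolded case_prod_beta']) (use assms in auto)
qed

lemma has_derivative_atom_deriv:
  assumes "0 < x" "0 \<le> z" "0 < \<sigma>" "0 < m"
  shows "((\<lambda>x. atom_deriv \<alpha> \<sigma> r i m x z) has_real_derivative atom_deriv \<alpha> \<sigma> (Suc r) i m x z) (at x)"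
  using assms(4)
proof (induction r arbitrary: i m)
  case 0
  show ?case
  proof (cases "z = 0")
    case True
    then show ?thesis using 0 by (simp add: kernel_atom_def zero_power)
  next
    case False
    with assms have z: "0 < z" by simp
    have m: "sqrt z ^ (m + 2) = sqrt z ^ m * z" using z by (simp add: power_add)
    define e where "e = exp (- ((x - \<alpha> * z)\<^sup>2 / (2 * \<sigma>\<^sup>2 * z)))"
    have "((\<lambda>x. - ((x - \<alpha> * z)\<^sup>2 / (2 * \<sigma>\<^sup>2 * z))) has_real_derivative
        - ((2 * (x - \<alpha> * z)) / (2 * (\<sigma>\<^sup>2 * z)))) (at x)"
      unfolding mult.assoc by (intro DERIV_minus DERIV_cdivide) (auto intro!: derivative_eq_intros)
    from DERIV_chain2[OF DERIV_exp this]
    have E: "((\<lambda>x. exp (- ((x - \<alpha> * z)\<^sup>2 / (2 * \<sigma>\<^sup>2 * z)))) has_real_derivative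
        e * - ((x - \<alpha> * z) / (\<sigma>\<^sup>2 * z))) (at x)"
      unfolding e_def mult_minus_right by (simp only: mult_divide_mult_cancel_left[of 2] mult_minus_right)
    have "((\<lambda>x. x ^ i) has_real_derivative real i * x ^ (i - 1)) (at x)"
      by (auto intro!: derivative_eq_intros)
    from DERIV_mult[OF DERIV_cdivide[OF this, of "sqrt z ^ m"] E]
    show ?thesis
      unfolding atom_deriv.simps kernel_atom_def m e_def[symmetric]
      by (rule DERIV_cong) (use z assms in \<open>simp add: field_simps\<close>)
  qed
next
  case (Suc r)
  have "0 < m + 2" by simp
  note d = Suc.IH[OF Suc.prems] Suc.IH[OF this]
  have "((\<lambda>x. real i * atom_deriv \<alpha> \<sigma> r (i - 1) m x z
        - atom_deriv \<alpha> \<sigma> r (i + 1) (m + 2) x z / \<sigma>\<^sup>2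
        + \<alpha> / \<sigma>\<^sup>2 * atom_deriv \<alpha> \<sigma> r i m x z) has_real_derivative
      real i * atom_deriv \<alpha> \<sigma> (Suc r) (i - 1) m x z
        - atom_deriv \<alpha> \<sigma> (Suc r) (i + 1) (m + 2) x z / \<sigma>\<^sup>2
        + \<alpha> / \<sigma>\<^sup>2 * atom_deriv \<alpha> \<sigma> (Suc r) i m x z) (at x)"
    by (intro DERIV_add DERIV_diff DERIV_cmult DERIV_cdivide d)
  then show ?case by (simp only: atom_deriv.simps(2))
qed

text \<open>
  The \<open>r\<close>-th \<open>x\<close>-derivative of the kernel of \<open>u\<^sub>t\<close>; its numerator \<open>x + \<alpha> z\<close> contributes one atom
  for each summand.
\<close>

definition conga_kernel :: "real \<Rightarrow> real \<Rightarrow> nat \<Rightarrow> real \<Rightarrow> real \<Rightarrow> real" where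
  "conga_kernel \<alpha> \<sigma> r x z =
    (atom_deriv \<alpha> \<sigma> r 1 3 x z + \<alpha> * atom_deriv \<alpha> \<sigma> r 0 1 x z) / (2 * \<sigma> * sqrt (2 * pi))"

lemma continuous_on_conga_kernel2:
  assumes "0 < \<sigma>"
  shows "continuous_on ({0<..} \<times> {0..1}) (\<lambda>(x, z). conga_kernel \<alpha> \<sigma> r x z)"
proof -
  note c = continuous_on_atom_deriv[OF assms, of 3] continuous_on_atom_deriv[OF assms, of 1]
  show ?thesis
    unfolding conga_kernel_def case_prod_beta'
    by (intro continuous_intros c[unfolded case_prod_beta']) (use assms in auto)
qed

lemma continuous_on_conga_kernel:
  assumes "0 < \<sigma>" "0 < x"
  shows "continuous_on {0..1} (conga_kernel \<alpha> \<sigma> r x)"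
  using continuous_on_compose2[OF continuous_on_conga_kernel2[OF assms(1)], of "{0..1}" "\<lambda>z. (x, z)"] assms
  by (simp add: continuous_on_Pair image_subset_iff)

lemma has_derivative_conga_kernel:
  assumes "0 < x" "0 \<le> z" "0 < \<sigma>"
  shows "((\<lambda>x. conga_kernel \<alpha> \<sigma> r x z) has_real_derivative conga_kernel \<alpha> \<sigma> (Suc r) x z) (at x)"
  unfolding conga_kernel_def
  by (intro DERIV_add DERIV_cmult DERIV_cdivide has_derivative_atom_deriv assms) auto

definition conga_deriv :: "real \<Rightarrow> real \<Rightarrow> (real \<Rightarrow> real) \<Rightarrow> nat \<Rightarrow> real \<Rightarrow> real" where
  "conga_deriv \<alpha> \<sigma> w r x = integral {0..1} (\<lambda>z. w (1 - z) * conga_kernel \<alpha> \<sigma> r x z)"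

lemma DERIV_integral_kernel:
  fixes g :: "real \<Rightarrow> real"
  assumes g: "continuous_on {0..b} g" and "0 < \<sigma>" "0 < x" "b \<le> 1"
  shows "((\<lambda>x. integral {0..b} (\<lambda>z. g z * conga_kernel \<alpha> \<sigma> r x z)) has_real_derivative
           integral {0..b} (\<lambda>z. g z * conga_kernel \<alpha> \<sigma> (Suc r) x z)) (at x)"
proof -
  have b: "{0..b} \<subseteq> {0..1}" using assms by auto
  have "((\<lambda>x. integral (cbox 0 b) (\<lambda>z. g z * conga_kernel \<alpha> \<sigma> r x z)) has_real_derivative
           integral (cbox 0 b) (\<lambda>z. g z * conga_kernel \<alpha> \<sigma> (Suc r) x z)) (at x within {0<..})"
  proof (rule leibniz_rule_field_derivative)
    fix x z :: real assume "x \<in> {0<..}" "z \<in> cbox 0 b"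
    then show "((\<lambda>x. g z * conga_kernel \<alpha> \<sigma> r x z) has_real_derivative
        g z * conga_kernel \<alpha> \<sigma> (Suc r) x z) (at x within {0<..})"
      by (intro DERIV_cmult has_field_derivative_at_within[OF has_derivative_conga_kernel]) (use assms in auto)
  next
    fix x :: real assume "x \<in> {0<..}"
    then show "(\<lambda>z. g z * conga_kernel \<alpha> \<sigma> r x z) integrable_on cbox 0 b"
      unfolding cbox_interval
      by (intro integrable_continuous_interval continuous_on_mult g
          continuous_on_subset[OF continuous_on_conga_kernel b]) (use assms in auto)
  next
    have "continuous_on ({0<..} \<times> {0..b}) (\<lambda>p. g (snd p))"
      by (rule continuous_on_compose2[OF g]) (auto intro: continuous_intros)
    moreover have "continuous_on ({0<..} \<times> {0..b}) (\<lambda>(x, z). conga_kernel \<alpha> \<sigma> (Suc r) x z)"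
      by (rule continuous_on_subset[OF continuous_on_conga_kernel2]) (use assms in auto)
    ultimately show "continuous_on ({0<..} \<times> cbox 0 b) (\<lambda>(x, z). g z * conga_kernel \<alpha> \<sigma> (Suc r) x z)"
      by (simp add: case_prod_beta', intro continuous_on_mult)
  qed (use assms in auto)
  then show ?thesis using assms by (simp add: at_within_open[of x "{0<..}"])
qed

lemma continuous_on_reversed_path:
  fixes w :: "real \<Rightarrow> real"
  assumes "continuous_on {0..1} w"
  shows "continuous_on {0..1} (\<lambda>z. w (1 - z))"
  by (rule continuous_on_compose2[OF assms]) (auto intro: continuous_intros)

lemma DERIV_conga_deriv:
  assumes "continuous_on {0..1} w" "0 < \<sigma>" "0 < x"
  shows "(conga_deriv \<alpha> \<sigma> w r has_real_derivative conga_deriv \<alpha> \<sigma> w (Suc r) x) (at x)"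
  unfolding conga_deriv_def[abs_def]
  by (rule DERIV_integral_kernel[OF continuous_on_reversed_path[OF assms(1)]]) (use assms in auto)

lemma conga_line_eq_conga_deriv:
  assumes w: "continuous_on {0..1} w" and \<sigma>: "0 < \<sigma>\<^sub>t \<alpha> t" and x: "0 < x"
  shows "conga_line \<alpha> t w x = conga_deriv \<alpha> (\<sigma>\<^sub>t \<alpha> t) w 0 x"
proof -
  let ?\<sigma> = "\<sigma>\<^sub>t \<alpha> t"
  let ?f = "\<lambda>z. w (1 - z) * conga_kernel \<alpha> ?\<sigma> 0 x z"
  have eq: "w (1 - z) * (1 / sqrt (2 * pi)) * ((x + \<alpha> * z) / (2 * ?\<sigma> * z powr (3 / 2))) *
      exp (- ((x - \<alpha> * z)\<^sup>2 / (2 * ?\<sigma>\<^sup>2 * z))) = ?f z" if "z \<in> {0..1}" for z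
  proof (cases "z = 0")
    case False
    with that have z: "0 < z" by simp
    have "z powr (3 / 2) = sqrt z ^ 3"
      using z powr_realpow[of "sqrt z" 3] by (simp add: powr_half_sqrt[symmetric] powr_powr)
    also have "\<dots> = sqrt z * z" using z by (simp add: power3_eq_cube)
    finally have p: "z powr (3 / 2) = sqrt z * z" .
    have p3: "sqrt z ^ 3 = sqrt z * z" using z by (simp add: power3_eq_cube)
    show ?thesis
      unfolding p conga_kernel_def atom_deriv.simps kernel_atom_def p3 using z \<sigma>
      by (simp add: field_simps)
  qed (simp add: conga_kernel_def kernel_atom_def)
  have cont: "continuous_on {0..1} ?f"
    by (intro continuous_on_mult continuous_on_reversed_path[OF w] continuous_on_conga_kernel \<sigma> x)
  have "conga_line \<alpha> t w x = (LBINT z:{0..1}. ?f z)"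
    unfolding conga_line_def by (rule set_lebesgue_integral_cong) (simp, use eq in blast)
  also have "\<dots> = integral {0..1} ?f"
    by (rule set_borel_integral_eq_integral(2)[OF borel_integrable_atLeastAtMost'[OF cont]])
  finally show ?thesis by (simp add: conga_deriv_def)
qed

section \<open>Primitives of the kernels and variance bounds\<close>

text \<open>
  The kernel of \<open>u\<^sub>t\<close> is \<open>d/dz \<Phi>((\<alpha> z - x) / (\<sigma> \<surd>z))\<close> with \<open>\<Phi>\<close> the normal distribution function,
  so the primitive in \<open>z\<close> of its \<open>(r + 1)\<close>-st \<open>x\<close>-derivative is the \<open>(r + 1)\<close>-st \<open>x\<close>-derivative of
  \<open>\<Phi>((\<alpha> z - x) / (\<sigma> \<surd>z))\<close>, again given by atoms. Integration by parts in the path integral turns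
  \<open>u^(r + 1)(x)\<close> into the integral of this function of \<open>1 - s\<close> against \<open>dW(s)\<close>, so covariances of
  derivatives of \<open>u\<^sub>t\<close> are \<open>L\<^sup>2\<close> inner products of these functions.
\<close>

definition wiener_kernel :: "real \<Rightarrow> real \<Rightarrow> nat \<Rightarrow> real \<Rightarrow> real \<Rightarrow> real" where
  "wiener_kernel \<alpha> \<sigma> r x y = - atom_deriv \<alpha> \<sigma> r 0 1 x y / (\<sigma> * sqrt (2 * pi))"

lemma wiener_kernel_DERIV_z:
  assumes "0 < z" "0 < \<sigma>"
  shows "(wiener_kernel \<alpha> \<sigma> 0 x has_real_derivative conga_kernel \<alpha> \<sigma> 1 x z) (at z)"
proof -
  define s where "s = sqrt z"
  have s: "0 < s" "z = s\<^sup>2" using assms by (auto simp: s_def)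
  define e where "e = exp (- ((x - \<alpha> * z)\<^sup>2 / (2 * \<sigma>\<^sup>2 * z)))"
  have "((\<lambda>z. - ((x - \<alpha> * z)\<^sup>2 / (2 * \<sigma>\<^sup>2 * z))) has_real_derivative
      (x\<^sup>2 / z\<^sup>2 - \<alpha>\<^sup>2) / (2 * \<sigma>\<^sup>2)) (at z)"
    using assms by (auto intro!: derivative_eq_intros simp: field_simps power2_eq_square)
  from DERIV_chain2[OF DERIV_exp this]
  have E: "((\<lambda>z. exp (- ((x - \<alpha> * z)\<^sup>2 / (2 * \<sigma>\<^sup>2 * z)))) has_real_derivative
      e * ((x\<^sup>2 / z\<^sup>2 - \<alpha>\<^sup>2) / (2 * \<sigma>\<^sup>2))) (at z)"
    by (simp add: e_def)
  have "((\<lambda>z. inverse (sqrt z)) has_real_derivative - (inverse (sqrt z / 2)) / 4 * inverse z) (at z)"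
    using assms by (auto intro!: derivative_eq_intros simp: field_simps power2_eq_square)
  then have S: "((\<lambda>z. inverse (sqrt z)) has_real_derivative - (1 / (2 * s ^ 3))) (at z)"
    by (rule DERIV_cong) (use s in \<open>simp add: field_simps power2_eq_square power3_eq_cube\<close>)
  have D: "(wiener_kernel \<alpha> \<sigma> 0 x has_real_derivative
      - (- (1 / (2 * s ^ 3)) * e + e * ((x\<^sup>2 / z\<^sup>2 - \<alpha>\<^sup>2) / (2 * \<sigma>\<^sup>2)) * inverse s) / (\<sigma> * sqrt (2 * pi))) (at z)"
    using DERIV_cdivide[OF DERIV_minus[OF DERIV_mult[OF S E]], of "\<sigma> * sqrt (2 * pi)"]
    by (simp add: wiener_kernel_def[abs_def] kernel_atom_def e_def s_def inverse_eq_divide)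
  have conga: "conga_kernel \<alpha> \<sigma> 1 x z
      = e * (1 / s ^ 3 - x\<^sup>2 / (\<sigma>\<^sup>2 * s ^ 5) + \<alpha>\<^sup>2 / (\<sigma>\<^sup>2 * s)) / (2 * \<sigma> * sqrt (2 * pi))"
  proof -
    have atom: "kernel_atom \<alpha> \<sigma> i m x z = x ^ i / s ^ m * e" for i m
      by (simp add: kernel_atom_def e_def s_def)
    show ?thesis
      unfolding conga_kernel_def One_nat_def atom_deriv.simps atom using s(1) assms(2)
      by (simp add: field_simps power_numeral_reduce)
  qed
  show ?thesis
    by (rule DERIV_cong[OF D], unfold conga) (use s assms in \<open>simp add: field_simps power_numeral_reduce\<close>)
qed

lemma continuous_on_atom_deriv_z:
  assumes "0 < \<sigma>" "0 < x" "0 < m"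
  shows "continuous_on {0..1} (atom_deriv \<alpha> \<sigma> r i m x)"
  using continuous_on_compose2[OF continuous_on_atom_deriv[OF assms(1,3)], of "{0..1}" "\<lambda>z. (x, z)"] assms
  by (simp add: continuous_on_Pair image_subset_iff)

lemma continuous_on_wiener_kernel:
  assumes "0 < \<sigma>" "0 < x"
  shows "continuous_on {0..1} (wiener_kernel \<alpha> \<sigma> r x)"
  unfolding wiener_kernel_def[abs_def]
  by (intro continuous_intros continuous_on_atom_deriv_z) (use assms in auto)

text \<open>
  Order \<open>0\<close> is the fundamental theorem of calculus. Each further order follows by differentiating
  the identity in \<open>x\<close>, so that only one \<open>z\<close>-derivative has to be computed by hand.
\<close>

lemma wiener_kernel_eq_integral:
  assumes "0 < \<sigma>" "0 < x" and y: "y \<in> {0..1}"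
  shows "wiener_kernel \<alpha> \<sigma> r x y = integral {0..y} (conga_kernel \<alpha> \<sigma> (Suc r) x)"
  using assms(2)
proof (induction r arbitrary: x)
  case 0
  have sub: "{0..y} \<subseteq> {0..1}" using y by auto
  have "(conga_kernel \<alpha> \<sigma> 1 x has_integral wiener_kernel \<alpha> \<sigma> 0 x y - wiener_kernel \<alpha> \<sigma> 0 x 0) {0..y}"
  proof (rule fundamental_theorem_of_calculus_interior)
    show "continuous_on {0..y} (wiener_kernel \<alpha> \<sigma> 0 x)"
      by (rule continuous_on_subset[OF continuous_on_wiener_kernel[OF assms(1) 0] sub])
    show "(wiener_kernel \<alpha> \<sigma> 0 x has_vector_derivative conga_kernel \<alpha> \<sigma> 1 x z) (at z)" if "z \<in> {0<..<y}" for z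
      using wiener_kernel_DERIV_z[of z \<sigma> \<alpha> x] that assms
      by (simp add: has_real_derivative_iff_has_vector_derivative)
  qed (use y in auto)
  moreover have "wiener_kernel \<alpha> \<sigma> 0 x 0 = 0" by (simp add: wiener_kernel_def kernel_atom_def)
  ultimately show ?case by (simp add: integral_unique)
next
  case (Suc r)
  have "((\<lambda>x. integral {0..y} (\<lambda>z. 1 * conga_kernel \<alpha> \<sigma> (Suc r) x z)) has_real_derivative
      integral {0..y} (\<lambda>z. 1 * conga_kernel \<alpha> \<sigma> (Suc (Suc r)) x z)) (at x)"
    by (rule DERIV_integral_kernel) (use assms Suc.prems in auto)
  then have "((\<lambda>x. integral {0..y} (conga_kernel \<alpha> \<sigma> (Suc r) x)) has_real_derivative
      integral {0..y} (conga_kernel \<alpha> \<sigma> (Suc (Suc r)) x)) (at x)" by simp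
  then have 1: "((\<lambda>x. wiener_kernel \<alpha> \<sigma> r x y) has_real_derivative
      integral {0..y} (conga_kernel \<alpha> \<sigma> (Suc (Suc r)) x)) (at x)"
    by (rule has_field_derivative_transform_within_open[of _ _ _ "{0<..}"])
       (use Suc in auto)
  have 2: "((\<lambda>x. wiener_kernel \<alpha> \<sigma> r x y) has_real_derivative wiener_kernel \<alpha> \<sigma> (Suc r) x y) (at x)"
    unfolding wiener_kernel_def
    by (intro DERIV_cdivide DERIV_minus has_derivative_atom_deriv) (use assms Suc.prems in auto)
  show ?case by (rule DERIV_unique[OF 2 1])
qed

lemma wiener_kernel_0:
  "wiener_kernel \<alpha> \<sigma> 0 x y
    = - exp (- ((x - \<alpha> * y)\<^sup>2 / (2 * \<sigma>\<^sup>2 * y))) / (sqrt (2 * pi) * \<sigma> * sqrt y)"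
  by (simp add: wiener_kernel_def kernel_atom_def)

lemma wiener_kernel_1:
  assumes "0 < y" "0 < \<sigma>"
  shows "wiener_kernel \<alpha> \<sigma> 1 x y = wiener_kernel \<alpha> \<sigma> 0 x y * - ((x - \<alpha> * y) / (\<sigma>\<^sup>2 * y))"
proof -
  define s where "s = sqrt y"
  have s: "0 < s" "y = s\<^sup>2" using assms by (auto simp: s_def)
  show ?thesis
    using s assms(2) by (simp add: wiener_kernel_def kernel_atom_def s_def[symmetric] field_simps power_numeral_reduce)
qed

lemma wiener_kernel_2:
  assumes "0 < y" "0 < \<sigma>"
  shows "wiener_kernel \<alpha> \<sigma> 2 x y
    = wiener_kernel \<alpha> \<sigma> 0 x y * (((x - \<alpha> * y)\<^sup>2 / (\<sigma>\<^sup>2 * y) - 1) / (\<sigma>\<^sup>2 * y))"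
proof -
  define s where "s = sqrt y"
  have s: "0 < s" "y = s\<^sup>2" using assms by (auto simp: s_def)
  show ?thesis
    using s assms(2) by (simp add: wiener_kernel_def kernel_atom_def s_def[symmetric] numeral_2_eq_2)
      (simp add: field_simps power_numeral_reduce)
qed

lemma wiener_kernel_0_square:
  assumes "0 < y" "0 < \<sigma>"
  shows "(wiener_kernel \<alpha> \<sigma> 0 x y)\<^sup>2 = exp (- ((x - \<alpha> * y)\<^sup>2 / (\<sigma>\<^sup>2 * y))) / (2 * pi * \<sigma>\<^sup>2 * y)"
proof -
  have "(exp (- ((x - \<alpha> * y)\<^sup>2 / (2 * \<sigma>\<^sup>2 * y))))\<^sup>2 = exp (- ((x - \<alpha> * y)\<^sup>2 / (\<sigma>\<^sup>2 * y)))"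
  proof -
    have "a / (2 * b * c) + a / (2 * b * c) = a / (b * c)" for a b c :: real
      by (simp add: mult.assoc)
    from this[of "(x - \<alpha> * y)\<^sup>2" "\<sigma>\<^sup>2" y] show ?thesis
      by (simp only: power2_eq_square[of "exp _"] exp_add[symmetric] minus_add_distrib[symmetric])
  qed
  then show ?thesis
    using assms by (simp add: wiener_kernel_0 power_divide power_mult_distrib)
qed

lemma integral_ge_on_subinterval:
  fixes f :: "real \<Rightarrow> real"
  assumes f: "continuous_on {0..1} f" "\<And>y. y \<in> {0..1} \<Longrightarrow> 0 \<le> f y"
    and ab: "0 \<le> a" "a \<le> b" "b \<le> 1" and C: "\<And>y. y \<in> {a..b} \<Longrightarrow> C \<le> f y"
  shows "(b - a) * C \<le> integral {0..1} f"
proof -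
  have sub: "{a..b} \<subseteq> {0..1}" using ab by auto
  have i: "f integrable_on {a..b}" "f integrable_on {0..1}"
    using f(1) continuous_on_subset[OF f(1) sub] by (auto intro: integrable_continuous_interval)
  have "(b - a) * C = integral {a..b} (\<lambda>_. C)" using ab by simp
  also have "\<dots> \<le> integral {a..b} f"
    by (rule integral_le) (use i C in auto)
  also have "\<dots> \<le> integral {0..1} f"
    by (rule integral_subset_le[OF sub i]) (use f in auto)
  finally show ?thesis .
qed

text \<open>
  The form \<open>(u - v q)\<^sup>2\<close> degenerates at \<open>q = u / v\<close> only. Of the two ranges \<open>q \<le> \<mu>\<close> and \<open>q \<ge> 4 \<mu>\<close>,
  at least one stays away from this value: the first if \<open>|u|\<close> dominates, the second if \<open>|v|\<close> does.
\<close>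

lemma square_diff_lower_bound:
  fixes u v q \<mu> :: real
  assumes "0 \<le> q" "0 < \<mu>"
    and cases: "(2 * \<mu> * \<bar>v\<bar> \<le> \<bar>u\<bar> \<and> q \<le> \<mu>) \<or> (\<bar>u\<bar> \<le> 2 * \<mu> * \<bar>v\<bar> \<and> 4 * \<mu> \<le> q)"
  shows "u\<^sup>2 / 8 + \<mu>\<^sup>2 * v\<^sup>2 / 2 \<le> (u - v * q)\<^sup>2"
  using cases
proof
  assume a: "2 * \<mu> * \<bar>v\<bar> \<le> \<bar>u\<bar> \<and> q \<le> \<mu>"
  have "\<bar>v * q\<bar> \<le> \<bar>v\<bar> * \<mu>" using a assms by (simp add: abs_mult mult_left_mono)
  moreover have "2 * (\<bar>v\<bar> * \<mu>) \<le> \<bar>u\<bar>" using a by (simp add: mult_ac)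
  ultimately have "\<bar>u\<bar> / 2 \<le> \<bar>u - v * q\<bar>" using abs_triangle_ineq2[of u "v * q"] by linarith
  then have "(\<bar>u\<bar> / 2)\<^sup>2 \<le> \<bar>u - v * q\<bar>\<^sup>2" by (rule power_mono) simp
  then have 1: "u\<^sup>2 / 4 \<le> (u - v * q)\<^sup>2" by (simp add: power_divide)
  have "(2 * \<mu> * \<bar>v\<bar>)\<^sup>2 \<le> \<bar>u\<bar>\<^sup>2" using a assms by (intro power_mono) auto
  then have "4 * (\<mu>\<^sup>2 * v\<^sup>2) \<le> u\<^sup>2" by (simp add: power_mult_distrib)
  then show ?thesis using 1 by simp
next
  assume a: "\<bar>u\<bar> \<le> 2 * \<mu> * \<bar>v\<bar> \<and> 4 * \<mu> \<le> q"
  have "\<bar>v * q\<bar> \<ge> \<bar>v\<bar> * (4 * \<mu>)" using a assms by (simp add: abs_mult mult_left_mono)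
  moreover have "\<bar>v\<bar> * (4 * \<mu>) = 2 * (2 * \<mu> * \<bar>v\<bar>)" by simp
  ultimately have "2 * \<mu> * \<bar>v\<bar> \<le> \<bar>u - v * q\<bar>" using a abs_triangle_ineq2[of "v * q" u] by linarith
  then have "(2 * \<mu> * \<bar>v\<bar>)\<^sup>2 \<le> \<bar>u - v * q\<bar>\<^sup>2" using assms by (intro power_mono) auto
  then have 1: "4 * (\<mu>\<^sup>2 * v\<^sup>2) \<le> (u - v * q)\<^sup>2" by (simp add: power_mult_distrib)
  have "\<bar>u\<bar>\<^sup>2 \<le> (2 * \<mu> * \<bar>v\<bar>)\<^sup>2" using a by (intro power_mono) auto
  then have "u\<^sup>2 \<le> 4 * (\<mu>\<^sup>2 * v\<^sup>2)" by (simp add: power_mult_distrib)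
  moreover have "0 \<le> \<mu>\<^sup>2 * v\<^sup>2" by simp
  ultimately show ?thesis using 1 by linarith
qed

text \<open>
  Nondegeneracy of \<open>(u'(x), u''(x))\<close>, uniform up to the endpoint \<open>x = \<alpha>\<close>. There only the half
  \<open>y \<le> x / \<alpha>\<close> of the Gaussian bump of the kernel lies in \<open>[0, 1]\<close>, so only this half is used. With
  \<open>q = (x - \<alpha> y) / (\<sigma>\<^sup>2 y)\<close> and the coefficients \<open>u\<close>, \<open>v\<close> of the form,
  the integrand is at least a constant times \<open>(u - v q)\<^sup>2 / \<sigma>\<^sup>2\<close>, and the bump contains two ranges of \<open>y\<close>, of length comparable to \<open>\<sigma>\<close>, on which \<open>q \<le> \<mu>\<close> and
  \<open>q \<ge> 4 \<mu>\<close> respectively, where \<open>\<mu>\<close> is of order \<open>1 / \<sigma>\<close>.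
\<close>

lemma variance_lower_bound:
  fixes \<alpha> \<delta> :: real
  assumes \<delta>: "0 < \<delta>" "\<delta> < \<alpha>"
  shows "\<exists>c>0. \<forall>\<sigma> x u v. 0 < \<sigma> \<longrightarrow> \<sigma> \<le> \<delta> / 2 \<longrightarrow> x \<in> {\<delta>..\<alpha>} \<longrightarrow>
    c / \<sigma> * u\<^sup>2 + c / \<sigma> ^ 3 * v\<^sup>2
      \<le> integral {0..1} (\<lambda>y. (u * wiener_kernel \<alpha> \<sigma> 0 x y + v * wiener_kernel \<alpha> \<sigma> 1 x y)\<^sup>2)"
proof -
  \<comment> \<open>\<open>\<kappa>\<^sup>2\<close> is a lower bound for the \<open>y\<close> in use, since \<open>x - \<alpha> y \<le> \<sigma> \<le> \<delta> / 2\<close> there; \<open>\<eta>\<close> makes \<open>q \<le> \<mu>\<close> hold for \<open>x - \<alpha> y \<le> \<eta> \<sigma>\<close>.\<close>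
  define \<kappa> where "\<kappa> = sqrt (\<delta> / (2 * \<alpha>))"
  have \<kappa>: "0 < \<kappa>" "\<kappa> \<le> 1" "\<kappa>\<^sup>2 = \<delta> / (2 * \<alpha>)" using \<delta> by (auto simp: \<kappa>_def)
  define \<eta> where "\<eta> = \<kappa> ^ 3 / 8"
  have \<kappa>3: "\<kappa> ^ 3 \<le> \<kappa>" using \<kappa> power_decreasing[of 1 3 \<kappa>] by simp
  have \<eta>: "0 < \<eta>" "\<eta> \<le> 1" "\<eta> \<le> \<kappa> / 2" using \<kappa> \<kappa>3 by (auto simp: \<eta>_def)
  define c where "c = \<eta> / \<alpha> * (exp (- 1) / (2 * pi)) * (\<kappa>\<^sup>2 / 128)"
  have c: "0 < c" using \<eta> \<kappa> \<delta> by (simp add: c_def)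
  have "c / \<sigma> * u\<^sup>2 + c / \<sigma> ^ 3 * v\<^sup>2
      \<le> integral {0..1} (\<lambda>y. (u * wiener_kernel \<alpha> \<sigma> 0 x y + v * wiener_kernel \<alpha> \<sigma> 1 x y)\<^sup>2)"
    if \<sigma>: "0 < \<sigma>" "\<sigma> \<le> \<delta> / 2" and x: "x \<in> {\<delta>..\<alpha>}" for \<sigma> x u v
  proof -
    let ?f = "\<lambda>y. (u * wiener_kernel \<alpha> \<sigma> 0 x y + v * wiener_kernel \<alpha> \<sigma> 1 x y)\<^sup>2"
    define \<mu> where "\<mu> = \<kappa> / (8 * \<sigma>)"
    have \<mu>: "0 < \<mu>" using \<kappa> \<sigma> by (simp add: \<mu>_def)
    define L where "L = exp (- 1) / (2 * pi * \<sigma>\<^sup>2) * (u\<^sup>2 / 8 + \<mu>\<^sup>2 * v\<^sup>2 / 2)"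
    have L: "0 \<le> L" by (simp add: L_def)
    have x0: "0 < x" using x \<delta> by auto
    have cont: "continuous_on {0..1} ?f"
      by (intro continuous_intros continuous_on_wiener_kernel \<sigma> x0)
    have pt: "L \<le> ?f y"
      if y: "\<kappa>\<^sup>2 \<le> y" "y \<le> 1" and r: "0 \<le> x - \<alpha> * y" "x - \<alpha> * y \<le> \<kappa> * \<sigma>"
        and cs: "(2 * \<mu> * \<bar>v\<bar> \<le> \<bar>u\<bar> \<and> (x - \<alpha> * y) / (\<sigma>\<^sup>2 * y) \<le> \<mu>) \<or>
          (\<bar>u\<bar> \<le> 2 * \<mu> * \<bar>v\<bar> \<and> 4 * \<mu> \<le> (x - \<alpha> * y) / (\<sigma>\<^sup>2 * y))" for y
    proof -
      have y0: "0 < y" using y \<kappa> by (meson less_le_trans zero_less_power)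
      define q where "q = (x - \<alpha> * y) / (\<sigma>\<^sup>2 * y)"
      have q: "0 \<le> q" using r y0 by (simp add: q_def)
      have "(x - \<alpha> * y)\<^sup>2 \<le> (\<kappa> * \<sigma>)\<^sup>2" using r by (intro power_mono) auto
      also have "\<dots> = \<sigma>\<^sup>2 * \<kappa>\<^sup>2" by (simp add: power_mult_distrib)
      also have "\<dots> \<le> \<sigma>\<^sup>2 * y" using y by (intro mult_left_mono) auto
      finally have "(x - \<alpha> * y)\<^sup>2 / (\<sigma>\<^sup>2 * y) \<le> 1" using y0 \<sigma> by (simp add: divide_le_eq)
      then have "exp (- 1) \<le> exp (- ((x - \<alpha> * y)\<^sup>2 / (\<sigma>\<^sup>2 * y)))" by simp
      moreover have "2 * pi * \<sigma>\<^sup>2 * y \<le> 2 * pi * \<sigma>\<^sup>2" using y by (simp add: mult_left_le)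
      ultimately have w: "exp (- 1) / (2 * pi * \<sigma>\<^sup>2) \<le> (wiener_kernel \<alpha> \<sigma> 0 x y)\<^sup>2"
        unfolding wiener_kernel_0_square[OF y0 \<sigma>(1)] using y0 \<sigma> by (intro frac_le) auto
      have "?f y = (wiener_kernel \<alpha> \<sigma> 0 x y)\<^sup>2 * (u - v * q)\<^sup>2"
        unfolding wiener_kernel_1[OF y0 \<sigma>(1)] q_def[symmetric]
        by (simp add: power_mult_distrib[symmetric] algebra_simps)
      also have "\<dots> \<ge> exp (- 1) / (2 * pi * \<sigma>\<^sup>2) * (u\<^sup>2 / 8 + \<mu>\<^sup>2 * v\<^sup>2 / 2)"
        using cs q \<mu> unfolding q_def[symmetric]
        by (intro mult_mono w square_diff_lower_bound) auto
      finally show ?thesis unfolding L_def .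
    qed
    have y_lower: "\<kappa>\<^sup>2 \<le> y" if "x - \<alpha> * y \<le> \<sigma>" for y
    proof -
      have "\<delta> / 2 \<le> \<alpha> * y" using that \<sigma> x by auto
      then show ?thesis using \<delta> by (simp add: \<kappa>(3) field_simps)
    qed
    have y_upper: "y \<le> 1" if "0 \<le> x - \<alpha> * y" for y
    proof -
      have "\<alpha> * y \<le> \<alpha> * 1" using that x by auto
      then show ?thesis using \<delta> by (simp add: mult_le_cancel_left)
    qed
    have main: "(b - a) * L \<le> integral {0..1} ?f"
      if ab: "x - \<alpha> * a \<le> \<kappa> * \<sigma>" "a \<le> b" "0 \<le> x - \<alpha> * b"
        and cs: "\<And>y. a \<le> y \<Longrightarrow> y \<le> b \<Longrightarrow> (2 * \<mu> * \<bar>v\<bar> \<le> \<bar>u\<bar> \<and> (x - \<alpha> * y) / (\<sigma>\<^sup>2 * y) \<le> \<mu>) \<or>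
          (\<bar>u\<bar> \<le> 2 * \<mu> * \<bar>v\<bar> \<and> 4 * \<mu> \<le> (x - \<alpha> * y) / (\<sigma>\<^sup>2 * y))" for a b
    proof (rule integral_ge_on_subinterval[OF cont])
      have \<kappa>\<sigma>: "\<kappa> * \<sigma> \<le> \<sigma>" using \<kappa> \<sigma> by simp
      show "0 \<le> a" using y_lower[of a] ab \<kappa>\<sigma> by (meson order_trans zero_le_power2)
      show "b \<le> 1" using y_upper[of b] ab by simp
      fix y assume y: "y \<in> {a..b}"
      have "\<alpha> * a \<le> \<alpha> * y" "\<alpha> * y \<le> \<alpha> * b" using y \<delta> by auto
      then have r: "0 \<le> x - \<alpha> * y" "x - \<alpha> * y \<le> \<kappa> * \<sigma>" using ab by auto
      show "L \<le> ?f y"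
        by (intro pt r y_lower y_upper cs) (use r \<kappa>\<sigma> y in auto)
    qed (use ab in auto)
    have "\<eta> * \<sigma> / \<alpha> * L \<le> integral {0..1} ?f"
    proof (cases "2 * \<mu> * \<bar>v\<bar> \<le> \<bar>u\<bar>")
      case True
      have "(x / \<alpha> - (x - \<eta> * \<sigma>) / \<alpha>) * L \<le> integral {0..1} ?f"
      proof (rule main)
        have "\<eta> * \<sigma> \<le> \<kappa> * \<sigma>" using \<eta> \<kappa> \<sigma> by (intro mult_right_mono) auto
        then show "x - \<alpha> * ((x - \<eta> * \<sigma>) / \<alpha>) \<le> \<kappa> * \<sigma>" using \<delta> by simp
        show "(x - \<eta> * \<sigma>) / \<alpha> \<le> x / \<alpha>" using \<eta> \<sigma> \<delta> by (simp add: divide_right_mono)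
        show "0 \<le> x - \<alpha> * (x / \<alpha>)" using \<delta> by simp
        fix y assume y: "(x - \<eta> * \<sigma>) / \<alpha> \<le> y" "y \<le> x / \<alpha>"
        have r: "0 \<le> x - \<alpha> * y" "x - \<alpha> * y \<le> \<eta> * \<sigma>" using y \<delta> by (auto simp: field_simps)
        have "\<eta> * \<sigma> \<le> \<sigma>" using \<eta> \<sigma> by simp
        then have yl: "\<kappa>\<^sup>2 \<le> y" using r by (intro y_lower) auto
        then have y0: "0 < y" using \<kappa> by (meson less_le_trans zero_less_power)
        have "(x - \<alpha> * y) / (\<sigma>\<^sup>2 * y) \<le> (\<eta> * \<sigma>) / (\<sigma>\<^sup>2 * \<kappa>\<^sup>2)"
          using r yl \<sigma> \<kappa>(1) \<eta> by (intro frac_le mult_left_mono) auto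
        also have "\<dots> = \<mu>" using \<sigma> \<kappa>(1) by (simp add: \<mu>_def \<eta>_def field_simps power_numeral_reduce)
        finally show "(2 * \<mu> * \<bar>v\<bar> \<le> \<bar>u\<bar> \<and> (x - \<alpha> * y) / (\<sigma>\<^sup>2 * y) \<le> \<mu>) \<or>
          (\<bar>u\<bar> \<le> 2 * \<mu> * \<bar>v\<bar> \<and> 4 * \<mu> \<le> (x - \<alpha> * y) / (\<sigma>\<^sup>2 * y))" using True by simp
      qed
      then show ?thesis by (simp add: diff_divide_distrib)
    next
      case False
      have "\<eta> * \<sigma> / \<alpha> * L \<le> ((x - \<kappa> * \<sigma> / 2) / \<alpha> - (x - \<kappa> * \<sigma>) / \<alpha>) * L"
      proof (intro mult_right_mono L)
        have "\<eta> * \<sigma> \<le> \<kappa> / 2 * \<sigma>" using \<eta> \<sigma> by (intro mult_right_mono) auto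
        then show "\<eta> * \<sigma> / \<alpha> \<le> (x - \<kappa> * \<sigma> / 2) / \<alpha> - (x - \<kappa> * \<sigma>) / \<alpha>"
          using \<delta> by (simp add: field_simps)
      qed
      also have "\<dots> \<le> integral {0..1} ?f"
      proof (rule main)
        show "x - \<alpha> * ((x - \<kappa> * \<sigma>) / \<alpha>) \<le> \<kappa> * \<sigma>" using \<delta> by simp
        show "(x - \<kappa> * \<sigma>) / \<alpha> \<le> (x - \<kappa> * \<sigma> / 2) / \<alpha>" using \<kappa> \<sigma> \<delta> by (simp add: divide_right_mono)
        show "0 \<le> x - \<alpha> * ((x - \<kappa> * \<sigma> / 2) / \<alpha>)" using \<kappa> \<sigma> \<delta> by simp
        fix y assume y: "(x - \<kappa> * \<sigma>) / \<alpha> \<le> y" "y \<le> (x - \<kappa> * \<sigma> / 2) / \<alpha>"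
        have r: "\<kappa> * \<sigma> / 2 \<le> x - \<alpha> * y" "x - \<alpha> * y \<le> \<kappa> * \<sigma>" using y \<delta> by (auto simp: field_simps)
        have "\<kappa> * \<sigma> \<le> \<sigma>" using \<kappa> \<sigma> by simp
        then have yl: "\<kappa>\<^sup>2 \<le> y" using r by (intro y_lower) auto
        then have y0: "0 < y" using \<kappa> by (meson less_le_trans zero_less_power)
        have r0: "0 \<le> x - \<alpha> * y" using r \<kappa> \<sigma> by (auto intro: order_trans[OF _ r(1)])
        have "4 * \<mu> = (\<kappa> * \<sigma> / 2) / (\<sigma>\<^sup>2 * 1)" using \<sigma> by (simp add: \<mu>_def field_simps power2_eq_square)
        also have "\<dots> \<le> (x - \<alpha> * y) / (\<sigma>\<^sup>2 * y)"
          using r r0 \<sigma> y0 y_upper[OF r0] by (intro frac_le mult_left_mono) auto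
        finally show "(2 * \<mu> * \<bar>v\<bar> \<le> \<bar>u\<bar> \<and> (x - \<alpha> * y) / (\<sigma>\<^sup>2 * y) \<le> \<mu>) \<or>
          (\<bar>u\<bar> \<le> 2 * \<mu> * \<bar>v\<bar> \<and> 4 * \<mu> \<le> (x - \<alpha> * y) / (\<sigma>\<^sup>2 * y))" using False by simp
      qed
      finally show ?thesis .
    qed
    moreover have "c / \<sigma> * u\<^sup>2 + c / \<sigma> ^ 3 * v\<^sup>2 \<le> \<eta> * \<sigma> / \<alpha> * L"
    proof -
      define G where "G = \<eta> / \<alpha> * (exp (- 1) / (2 * pi))"
      have G: "0 < G" using \<eta> \<delta> by (simp add: G_def)
      have "\<eta> * \<sigma> / \<alpha> * L = G * (u\<^sup>2 / \<sigma> / 8 + \<kappa>\<^sup>2 / 128 * (v\<^sup>2 / \<sigma> ^ 3))"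
        using \<sigma> \<delta> by (simp add: G_def L_def \<mu>_def field_simps power_numeral_reduce)
      moreover have "c / \<sigma> * u\<^sup>2 + c / \<sigma> ^ 3 * v\<^sup>2 = G * (\<kappa>\<^sup>2 / 128 * (u\<^sup>2 / \<sigma>) + \<kappa>\<^sup>2 / 128 * (v\<^sup>2 / \<sigma> ^ 3))"
        by (simp add: c_def G_def algebra_simps)
      moreover have "\<kappa>\<^sup>2 / 128 * (u\<^sup>2 / \<sigma>) \<le> 1 / 8 * (u\<^sup>2 / \<sigma>)"
        using \<kappa> \<sigma> power_le_one[of \<kappa> 2] by (intro mult_right_mono) auto
      ultimately show ?thesis using G by simp
    qed
    ultimately show ?thesis by linarith
  qed
  with c show ?thesis by blast
qed

text \<open>
  The variance of \<open>u'''(x)\<close>. With \<open>q = (x - \<alpha> y)\<^sup>2 / (\<sigma>\<^sup>2 y)\<close> the integrand is \<open>\<sigma>^(-6) (q - 1)\<^sup>2 y^(-3) e^(-q)\<close>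
  up to a constant. One quarter of the exponent absorbs the polynomial, another quarter absorbs
  \<open>y^(-3)\<close> (for small \<open>y\<close> because \<open>x \<ge> \<delta>\<close> makes \<open>q\<close> at least of order \<open>1 / y\<close>), and what remains
  is a Gaussian of width comparable to \<open>\<sigma>\<close>, whose integral supplies one power of \<open>\<sigma>\<close>.
\<close>

lemma variance_upper_bound:
  fixes \<alpha> \<delta> :: real
  assumes \<delta>: "0 < \<delta>" "\<delta> < \<alpha>"
  shows "\<exists>V. \<forall>\<sigma> x. 0 < \<sigma> \<longrightarrow> \<sigma> \<le> 1 \<longrightarrow> x \<in> {\<delta>..\<alpha>} \<longrightarrow>
    integral {0..1} (\<lambda>y. (wiener_kernel \<alpha> \<sigma> 2 x y)\<^sup>2) \<le> V / \<sigma> ^ 5"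
proof -
  define D where "D = (2 * \<alpha> / \<delta>) ^ 3 + (48 / \<delta>\<^sup>2) ^ 3"
  have D: "0 \<le> D" using \<delta> by (simp add: D_def)
  define V where "V = 64 * D / (2 * pi) * (sqrt (2 * pi) / \<alpha>)"
  have "integral {0..1} (\<lambda>y. (wiener_kernel \<alpha> \<sigma> 2 x y)\<^sup>2) \<le> V / \<sigma> ^ 5"
    if \<sigma>: "0 < \<sigma>" "\<sigma> \<le> 1" and x: "x \<in> {\<delta>..\<alpha>}" for \<sigma> x
  proof -
    have x0: "0 < x" using x \<delta> by auto
    let ?N = "normal_density (x / \<alpha>) (\<sigma> / \<alpha>)"
    have pt: "(wiener_kernel \<alpha> \<sigma> 2 x y)\<^sup>2 \<le> V / \<sigma> ^ 5 * ?N y" if y: "y \<in> {0..1}" for y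
    proof (cases "y = 0")
      case True
      have "wiener_kernel \<alpha> \<sigma> 2 x 0 = 0"
        by (simp add: wiener_kernel_def kernel_atom_def numeral_2_eq_2)
      then show ?thesis using True D \<delta> \<sigma> by (simp add: V_def)
    next
      case False
      with y have y: "0 < y" "y \<le> 1" by auto
      define q where "q = (x - \<alpha> * y)\<^sup>2 / (\<sigma>\<^sup>2 * y)"
      have q: "0 \<le> q" using y by (simp add: q_def)
      have poly: "(q - 1)\<^sup>2 * exp (- (q / 4)) \<le> 64"
      proof -
        have "(1 + q / 8)\<^sup>2 \<le> (exp (q / 8))\<^sup>2"
          using q by (intro power_mono) auto
        also have "\<dots> = exp (q / 4)" by (simp add: power2_eq_square exp_add[symmetric])
        finally have "64 * (1 + q / 8)\<^sup>2 \<le> 64 * exp (q / 4)" by simp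
        moreover have "(q - 1)\<^sup>2 \<le> 64 * (1 + q / 8)\<^sup>2"
          using q by (simp add: power2_eq_square algebra_simps)
        ultimately show ?thesis by (simp add: exp_minus field_simps)
      qed
      have cube: "exp (- (q / 4)) / y ^ 3 \<le> D"
      proof (cases "\<delta> / (2 * \<alpha>) \<le> y")
        case True
        have "exp (- (q / 4)) / y ^ 3 \<le> 1 / (\<delta> / (2 * \<alpha>)) ^ 3"
          using q True \<delta> by (intro frac_le power_mono) auto
        also have "\<dots> = (2 * \<alpha> / \<delta>) ^ 3" by (simp add: power_divide)
        also have "\<dots> \<le> D" using \<delta> by (simp add: D_def)
        finally show ?thesis .
      next
        case False
        then have "\<alpha> * y \<le> \<delta> / 2" using \<delta> by (simp add: field_simps)
        then have "\<delta> / 2 \<le> x - \<alpha> * y" using x by auto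
        then have "(\<delta> / 2)\<^sup>2 \<le> (x - \<alpha> * y)\<^sup>2" using \<delta> by (intro power_mono) auto
        moreover have "\<sigma>\<^sup>2 * y \<le> y" using \<sigma> y by (simp add: power_le_one mult_left_le_one_le)
        ultimately have "(\<delta> / 2)\<^sup>2 / y \<le> q"
          unfolding q_def using y \<sigma> by (intro frac_le) auto
        then have "\<delta>\<^sup>2 / (48 * y) \<le> q / 12" by (simp add: power_divide)
        then have "(\<delta>\<^sup>2 / (48 * y)) ^ 3 \<le> (1 + q / 4 / real 3) ^ 3"
          using y q by (intro power_mono) auto
        also have "\<dots> \<le> exp (q / 4)"
          using q by (intro exp_ge_one_plus_x_over_n_power_n) auto
        finally have "exp (- (q / 4)) \<le> 1 / (\<delta>\<^sup>2 / (48 * y)) ^ 3"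
          using y \<delta> by (simp add: exp_minus inverse_eq_divide frac_le)
        then have "exp (- (q / 4)) / y ^ 3 \<le> 1 / (\<delta>\<^sup>2 / (48 * y)) ^ 3 / y ^ 3"
          using y by (intro divide_right_mono) auto
        also have "\<dots> = (48 / \<delta>\<^sup>2) ^ 3" using y by (simp add: power_divide power_mult_distrib)
        also have "\<dots> \<le> D" using \<delta> by (simp add: D_def)
        finally show ?thesis .
      qed
      have "exp (- q) = exp (- (q / 4)) * exp (- (q / 4)) * exp (- (q / 2))"
        by (simp add: exp_add[symmetric])
      then have "(wiener_kernel \<alpha> \<sigma> 2 x y)\<^sup>2
          = ((q - 1)\<^sup>2 * exp (- (q / 4))) * (exp (- (q / 4)) / y ^ 3) * exp (- (q / 2)) / (2 * pi * \<sigma> ^ 6)"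
        unfolding wiener_kernel_2[OF y(1) \<sigma>(1)] power_mult_distrib wiener_kernel_0_square[OF y(1) \<sigma>(1)]
          q_def[symmetric] power_divide
        using y \<sigma> by (simp add: field_simps power_numeral_reduce)
      also have "\<dots> \<le> 64 * D * exp (- ((x - \<alpha> * y)\<^sup>2 / (2 * \<sigma>\<^sup>2))) / (2 * pi * \<sigma> ^ 6)"
      proof (intro divide_right_mono mult_mono poly cube D)
        have "(x - \<alpha> * y)\<^sup>2 / \<sigma>\<^sup>2 \<le> q"
          unfolding q_def using y \<sigma> by (intro divide_left_mono) (auto simp: mult_left_le)
        then show "exp (- (q / 2)) \<le> exp (- ((x - \<alpha> * y)\<^sup>2 / (2 * \<sigma>\<^sup>2)))" by simp
      qed (use y \<sigma> D in auto)
      also have "exp (- ((x - \<alpha> * y)\<^sup>2 / (2 * \<sigma>\<^sup>2))) = sqrt (2 * pi) * (\<sigma> / \<alpha>) * ?N y"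
      proof -
        have "(y - x / \<alpha>)\<^sup>2 / (2 * (\<sigma> / \<alpha>)\<^sup>2) = (x - \<alpha> * y)\<^sup>2 / (2 * \<sigma>\<^sup>2)"
          using \<sigma> \<delta> by (simp add: field_simps power2_eq_square)
        moreover have "sqrt (2 * pi * (\<sigma> / \<alpha>)\<^sup>2) = sqrt (2 * pi) * (\<sigma> / \<alpha>)"
          using \<sigma> \<delta> by (simp add: real_sqrt_mult)
        ultimately show ?thesis unfolding normal_density_def using \<sigma> \<delta> by simp
      qed
      also have "64 * D * (sqrt (2 * pi) * (\<sigma> / \<alpha>) * ?N y) / (2 * pi * \<sigma> ^ 6) = V / \<sigma> ^ 5 * ?N y"
        using \<sigma> \<delta> by (simp add: V_def field_simps power_numeral_reduce)
      finally show ?thesis .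
    qed
    have N: "?N integrable_on UNIV" "integral UNIV ?N = 1"
      using integrable_on_lborel[OF integrable_normal_density] integral_lborel[OF integrable_normal_density]
        integral_normal_density \<sigma> \<delta> by auto
    have N01: "?N integrable_on {0..1}"
      using N(1) by (rule integrable_on_subinterval) simp
    have "integral {0..1} (\<lambda>y. (wiener_kernel \<alpha> \<sigma> 2 x y)\<^sup>2) \<le> integral {0..1} (\<lambda>y. V / \<sigma> ^ 5 * ?N y)"
      by (intro integral_le integrable_continuous_interval continuous_intros continuous_on_wiener_kernel
          integrable_on_mult_right N01 pt \<sigma> x0)
    also have "\<dots> = V / \<sigma> ^ 5 * integral {0..1} ?N"
      by (rule Henstock_Kurzweil_Integration.integral_mult_right)
    also have "\<dots> \<le> V / \<sigma> ^ 5 * 1"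
    proof (intro mult_left_mono)
      show "integral {0..1} ?N \<le> 1"
        using integral_subset_le[OF _ N01 N(1)] N(2) by simp
      show "0 \<le> V / \<sigma> ^ 5" using D \<sigma> \<delta> by (simp add: V_def)
    qed
    finally show ?thesis by simp
  qed
  then show ?thesis by blast
qed

section \<open>Exponentially tilted Gaussian small-ball estimates\<close>

text \<open>
  By completing the square, the tilt \<open>exp(e X)\<close> turns \<open>N(0, s\<^sup>2)\<close> into a multiple of \<open>N(s\<^sup>2 e, s\<^sup>2)\<close>.
  The new mean only rotates the characteristic function, whose decay in \<open>b\<close> is therefore intact.
\<close>

lemma tilted_char_normal:
  fixes X :: "'a \<Rightarrow> real" and b e s :: real
  assumes X: "distributed M lborel X (normal_density 0 s)" and s: "0 < s"
  shows "integrable M (\<lambda>\<omega>. iexp (b * X \<omega>) * exp (e * X \<omega>))" (is ?I)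
    and "cmod (\<integral>\<omega>. iexp (b * X \<omega>) * exp (e * X \<omega>) \<partial>M) = exp (s\<^sup>2 * (e\<^sup>2 - b\<^sup>2) / 2)" (is ?E)
proof -
  have rvX: "X \<in> borel_measurable M"
    using distributed_measurable[OF X] by simp
  have Xd: "distr M lborel X = density lborel (\<lambda>x. ennreal (normal_density 0 s x))"
    using X by (simp add: distributed_def)
  define g where "g = (\<lambda>x. iexp (b * x) * complex_of_real (exp (e * x)))"
  have gm [measurable]: "g \<in> borel_measurable borel" by (simp add: g_def)
  have shift: "normal_density 0 s x * exp (e * x) = exp (s\<^sup>2 * e\<^sup>2 / 2) * normal_density (s\<^sup>2 * e) s x" for x
  proof -
    have "- (x\<^sup>2 / (2 * s\<^sup>2)) + e * x = s\<^sup>2 * e\<^sup>2 / 2 + - ((x - s\<^sup>2 * e)\<^sup>2 / (2 * s\<^sup>2))"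
      using s by (simp add: field_simps power2_eq_square)
    then have "exp (- (x\<^sup>2 / (2 * s\<^sup>2))) * exp (e * x) = exp (s\<^sup>2 * e\<^sup>2 / 2) * exp (- ((x - s\<^sup>2 * e)\<^sup>2 / (2 * s\<^sup>2)))"
      by (simp only: exp_add[symmetric])
    then show ?thesis by (simp add: normal_density_def)
  qed
  have g': "normal_density 0 s x *\<^sub>R g x = complex_of_real (exp (s\<^sup>2 * e\<^sup>2 / 2)) * (normal_density (s\<^sup>2 * e) s x *\<^sub>R iexp (b * x))" for x
  proof -
    have "normal_density 0 s x *\<^sub>R g x = iexp (b * x) * complex_of_real (normal_density 0 s x * exp (e * x))"
      by (simp add: g_def scaleR_conv_of_real)
    then show ?thesis unfolding shift by (simp add: scaleR_conv_of_real)
  qed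
  have int: "integrable lborel (\<lambda>x. normal_density (s\<^sup>2 * e) s x *\<^sub>R iexp (b * x))"
    using integrable_normal_density[OF s, of "s\<^sup>2 * e"]
    by (rule Bochner_Integration.integrable_bound) (auto simp: normal_density_nonneg)
  have "integrable lborel (\<lambda>x. normal_density 0 s x *\<^sub>R g x)"
    unfolding g' using int by (rule integrable_mult_right)
  then have "integrable (distr M lborel X) g"
    unfolding Xd by (subst integrable_density) auto
  then show ?I
    using rvX by (subst (asm) integrable_distr_eq) (auto simp: g_def)
  have "(\<integral>\<omega>. iexp (b * X \<omega>) * exp (e * X \<omega>) \<partial>M) = (\<integral>x. g x \<partial>distr M lborel X)"
    using rvX by (subst integral_distr) (auto simp: g_def)
  also have "\<dots> = (\<integral>x. normal_density 0 s x *\<^sub>R g x \<partial>lborel)"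
    unfolding Xd by (subst integral_density) auto
  also have "\<dots> = exp (s\<^sup>2 * e\<^sup>2 / 2) * (\<integral>x. normal_density (s\<^sup>2 * e) s x *\<^sub>R iexp (b * x) \<partial>lborel)"
    unfolding g' by (rule integral_mult_right_zero)
  also have "(\<integral>x. normal_density (s\<^sup>2 * e) s x *\<^sub>R iexp (b * x) \<partial>lborel)
      = \<bar>s\<bar> *\<^sub>R (\<integral>u. normal_density (s\<^sup>2 * e) s (s\<^sup>2 * e + s * u) *\<^sub>R iexp (b * (s\<^sup>2 * e + s * u)) \<partial>lborel)"
    using s by (intro lborel_integral_real_affine) simp
  also have "\<dots> = \<bar>s\<bar> *\<^sub>R (\<integral>u. (iexp (b * s\<^sup>2 * e) / s) * (std_normal_density u *\<^sub>R iexp ((b * s) * u)) \<partial>lborel)"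
  proof (intro arg_cong[of _ _ "\<lambda>x. \<bar>s\<bar> *\<^sub>R x"] Bochner_Integration.integral_cong refl)
    fix u :: real
    have 1: "normal_density (s\<^sup>2 * e) s (s\<^sup>2 * e + s * u) = std_normal_density u / s"
      using s by (simp add: normal_density_def real_sqrt_mult power_mult_distrib)
    have 2: "iexp (b * (s\<^sup>2 * e + s * u)) = iexp (b * s\<^sup>2 * e) * iexp ((b * s) * u)"
      by (simp add: exp_add[symmetric] algebra_simps)
    show "normal_density (s\<^sup>2 * e) s (s\<^sup>2 * e + s * u) *\<^sub>R iexp (b * (s\<^sup>2 * e + s * u)) =
        (iexp (b * s\<^sup>2 * e) / s) * (std_normal_density u *\<^sub>R iexp ((b * s) * u))"
      unfolding 1 2 by (simp add: scaleR_conv_of_real)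
  qed
  also have "\<dots> = \<bar>s\<bar> *\<^sub>R ((iexp (b * s\<^sup>2 * e) / s) * (\<integral>u. std_normal_density u *\<^sub>R iexp ((b * s) * u) \<partial>lborel))"
    by (simp only: integral_mult_right_zero)
  also have "(\<integral>u. std_normal_density u *\<^sub>R iexp ((b * s) * u) \<partial>lborel) = char std_normal_distribution (b * s)"
    unfolding char_def by (subst integral_density) auto
  also have "\<dots> = complex_of_real (exp (- ((b * s)\<^sup>2) / 2))"
    by (simp add: char_std_normal_distribution)
  finally have "cmod (\<integral>\<omega>. iexp (b * X \<omega>) * exp (e * X \<omega>) \<partial>M)
      = exp (s\<^sup>2 * e\<^sup>2 / 2) * exp (- ((b * s)\<^sup>2) / 2)"
    using s by (simp add: norm_mult norm_divide)
  also have "\<dots> = exp (s\<^sup>2 * (e\<^sup>2 - b\<^sup>2) / 2)"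
    by (simp only: exp_add[symmetric]) (simp add: field_simps power_mult_distrib)
  finally show ?E .
qed

lemma (in prob_space) tilted_char_sum:
  fixes \<xi> :: "'i \<Rightarrow> 'a \<Rightarrow> real" and b e :: "'i \<Rightarrow> real"
  assumes ind: "indep_vars (\<lambda>_. borel) \<xi> I" and I: "finite I" and s: "0 < s"
    and \<xi>: "\<And>i. i \<in> I \<Longrightarrow> distributed M lborel (\<xi> i) (normal_density 0 s)"
  shows "integrable M (\<lambda>\<omega>. iexp (\<Sum>i\<in>I. b i * \<xi> i \<omega>) * exp (\<Sum>i\<in>I. e i * \<xi> i \<omega>))" (is ?I)
    and "cmod (\<integral>\<omega>. iexp (\<Sum>i\<in>I. b i * \<xi> i \<omega>) * exp (\<Sum>i\<in>I. e i * \<xi> i \<omega>) \<partial>M)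
      = exp (s\<^sup>2 * ((\<Sum>i\<in>I. (e i)\<^sup>2) - (\<Sum>i\<in>I. (b i)\<^sup>2)) / 2)" (is ?E)
proof -
  let ?Y = "\<lambda>i \<omega>. iexp (b i * \<xi> i \<omega>) * complex_of_real (exp (e i * \<xi> i \<omega>))"
  have indY: "indep_vars (\<lambda>_. borel) ?Y I"
    by (rule indep_vars_compose2[OF ind, where Y = "\<lambda>i x. iexp (b i * x) * complex_of_real (exp (e i * x))"]) simp
  have intY: "integrable M (?Y i)" if "i \<in> I" for i
    using tilted_char_normal(1)[OF \<xi>[OF that] s] by simp
  have eq: "iexp (\<Sum>i\<in>I. b i * \<xi> i \<omega>) * complex_of_real (exp (\<Sum>i\<in>I. e i * \<xi> i \<omega>)) = (\<Prod>i\<in>I. ?Y i \<omega>)" for \<omega>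
    by (simp add: exp_sum[OF I] sum_distrib_left prod.distrib)
  show ?I unfolding eq using indep_vars_integrable[OF I indY intY] by simp
  have "cmod (\<integral>\<omega>. iexp (\<Sum>i\<in>I. b i * \<xi> i \<omega>) * exp (\<Sum>i\<in>I. e i * \<xi> i \<omega>) \<partial>M)
      = (\<Prod>i\<in>I. cmod (\<integral>\<omega>. ?Y i \<omega> \<partial>M))"
  proof -
    have "(\<integral>\<omega>. (\<Prod>i\<in>I. ?Y i \<omega>) \<partial>M) = (\<Prod>i\<in>I. \<integral>\<omega>. ?Y i \<omega> \<partial>M)"
      by (rule indep_vars_lebesgue_integral[OF I indY intY])
    then show ?thesis unfolding eq by (simp only: prod_norm)
  qed
  also have "\<dots> = (\<Prod>i\<in>I. exp (s\<^sup>2 * ((e i)\<^sup>2 - (b i)\<^sup>2) / 2))"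
    by (intro prod.cong refl tilted_char_normal(2)[OF \<xi> s])
  also have "\<dots> = exp (s\<^sup>2 * ((\<Sum>i\<in>I. (e i)\<^sup>2) - (\<Sum>i\<in>I. (b i)\<^sup>2)) / 2)"
    by (simp add: exp_sum[OF I, symmetric] sum_divide_distrib[symmetric] sum_distrib_left[symmetric] sum_subtractf)
  finally show ?E .
qed

text \<open>
  The weight \<open>exp(- (X / A)\<^sup>2 / 2)\<close> is the characteristic function of a standard normal \<open>u\<close> at \<open>X / A\<close>.
  After exchanging the expectations, the decay in \<open>u\<close> confines the average over \<open>u\<close> to a window
  of width of order \<open>A / \<surd>l\<close>: this is the small-ball factor.
\<close>

lemma (in prob_space) gaussian_weight_step:
  fixes X :: "'a \<Rightarrow> real" and F :: "'a \<Rightarrow> complex"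
  assumes X [measurable]: "X \<in> borel_measurable M" and F: "integrable M F"
    and A: "0 < A" and l: "0 < l" and c: "0 \<le> c"
    and decay: "\<And>u. cmod (\<integral>\<omega>. iexp (u * X \<omega>) * F \<omega> \<partial>M) \<le> c * exp (- (l * u\<^sup>2 / 2))"
  shows "cmod (\<integral>\<omega>. exp (- ((X \<omega> / A)\<^sup>2 / 2)) * F \<omega> \<partial>M) \<le> c * A / sqrt l"
proof -
  let ?N = std_normal_distribution
  interpret N: real_distribution ?N by (rule real_dist_normal_dist)
  interpret P: pair_sigma_finite M ?N ..
  have Fm [measurable]: "F \<in> borel_measurable M" using F by auto
  let ?f = "\<lambda>\<omega> u. iexp (u / A * X \<omega>) * F \<omega>"
  have int: "integrable (M \<Otimes>\<^sub>M ?N) (case_prod ?f)"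
  proof (rule P.Fubini_integrable)
    show "case_prod ?f \<in> borel_measurable (M \<Otimes>\<^sub>M ?N)" by measurable
    show "integrable M (\<lambda>\<omega>. \<integral>u. norm (case_prod ?f (\<omega>, u)) \<partial>?N)"
      using F by (simp add: norm_mult N.prob_space[simplified])
    show "AE \<omega> in M. integrable ?N (\<lambda>u. case_prod ?f (\<omega>, u))"
    proof (rule AE_I2)
      fix \<omega> assume "\<omega> \<in> space M"
      have "(\<lambda>u. ?f \<omega> u) \<in> borel_measurable ?N" by measurable
      then show "integrable ?N (\<lambda>u. case_prod ?f (\<omega>, u))"
        by (intro N.integrable_const_bound[where B = "cmod (F \<omega>)"]) (auto simp: norm_mult)
    qed
  qed
  have ch: "(\<integral>u. ?f \<omega> u \<partial>?N) = exp (- ((X \<omega> / A)\<^sup>2 / 2)) * F \<omega>" for \<omega>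
  proof -
    have "(\<integral>u. ?f \<omega> u \<partial>?N) = (\<integral>u. iexp ((X \<omega> / A) * u) \<partial>?N) * F \<omega>"
      by (subst integral_mult_left_zero) (simp add: mult.commute)
    also have "(\<integral>u. iexp ((X \<omega> / A) * u) \<partial>?N) = char ?N (X \<omega> / A)"
      by (simp add: char_def)
    finally show ?thesis by (simp add: char_std_normal_distribution)
  qed
  have "(\<integral>\<omega>. exp (- ((X \<omega> / A)\<^sup>2 / 2)) * F \<omega> \<partial>M) = (\<integral>\<omega>. (\<integral>u. ?f \<omega> u \<partial>?N) \<partial>M)"
    by (simp only: ch)
  also have "\<dots> = (\<integral>u. (\<integral>\<omega>. ?f \<omega> u \<partial>M) \<partial>?N)"
    by (rule P.Fubini_integral[OF int, symmetric])
  also have "cmod \<dots> \<le> (\<integral>u. cmod (\<integral>\<omega>. ?f \<omega> u \<partial>M) \<partial>?N)"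
    by (rule integral_norm_bound)
  also have "\<dots> \<le> (\<integral>u. c * exp (- (l * (u / A)\<^sup>2 / 2)) \<partial>?N)"
  proof (rule integral_mono)
    show "integrable ?N (\<lambda>u. cmod (\<integral>\<omega>. ?f \<omega> u \<partial>M))"
      using P.integrable_snd[OF int] by (rule integrable_norm)
    have "(\<lambda>u. c * exp (- (l * (u / A)\<^sup>2 / 2))) \<in> borel_measurable ?N" by measurable
    then show "integrable ?N (\<lambda>u. c * exp (- (l * (u / A)\<^sup>2 / 2)))"
      using c l by (intro N.integrable_const_bound[where B = c]) (auto simp: mult_le_cancel_left2)
  qed (rule decay)
  also have "\<dots> = (\<integral>u. std_normal_density u * (c * exp (- (l * (u / A)\<^sup>2 / 2))) \<partial>lborel)"
    by (subst integral_density) auto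
  also have "\<dots> \<le> (\<integral>u. c * A / sqrt l * normal_density 0 (A / sqrt l) u \<partial>lborel)"
  proof (rule integral_mono')
    show "integrable lborel (\<lambda>u. c * A / sqrt l * normal_density 0 (A / sqrt l) u)"
      using A l by (intro integrable_mult_right integrable_normal_density) auto
    fix u :: real
    have "std_normal_density u \<le> 1 / sqrt (2 * pi)" 
      by (simp add: std_normal_density_def divide_right_mono)
    then have "std_normal_density u * (c * exp (- (l * (u / A)\<^sup>2 / 2)))
        \<le> 1 / sqrt (2 * pi) * (c * exp (- (l * (u / A)\<^sup>2 / 2)))"
      using c by (intro mult_right_mono) auto
    also have "\<dots> = c * A / sqrt l * normal_density 0 (A / sqrt l) u"
    proof -
      have "u\<^sup>2 / (2 * (A / sqrt l)\<^sup>2) = l * (u / A)\<^sup>2 / 2"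
        using A l by (simp add: power_divide field_simps)
      moreover have "sqrt (2 * pi * (A / sqrt l)\<^sup>2) = sqrt (2 * pi) * (A / sqrt l)"
        using A l by (simp add: real_sqrt_mult)
      ultimately show ?thesis
        unfolding normal_density_def using A l by (simp add: field_simps)
    qed
    finally show "std_normal_density u * (c * exp (- (l * (u / A)\<^sup>2 / 2)))
      \<le> c * A / sqrt l * normal_density 0 (A / sqrt l) u" .
    show "0 \<le> c * A / sqrt l * normal_density 0 (A / sqrt l) u"
      using c A l by simp
  qed
  also have "\<dots> = c * A / sqrt l"
    using A l by simp
  finally show ?thesis .
qed

text \<open>
  One factor at a time: the bound for the first weight holds for every character in \<open>Y\<close> and
  keeps the decay in \<open>v\<close>, so it serves as the hypothesis for the second weight.
\<close>

lemma (in prob_space) gaussian_weight_pair: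
  fixes X Y :: "'a \<Rightarrow> real" and F :: "'a \<Rightarrow> real"
  assumes X [measurable]: "X \<in> borel_measurable M" and Y [measurable]: "Y \<in> borel_measurable M"
    and F: "integrable M F" and F0: "\<And>\<omega>. 0 \<le> F \<omega>"
    and A: "0 < A" and B: "0 < B" and l: "0 < l" and m: "0 < m" and c: "0 \<le> c"
    and decay: "\<And>u v. cmod (\<integral>\<omega>. iexp (u * X \<omega> + v * Y \<omega>) * F \<omega> \<partial>M)
      \<le> c * exp (- ((l * u\<^sup>2 + m * v\<^sup>2) / 2))"
  shows "(\<integral>\<omega>. exp (- ((X \<omega> / A)\<^sup>2 / 2)) * exp (- ((Y \<omega> / B)\<^sup>2 / 2)) * F \<omega> \<partial>M) \<le> c * A * B / sqrt (l * m)"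
proof -
  have Fm [measurable]: "F \<in> borel_measurable M" using F by auto
  have "cmod (\<integral>\<omega>. exp (- ((Y \<omega> / B)\<^sup>2 / 2)) * (exp (- ((X \<omega> / A)\<^sup>2 / 2)) * complex_of_real (F \<omega>)) \<partial>M)
      \<le> (c * A / sqrt l) * B / sqrt m"
  proof (rule gaussian_weight_step[OF Y _ B m])
    show "integrable M (\<lambda>\<omega>. complex_of_real (exp (- ((X \<omega> / A)\<^sup>2 / 2))) * complex_of_real (F \<omega>))"
      by (rule Bochner_Integration.integrable_bound[OF F]) (auto simp: norm_mult intro!: mult_left_le_one_le)
    show "0 \<le> c * A / sqrt l" using A c l by simp
    fix v
    have "cmod (\<integral>\<omega>. exp (- ((X \<omega> / A)\<^sup>2 / 2)) * (iexp (v * Y \<omega>) * complex_of_real (F \<omega>)) \<partial>M)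
        \<le> (c * exp (- (m * v\<^sup>2 / 2))) * A / sqrt l"
    proof (rule gaussian_weight_step[OF X _ A l])
      show "integrable M (\<lambda>\<omega>. iexp (v * Y \<omega>) * complex_of_real (F \<omega>))"
        by (rule Bochner_Integration.integrable_bound[OF F]) (auto simp: norm_mult)
      show "0 \<le> c * exp (- (m * v\<^sup>2 / 2))" using c by simp
      fix u
      have "(\<integral>\<omega>. iexp (u * X \<omega>) * (iexp (v * Y \<omega>) * complex_of_real (F \<omega>)) \<partial>M)
          = (\<integral>\<omega>. iexp (u * X \<omega> + v * Y \<omega>) * F \<omega> \<partial>M)"
        by (intro Bochner_Integration.integral_cong refl) (simp add: distrib_left exp_add mult.assoc)
      also have "cmod \<dots> \<le> c * exp (- ((l * u\<^sup>2 + m * v\<^sup>2) / 2))" by (rule decay)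
      also have "\<dots> = c * exp (- (m * v\<^sup>2 / 2)) * exp (- (l * u\<^sup>2 / 2))"
        by (simp add: mult.assoc exp_add[symmetric] add_divide_distrib)
      finally show "cmod (\<integral>\<omega>. iexp (u * X \<omega>) * (iexp (v * Y \<omega>) * complex_of_real (F \<omega>)) \<partial>M)
          \<le> c * exp (- (m * v\<^sup>2 / 2)) * exp (- (l * u\<^sup>2 / 2))" .
    qed
    then show "cmod (\<integral>\<omega>. iexp (v * Y \<omega>) * (exp (- ((X \<omega> / A)\<^sup>2 / 2)) * complex_of_real (F \<omega>)) \<partial>M)
        \<le> c * A / sqrt l * exp (- (m * v\<^sup>2 / 2))"
      by (simp add: mult_ac)
  qed
  also have "(\<integral>\<omega>. exp (- ((Y \<omega> / B)\<^sup>2 / 2)) * (exp (- ((X \<omega> / A)\<^sup>2 / 2)) * complex_of_real (F \<omega>)) \<partial>M)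
      = complex_of_real (\<integral>\<omega>. exp (- ((X \<omega> / A)\<^sup>2 / 2)) * exp (- ((Y \<omega> / B)\<^sup>2 / 2)) * F \<omega> \<partial>M)"
    by (subst integral_complex_of_real[symmetric]) (intro Bochner_Integration.integral_cong refl, simp)
  also have "cmod \<dots> = (\<integral>\<omega>. exp (- ((X \<omega> / A)\<^sup>2 / 2)) * exp (- ((Y \<omega> / B)\<^sup>2 / 2)) * F \<omega> \<partial>M)"
    using F0 by (simp add: integral_nonneg_AE)
  finally show ?thesis by (simp add: real_sqrt_mult)
qed

section \<open>Path integrals as limits of increment sums\<close>

lemma integral_combine_cells:
  fixes f :: "real \<Rightarrow> real"
  assumes f: "continuous_on {0..1} f" and n: "0 < n" and m: "m \<le> n"
  shows "integral {0..real m / real n} f = (\<Sum>j<m. integral {real j / real n..real (Suc j) / real n} f)"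
  using m
proof (induction m)
  case 0
  show ?case by simp
next
  case (Suc m)
  have "f integrable_on {0..real (Suc m) / real n}"
    by (rule integrable_continuous_interval[OF continuous_on_subset[OF f]]) (use Suc.prems n in auto)
  then have "integral {0..real m / real n} f + integral {real m / real n..real (Suc m) / real n} f
      = integral {0..real (Suc m) / real n} f"
    by (intro Henstock_Kurzweil_Integration.integral_combine) (auto simp: divide_right_mono)
  then show ?case using Suc by simp
qed

text \<open>
  With \<open>k = 1\<close> these are Riemann sums; for general \<open>k\<close> they are what summation by parts leaves of a
  sum of increments.
\<close>

lemma stieltjes_sum_tendsto:
  fixes g k :: "real \<Rightarrow> real"
  assumes g: "continuous_on {0..1} g" and k: "continuous_on {0..1} k"
  shows "(\<lambda>n. \<Sum>j<n. g (real j / real n) * integral {real j / real n..real (Suc j) / real n} k)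
    \<longlonglongrightarrow> integral {0..1} (\<lambda>z. g z * k z)"
proof (rule metric_LIMSEQ_I)
  fix r :: real assume r: "0 < r"
  have "bounded (k ` {0..1})"
    by (rule compact_imp_bounded[OF compact_continuous_image[OF k]]) simp
  then obtain B where B: "0 < B" "\<And>z. z \<in> {0..1} \<Longrightarrow> \<bar>k z\<bar> \<le> B"
    by (auto simp: bounded_pos)
  have "uniformly_continuous_on {0..1} g"
    by (rule compact_uniformly_continuous[OF g]) simp
  moreover define \<eta> where "\<eta> = r / (2 * B)"
  moreover have "0 < \<eta>" using r B by (simp add: \<eta>_def)
  ultimately obtain d where d: "0 < d"
    "\<And>y z. y \<in> {0..1} \<Longrightarrow> z \<in> {0..1} \<Longrightarrow> dist z y < d \<Longrightarrow> dist (g z) (g y) < \<eta>"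
    unfolding uniformly_continuous_on_def by metis
  obtain N :: nat where N: "1 / d < real N" using reals_Archimedean2 by blast
  have gk: "continuous_on {0..1} (\<lambda>z. g z * k z)"
    by (intro continuous_intros g k)
  have "dist (\<Sum>j<n. g (real j / real n) * integral {real j / real n..real (Suc j) / real n} k)
      (integral {0..1} (\<lambda>z. g z * k z)) < r" if n: "N \<le> n" for n
  proof -
    have n0: "0 < n" using N n d(1) by (cases n) (auto intro: ccontr simp: field_simps)
    have nd: "1 / real n < d"
      using N n d(1) n0 by (simp add: field_simps) (smt (verit) mult_left_mono of_nat_mono)
    let ?a = "\<lambda>j. real j / real n" 
    have cell: "\<bar>g (?a j) * integral {?a j..?a (Suc j)} k - integral {?a j..?a (Suc j)} (\<lambda>z. g z * k z)\<bar>
        \<le> (\<eta> * B) * (1 / n)" if j: "j < n" for j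
    proof -
      have sub: "{?a j..?a (Suc j)} \<subseteq> {0..1}" using j n0 by auto
      have ik: "k integrable_on {?a j..?a (Suc j)}"
        by (rule integrable_continuous_interval[OF continuous_on_subset[OF k sub]])
      have igk: "(\<lambda>z. g z * k z) integrable_on {?a j..?a (Suc j)}"
        by (rule integrable_continuous_interval[OF continuous_on_subset[OF gk sub]])
      have "g (?a j) * integral {?a j..?a (Suc j)} k - integral {?a j..?a (Suc j)} (\<lambda>z. g z * k z)
          = integral {?a j..?a (Suc j)} (\<lambda>z. g (?a j) * k z - g z * k z)"
      proof -
        have "(\<lambda>z. g (?a j) * k z) integrable_on {?a j..?a (Suc j)}"
          using ik by (rule integrable_on_mult_right)
        from Henstock_Kurzweil_Integration.integral_diff[OF this igk] show ?thesis
          by (simp only: Henstock_Kurzweil_Integration.integral_mult_right)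
      qed
      also have "\<bar>\<dots>\<bar> \<le> (\<eta> * B) * (?a (Suc j) - ?a j)"
      proof -
        have "norm (integral {?a j..?a (Suc j)} (\<lambda>z. g (?a j) * k z - g z * k z)) \<le> (\<eta> * B) * (?a (Suc j) - ?a j)"
        proof (rule integral_bound)
          show "?a j \<le> ?a (Suc j)" by (simp add: divide_right_mono)
          show "continuous_on {?a j..?a (Suc j)} (\<lambda>z. g (?a j) * k z - g z * k z)"
            by (intro continuous_intros continuous_on_subset[OF k sub] continuous_on_subset[OF g sub])
          fix z assume z: "z \<in> {?a j..?a (Suc j)}"
          have z01: "z \<in> {0..1}" using z sub by blast
          have a01: "?a j \<in> {0..1}" using j by (auto simp: divide_le_eq)
          have "dist (?a j) z \<le> 1 / real n"
          proof -
            have "?a (Suc j) = ?a j + 1 / real n" by (simp add: add_divide_distrib)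
            then have "?a j \<le> z \<and> z \<le> ?a j + 1 / real n" using z by simp
            then show ?thesis by (auto simp: dist_real_def)
          qed
          then have "dist (g (?a j)) (g z) < \<eta>"
            using nd z01 a01 by (intro d(2)) auto
          then have "\<bar>g (?a j) - g z\<bar> * \<bar>k z\<bar> \<le> \<eta> * B"
            using B z01 by (intro mult_mono) (auto simp: dist_real_def dist_commute abs_minus_commute)
          then show "norm (g (?a j) * k z - g z * k z) \<le> \<eta> * B"
            by (simp add: left_diff_distrib[symmetric] abs_mult)
        qed
        then show ?thesis by simp
      qed
      also have "?a (Suc j) - ?a j = 1 / n" using n0 by (simp add: field_simps)
      finally show ?thesis .
    qed
    have "integral {0..1} (\<lambda>z. g z * k z) = (\<Sum>j<n. integral {?a j..?a (Suc j)} (\<lambda>z. g z * k z))"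
      using integral_combine_cells[OF gk n0 order_refl] n0 by simp
    then have "dist (\<Sum>j<n. g (?a j) * integral {?a j..?a (Suc j)} k) (integral {0..1} (\<lambda>z. g z * k z))
        = \<bar>\<Sum>j<n. g (?a j) * integral {?a j..?a (Suc j)} k - integral {?a j..?a (Suc j)} (\<lambda>z. g z * k z)\<bar>"
      by (simp add: dist_real_def sum_subtractf)
    also have "\<dots> \<le> (\<Sum>j<n. (\<eta> * B) * (1 / n))"
      by (rule order_trans[OF sum_abs]) (intro sum_mono cell, simp)
    also have "\<dots> = r / 2" using n0 B by (simp add: \<eta>_def)
    finally show ?thesis using r by simp
  qed
  then show "\<exists>no. \<forall>n\<ge>no. dist (\<Sum>j<n. g (real j / real n) * integral {real j / real n..real (Suc j) / real n} k)
      (integral {0..1} (\<lambda>z. g z * k z)) < r" by blast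
qed

lemma riemann_sum_tendsto:
  fixes g :: "real \<Rightarrow> real"
  assumes g: "continuous_on {0..1} g"
  shows "(\<lambda>n. (\<Sum>i<n. g (1 - real i / real n)) / n) \<longlonglongrightarrow> integral {0..1} g"
proof -
  have g': "continuous_on {0..1} (\<lambda>z. g (1 - z))"
    by (rule continuous_on_compose2[OF g]) (auto intro: continuous_intros)
  have refl: "integral {0..1} (\<lambda>z. g (1 - z)) = integral {0..1} g"
  proof -
    have "(g has_integral integral {0..1} g) (cbox 0 1)"
      using integrable_integral[OF integrable_continuous_interval[OF g]] by simp
    from has_integral_affinity[OF this, of "- 1" 1]
    have "((\<lambda>z. g (1 - z)) has_integral integral {0..1} g) ((\<lambda>z. 1 - z) ` {0..1})"
      by (simp add: algebra_simps)
    also have "(\<lambda>z. 1 - z) ` {0..1} = {0..1::real}"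
      by (auto simp: image_def intro!: bexI[of _ "1 - _"])
    finally show ?thesis by (rule integral_unique)
  qed
  have "(\<Sum>j<n. g (1 - real j / real n) * integral {real j / real n..real (Suc j) / real n} (\<lambda>_. 1))
      = (\<Sum>i<n. g (1 - real i / real n)) / n" for n
    by (simp add: sum_divide_distrib diff_divide_distrib[symmetric] divide_right_mono)
  then show ?thesis
    using stieltjes_sum_tendsto[OF g' continuous_on_const[of _ 1]] by (simp add: refl)
qed

text \<open>
  Summation by parts moves the increments from the path onto \<open>K\<close>; the boundary terms vanish because
  \<open>w 0 = 0\<close> and \<open>K 0 = 0\<close>. This represents a path integral by increments with no stochastic
  integration.
\<close>

lemma wiener_sum_tendsto:
  fixes w k K :: "real \<Rightarrow> real"
  assumes w: "continuous_on {0..1} w" "w 0 = 0" and k: "continuous_on {0..1} k"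
    and K: "\<And>y. y \<in> {0..1} \<Longrightarrow> K y = integral {0..y} k"
  shows "(\<lambda>n. \<Sum>i<n. K (1 - real i / n) * (w (real (Suc i) / n) - w (real i / n)))
    \<longlonglongrightarrow> integral {0..1} (\<lambda>z. w (1 - z) * k z)"
proof -
  have w': "continuous_on {0..1} (\<lambda>z. w (1 - z))"
    by (rule continuous_on_compose2[OF w(1)]) (auto intro: continuous_intros)
  have "(\<Sum>i<n. K (1 - real i / n) * (w (real (Suc i) / n) - w (real i / n)))
      = (\<Sum>j<n. w (1 - real j / n) * integral {real j / n..real (Suc j) / n} k)" for n
  proof (cases "n = 0")
    case False
    let ?K = "\<lambda>i. K (1 - real i / n)" and ?w = "\<lambda>i. w (real i / n)"
    have "(\<Sum>i<n. ?w (Suc i) * ?K (Suc i) - ?w i * ?K i) = ?w n * ?K n - ?w 0 * ?K 0"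
      by (rule sum_lessThan_telescope)
    also have "\<dots> = 0" using w(2) K[of 0] False by simp
    finally have tel: "(\<Sum>i<n. ?w (Suc i) * ?K (Suc i) - ?w i * ?K i) = 0" .
    have "(\<Sum>i<n. ?K i * (?w (Suc i) - ?w i))
        = (\<Sum>i<n. ?w (Suc i) * (?K i - ?K (Suc i)) + (?w (Suc i) * ?K (Suc i) - ?w i * ?K i))"
      by (intro sum.cong) (auto simp: algebra_simps)
    also have "\<dots> = (\<Sum>i<n. ?w (Suc i) * (?K i - ?K (Suc i)))"
      using tel by (simp add: sum.distrib)
    also have "\<dots> = (\<Sum>j<n. ?w (Suc (n - Suc j)) * (?K (n - Suc j) - ?K (Suc (n - Suc j))))"
      by (rule sum.nat_diff_reindex[symmetric])
    also have "\<dots> = (\<Sum>j<n. w (1 - real j / n) * integral {real j / n..real (Suc j) / n} k)"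
    proof (intro sum.cong refl)
      fix j assume j: "j \<in> {..<n}"
      have e: "Suc (n - Suc j) = n - j" using j by auto
      have 1: "real (n - j) / n = 1 - real j / n" using j False by (simp add: of_nat_diff field_simps)
      have 2: "1 - real (n - j) / n = real j / n" using 1 by simp
      have 3: "1 - real (n - Suc j) / n = real (Suc j) / n" using j False by (simp add: of_nat_diff field_simps)
      have le: "real j / n \<le> real (Suc j) / n" "real (Suc j) / n \<le> 1"
        using j False by (auto simp: divide_right_mono)
      have "k integrable_on {0..real (Suc j) / n}"
        by (rule integrable_continuous_interval[OF continuous_on_subset[OF k]]) (use le in auto)
      then have "integral {0..real j / n} k + integral {real j / n..real (Suc j) / n} k = integral {0..real (Suc j) / n} k"
        using le by (intro Henstock_Kurzweil_Integration.integral_combine) auto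
      then have "K (real (Suc j) / n) - K (real j / n) = integral {real j / n..real (Suc j) / n} k"
        using le by (subst (1 2) K) auto
      then show "?w (Suc (n - Suc j)) * (?K (n - Suc j) - ?K (Suc (n - Suc j)))
          = w (1 - real j / n) * integral {real j / n..real (Suc j) / n} k"
        unfolding e 1 2 3 by simp
    qed
    finally show ?thesis .
  qed simp
  then show ?thesis using stieltjes_sum_tendsto[OF w' k] by simp
qed

text \<open>
  Convergence of the three coefficients of a positive definite form in two variables gives a lower
  bound for the approximating forms that is uniform in \<open>u\<close> and \<open>v\<close>, at the price of a factor \<open>2\<close>.
\<close>

lemma quadratic_form_perturbation:
  fixes a b d a' b' d' l m u v \<eta> :: real
  assumes "l * u\<^sup>2 + m * v\<^sup>2 \<le> a * u\<^sup>2 + 2 * b * (u * v) + d * v\<^sup>2"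
    and "\<bar>a' - a\<bar> \<le> \<eta>" "\<bar>b' - b\<bar> \<le> \<eta>" "\<bar>d' - d\<bar> \<le> \<eta>"
    and "4 * \<eta> \<le> l" "4 * \<eta> \<le> m"
  shows "(l * u\<^sup>2 + m * v\<^sup>2) / 2 \<le> a' * u\<^sup>2 + 2 * b' * (u * v) + d' * v\<^sup>2"
proof -
  have \<eta>: "0 \<le> \<eta>" using assms(2) by linarith
  have "(a' - a) * u\<^sup>2 \<ge> - \<eta> * u\<^sup>2" "(d' - d) * v\<^sup>2 \<ge> - \<eta> * v\<^sup>2"
    using assms(2,4) by (intro mult_right_mono; simp)+
  moreover have "(b' - b) * (2 * (u * v)) \<ge> - (\<eta> * (u\<^sup>2 + v\<^sup>2))"
  proof -
    have "\<bar>(b' - b) * (2 * (u * v))\<bar> = \<bar>b' - b\<bar> * \<bar>2 * (u * v)\<bar>" by (simp add: abs_mult)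
    also have "\<dots> \<le> \<eta> * (u\<^sup>2 + v\<^sup>2)"
    proof (intro mult_mono assms(3) \<eta>)
      have "0 \<le> (\<bar>u\<bar> - \<bar>v\<bar>)\<^sup>2" by simp
      then show "\<bar>2 * (u * v)\<bar> \<le> u\<^sup>2 + v\<^sup>2" by (simp add: power2_diff abs_mult)
    qed simp
    finally show ?thesis by linarith
  qed
  moreover have "4 * \<eta> * u\<^sup>2 \<le> l * u\<^sup>2" "4 * \<eta> * v\<^sup>2 \<le> m * v\<^sup>2"
    using assms by (auto intro: mult_right_mono)
  ultimately show ?thesis using assms(1) by (simp add: algebra_simps)
qed

text \<open>
  The discretisation of the Wiener integral of \<open>K (1 - s)\<close> against \<open>dW(s)\<close>.
\<close>

definition increment_sum :: "(real \<Rightarrow> 'a \<Rightarrow> real) \<Rightarrow> (real \<Rightarrow> real) \<Rightarrow> nat \<Rightarrow> 'a \<Rightarrow> real" where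
  "increment_sum W K n \<omega> =
    (\<Sum>i<n. K (1 - real i / n) * (W (real (Suc i) / n) \<omega> - W (real i / n) \<omega>))"

lemma continuous_on_primitive:
  fixes k K :: "real \<Rightarrow> real"
  assumes "continuous_on {0..1} k" "\<And>y. y \<in> {0..1} \<Longrightarrow> K y = integral {0..y} k"
  shows "continuous_on {0..1} K"
proof -
  have "continuous_on {0..1} (\<lambda>y. integral {0..y} k)"
    by (rule indefinite_integral_continuous_1[OF integrable_continuous_interval[OF assms(1)]])
  then show ?thesis using assms(2) by (subst continuous_on_cong[OF refl]) auto
qed

context standard_brownian_motion
begin

lemma measurable_W [measurable (raw)]: "s \<in> {0..1} \<Longrightarrow> W s \<in> borel_measurable M"
  using random_variable[of s] by simp

lemma measurable_increment_sum: "increment_sum W K n \<in> borel_measurable M"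
proof -
  have "(\<lambda>\<omega>. \<Sum>i<n. K (1 - real i / n) * (W (real (Suc i) / n) \<omega> - W (real i / n) \<omega>)) \<in> borel_measurable M"
    by (intro borel_measurable_sum borel_measurable_times borel_measurable_const borel_measurable_diff measurable_W)
       auto
  then show ?thesis by (simp add: increment_sum_def[abs_def])
qed

lemma increment_sum_tendsto:
  assumes "continuous_on {0..1} k" "\<And>y. y \<in> {0..1} \<Longrightarrow> K y = integral {0..y} k" "\<omega> \<in> space M"
  shows "(\<lambda>n. increment_sum W K n \<omega>) \<longlonglongrightarrow> integral {0..1} (\<lambda>z. W (1 - z) \<omega> * k z)"
  unfolding increment_sum_def
  by (rule wiener_sum_tendsto[OF continuous_paths[OF assms(3)] start[OF assms(3)] assms(1,2)])

lemma measurable_path_functional: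
  assumes "continuous_on {0..1} k"
  shows "(\<lambda>\<omega>. integral {0..1} (\<lambda>z. W (1 - z) \<omega> * k z)) \<in> borel_measurable M"
  by (rule borel_measurable_LIMSEQ_real[OF increment_sum_tendsto[OF assms refl] measurable_increment_sum])

text \<open>
  The increments are independent normal variables of variance \<open>1 / n\<close>, so the sums over \<open>i\<close> in the
  hypotheses are exactly the variances that govern the tilted characteristic function.
\<close>

lemma increment_sum_small_ball:
  fixes A B l m V :: real
  assumes n: "0 < n" and A: "0 < A" and B: "0 < B" and l: "0 < l" and m: "0 < m"
    and lower: "\<And>u v. l * u\<^sup>2 + m * v\<^sup>2 \<le> (\<Sum>i<n. (u * K1 (1 - real i / n) + v * K2 (1 - real i / n))\<^sup>2) / n"
    and upper: "(\<Sum>i<n. (K3 (1 - real i / n))\<^sup>2) / n \<le> V"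
  shows "(\<integral>\<^sup>+\<omega>. ennreal (exp (- ((increment_sum W K1 n \<omega> / A)\<^sup>2 / 2)) *
      exp (- ((increment_sum W K2 n \<omega> / B)\<^sup>2 / 2)) * exp (increment_sum W K3 n \<omega>)) \<partial>M)
    \<le> ennreal (exp (V / 2) * A * B / sqrt (l * m))"
proof -
  let ?X = "increment_sum W K1 n" and ?Y = "increment_sum W K2 n" and ?Z = "increment_sum W K3 n"
  define \<xi> where "\<xi> = (\<lambda>i \<omega>. W (real (Suc i) / n) \<omega> - W (real i / n) \<omega>)"
  have ind: "indep_vars (\<lambda>_. borel) \<xi> {..<n}"
    unfolding \<xi>_def using independent_increments[of n "\<lambda>i. real i / n"] n by (auto simp: divide_right_mono)
  have dist: "distributed M lborel (\<xi> i) (normal_density 0 (sqrt (1 / n)))" if "i \<in> {..<n}" for i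
  proof -
    have "real (Suc i) / n - real i / n = 1 / n" using n by (simp add: field_simps)
    then show ?thesis
      unfolding \<xi>_def using gaussian_increments[of "real i / n" "real (Suc i) / n"] n that
      by (simp add: divide_strict_right_mono)
  qed
  have s: "0 < sqrt (1 / n)" using n by simp
  note ch = tilted_char_sum[OF ind _ s dist]
  have F: "integrable M (\<lambda>\<omega>. exp (?Z \<omega>))"
    using integrable_norm[OF ch(1)[of "\<lambda>_. 0" "\<lambda>i. K3 (1 - real i / n)"]]
    by (simp add: norm_mult increment_sum_def \<xi>_def)
  have [measurable]: "?X \<in> borel_measurable M" "?Y \<in> borel_measurable M" "?Z \<in> borel_measurable M"
    by (rule measurable_increment_sum)+
  have bound: "(\<integral>\<omega>. exp (- ((?X \<omega> / A)\<^sup>2 / 2)) * exp (- ((?Y \<omega> / B)\<^sup>2 / 2)) * exp (?Z \<omega>) \<partial>M)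
      \<le> exp (V / 2) * A * B / sqrt (l * m)"
  proof (rule gaussian_weight_pair[OF _ _ F _ A B l m])
    fix u v :: real
    let ?b = "\<lambda>i. u * K1 (1 - real i / n) + v * K2 (1 - real i / n)" and ?e = "\<lambda>i. K3 (1 - real i / n)"
    have "u * ?X \<omega> + v * ?Y \<omega> = (\<Sum>i<n. ?b i * \<xi> i \<omega>)" for \<omega>
      by (simp add: increment_sum_def \<xi>_def sum_distrib_left sum.distrib[symmetric] algebra_simps)
    moreover have "?Z \<omega> = (\<Sum>i<n. ?e i * \<xi> i \<omega>)" for \<omega>
      by (simp add: increment_sum_def \<xi>_def)
    ultimately have "cmod (\<integral>\<omega>. iexp (u * ?X \<omega> + v * ?Y \<omega>) * exp (?Z \<omega>) \<partial>M)
        = exp ((sqrt (1 / n))\<^sup>2 * ((\<Sum>i<n. (?e i)\<^sup>2) - (\<Sum>i<n. (?b i)\<^sup>2)) / 2)"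
      using ch(2)[of ?b ?e] by simp
    also have "(sqrt (1 / n))\<^sup>2 * ((\<Sum>i<n. (?e i)\<^sup>2) - (\<Sum>i<n. (?b i)\<^sup>2)) / 2
        = ((\<Sum>i<n. (?e i)\<^sup>2) / n - (\<Sum>i<n. (?b i)\<^sup>2) / n) / 2"
      by (simp add: diff_divide_distrib)
    also have "exp \<dots> \<le> exp (V / 2 + - ((l * u\<^sup>2 + m * v\<^sup>2) / 2))"
      using lower[of u v] upper by (simp add: field_simps)
    finally show "cmod (\<integral>\<omega>. iexp (u * ?X \<omega> + v * ?Y \<omega>) * exp (?Z \<omega>) \<partial>M)
        \<le> exp (V / 2) * exp (- ((l * u\<^sup>2 + m * v\<^sup>2) / 2))"
      by (simp only: exp_add)
  qed auto
  have "integrable M (\<lambda>\<omega>. exp (- ((?X \<omega> / A)\<^sup>2 / 2)) * exp (- ((?Y \<omega> / B)\<^sup>2 / 2)) * exp (?Z \<omega>))"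
    by (rule Bochner_Integration.integrable_bound[OF F]) (auto simp: exp_add[symmetric])
  then show ?thesis
    by (subst nn_integral_eq_integral) (auto intro!: ennreal_leI bound)
qed

text \<open>
  The small-ball probability of \<open>(X, Y)\<close> survives a tilt by \<open>exp Z\<close>, however \<open>Z\<close> is correlated with
  \<open>X\<close> and \<open>Y\<close>, at the cost of the factor \<open>exp(V / 2)\<close>. The finite sums satisfy this with
  the limiting constants slightly worsened (\<open>l / 2\<close>, \<open>m / 2\<close>, \<open>V + 1\<close>), and Fatou's lemma carries the
  bound to the limit.
\<close>

lemma brownian_small_ball:
  fixes k1 k2 k3 K1 K2 K3 :: "real \<Rightarrow> real" and A B l m V :: real
  assumes k: "continuous_on {0..1} k1" "continuous_on {0..1} k2" "continuous_on {0..1} k3"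
    and K: "\<And>y. y \<in> {0..1} \<Longrightarrow> K1 y = integral {0..y} k1"
      "\<And>y. y \<in> {0..1} \<Longrightarrow> K2 y = integral {0..y} k2"
      "\<And>y. y \<in> {0..1} \<Longrightarrow> K3 y = integral {0..y} k3"
    and pos: "0 < A" "0 < B" "0 < l" "0 < m"
    and lower: "\<And>u v. l * u\<^sup>2 + m * v\<^sup>2 \<le> integral {0..1} (\<lambda>y. (u * K1 y + v * K2 y)\<^sup>2)"
    and upper: "integral {0..1} (\<lambda>y. (K3 y)\<^sup>2) \<le> V"
  defines "X \<equiv> \<lambda>\<omega>. integral {0..1} (\<lambda>z. W (1 - z) \<omega> * k1 z)"
    and "Y \<equiv> \<lambda>\<omega>. integral {0..1} (\<lambda>z. W (1 - z) \<omega> * k2 z)"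
    and "Z \<equiv> \<lambda>\<omega>. integral {0..1} (\<lambda>z. W (1 - z) \<omega> * k3 z)"
  shows "(\<integral>\<^sup>+\<omega>. ennreal (exp (- ((X \<omega> / A)\<^sup>2 / 2)) * exp (- ((Y \<omega> / B)\<^sup>2 / 2)) * exp (Z \<omega>)) \<partial>M)
    \<le> ennreal (2 * exp ((V + 1) / 2) * A * B / sqrt (l * m))"
proof -
  have c [continuous_intros]: "continuous_on {0..1} K1" "continuous_on {0..1} K2" "continuous_on {0..1} K3"
    using continuous_on_primitive k K by blast+
  define a b d where "a = integral {0..1} (\<lambda>y. (K1 y)\<^sup>2)" and "b = integral {0..1} (\<lambda>y. K1 y * K2 y)"
    and "d = integral {0..1} (\<lambda>y. (K2 y)\<^sup>2)"
  define an bn dn vn where "an = (\<lambda>n. (\<Sum>i<n. (K1 (1 - real i / real n))\<^sup>2) / n)"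
    and "bn = (\<lambda>n. (\<Sum>i<n. K1 (1 - real i / real n) * K2 (1 - real i / real n)) / n)"
    and "dn = (\<lambda>n. (\<Sum>i<n. (K2 (1 - real i / real n))\<^sup>2) / n)"
    and "vn = (\<lambda>n. (\<Sum>i<n. (K3 (1 - real i / real n))\<^sup>2) / n)"
  have lim: "an \<longlonglongrightarrow> a" "bn \<longlonglongrightarrow> b" "dn \<longlonglongrightarrow> d" "vn \<longlonglongrightarrow> integral {0..1} (\<lambda>y. (K3 y)\<^sup>2)"
    unfolding an_def bn_def dn_def vn_def a_def b_def d_def
    by (intro riemann_sum_tendsto continuous_intros)+
  have quad: "integral {0..1} (\<lambda>y. (u * K1 y + v * K2 y)\<^sup>2) = a * u\<^sup>2 + 2 * b * (u * v) + d * v\<^sup>2" for u v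
  proof -
    have "((\<lambda>y. (K1 y)\<^sup>2 * u\<^sup>2 + (K1 y * K2 y) * (2 * (u * v)) + (K2 y)\<^sup>2 * v\<^sup>2)
        has_integral a * u\<^sup>2 + b * (2 * (u * v)) + d * v\<^sup>2) {0..1}"
      unfolding a_def b_def d_def
      by (intro has_integral_add has_integral_mult_left integrable_integral integrable_continuous_interval
          continuous_intros)
    then show ?thesis
      by (intro integral_unique) (simp add: power2_eq_square algebra_simps)
  qed
  \<comment> \<open>Closeness of the coefficients that \<open>quadratic_form_perturbation\<close> requires.\<close>
  define \<eta> where "\<eta> = min l m / 4"
  have \<eta>: "0 < \<eta>" "4 * \<eta> \<le> l" "4 * \<eta> \<le> m" using pos by (auto simp: \<eta>_def)
  have "\<forall>\<^sub>F n in sequentially. 0 < n" by (rule eventually_gt_at_top)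
  moreover have "\<forall>\<^sub>F n in sequentially. dist (an n) a < \<eta>" "\<forall>\<^sub>F n in sequentially. dist (bn n) b < \<eta>"
    "\<forall>\<^sub>F n in sequentially. dist (dn n) d < \<eta>"
    using lim \<eta>(1) by (auto simp: tendsto_iff)
  moreover have "\<forall>\<^sub>F n in sequentially. vn n < V + 1"
    using lim(4) upper by (intro order_tendstoD(2)) auto
  ultimately have ev: "\<forall>\<^sub>F n in sequentially.
      (\<integral>\<^sup>+\<omega>. ennreal (exp (- ((increment_sum W K1 n \<omega> / A)\<^sup>2 / 2)) *
        exp (- ((increment_sum W K2 n \<omega> / B)\<^sup>2 / 2)) * exp (increment_sum W K3 n \<omega>)) \<partial>M)
      \<le> ennreal (2 * exp ((V + 1) / 2) * A * B / sqrt (l * m))"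
  proof eventually_elim
    case (elim n)
    have "(\<Sum>i<n. (u * K1 (1 - real i / n) + v * K2 (1 - real i / n))\<^sup>2) / n
        = an n * u\<^sup>2 + 2 * bn n * (u * v) + dn n * v\<^sup>2" for u v
    proof -
      have "(\<Sum>i<n. (u * K1 (1 - real i / n) + v * K2 (1 - real i / n))\<^sup>2)
        = (\<Sum>i<n. (K1 (1 - real i / real n))\<^sup>2) * u\<^sup>2
        + 2 * (\<Sum>i<n. K1 (1 - real i / real n) * K2 (1 - real i / real n)) * (u * v)
        + (\<Sum>i<n. (K2 (1 - real i / real n))\<^sup>2) * v\<^sup>2"
        by (simp add: sum_distrib_left sum_distrib_right sum.distrib[symmetric])
           (intro sum.cong refl, simp add: power2_eq_square algebra_simps)
      then show ?thesis by (simp add: an_def bn_def dn_def add_divide_distrib)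
    qed
    moreover have "(l * u\<^sup>2 + m * v\<^sup>2) / 2 \<le> an n * u\<^sup>2 + 2 * bn n * (u * v) + dn n * v\<^sup>2" for u v
      by (rule quadratic_form_perturbation[OF lower[unfolded quad] _ _ _ \<eta>(2,3)])
         (use elim in \<open>auto simp: dist_real_def\<close>)
    ultimately have "l / 2 * u\<^sup>2 + m / 2 * v\<^sup>2
        \<le> (\<Sum>i<n. (u * K1 (1 - real i / n) + v * K2 (1 - real i / n))\<^sup>2) / n" for u v
      by (simp add: add_divide_distrib)
    then have "(\<integral>\<^sup>+\<omega>. ennreal (exp (- ((increment_sum W K1 n \<omega> / A)\<^sup>2 / 2)) *
        exp (- ((increment_sum W K2 n \<omega> / B)\<^sup>2 / 2)) * exp (increment_sum W K3 n \<omega>)) \<partial>M)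
      \<le> ennreal (exp ((V + 1) / 2) * A * B / sqrt (l / 2 * (m / 2)))"
      by (intro increment_sum_small_ball) (use elim pos in \<open>auto simp: vn_def\<close>)
    also have "sqrt (l / 2 * (m / 2)) = sqrt (l * m) / 2"
      by (simp add: real_sqrt_divide)
    finally show ?case by (simp add: mult_ac)
  qed
  have X: "(\<lambda>n. increment_sum W K1 n \<omega>) \<longlonglongrightarrow> X \<omega>"
    and Y: "(\<lambda>n. increment_sum W K2 n \<omega>) \<longlonglongrightarrow> Y \<omega>"
    and Z: "(\<lambda>n. increment_sum W K3 n \<omega>) \<longlonglongrightarrow> Z \<omega>" if "\<omega> \<in> space M" for \<omega>
    using increment_sum_tendsto k K that unfolding X_def Y_def Z_def by blast+
  have lm: "(\<lambda>n. ennreal (exp (- ((increment_sum W K1 n \<omega> / A)\<^sup>2 / 2)) *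
        exp (- ((increment_sum W K2 n \<omega> / B)\<^sup>2 / 2)) * exp (increment_sum W K3 n \<omega>)))
      \<longlonglongrightarrow> ennreal (exp (- ((X \<omega> / A)\<^sup>2 / 2)) * exp (- ((Y \<omega> / B)\<^sup>2 / 2)) * exp (Z \<omega>))"
    if "\<omega> \<in> space M" for \<omega>
    using pos by (intro tendsto_ennrealI tendsto_intros X Y Z that) auto
  note [measurable] = measurable_increment_sum
  have "(\<integral>\<^sup>+\<omega>. ennreal (exp (- ((X \<omega> / A)\<^sup>2 / 2)) * exp (- ((Y \<omega> / B)\<^sup>2 / 2)) * exp (Z \<omega>)) \<partial>M)
     = (\<integral>\<^sup>+\<omega>. liminf (\<lambda>n. ennreal (exp (- ((increment_sum W K1 n \<omega> / A)\<^sup>2 / 2)) *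
        exp (- ((increment_sum W K2 n \<omega> / B)\<^sup>2 / 2)) * exp (increment_sum W K3 n \<omega>))) \<partial>M)"
    by (intro nn_integral_cong lim_imp_Liminf[symmetric] lm) auto
  also have "\<dots> \<le> liminf (\<lambda>n. \<integral>\<^sup>+\<omega>. ennreal (exp (- ((increment_sum W K1 n \<omega> / A)\<^sup>2 / 2)) *
        exp (- ((increment_sum W K2 n \<omega> / B)\<^sup>2 / 2)) * exp (increment_sum W K3 n \<omega>)) \<partial>M)"
    by (intro nn_integral_liminf) measurable
  also have "\<dots> \<le> liminf (\<lambda>n. ennreal (2 * exp ((V + 1) / 2) * A * B / sqrt (l * m)))"
    by (rule Liminf_mono[OF ev])
  also have "\<dots> = ennreal (2 * exp ((V + 1) / 2) * A * B / sqrt (l * m))"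
    by (simp add: Liminf_const)
  finally show ?thesis .
qed

end

section \<open>Derivatives of the Conga line as random functions\<close>

context standard_brownian_motion
begin

abbreviation u_deriv :: "real \<Rightarrow> real \<Rightarrow> nat \<Rightarrow> 'a \<Rightarrow> real \<Rightarrow> real" where
  "u_deriv \<alpha> \<sigma> r \<omega> \<equiv> conga_deriv \<alpha> \<sigma> (\<lambda>s. W s \<omega>) r"

lemma DERIV_u_deriv:
  assumes "\<omega> \<in> space M" "0 < \<sigma>" "0 < x"
  shows "(u_deriv \<alpha> \<sigma> r \<omega> has_real_derivative u_deriv \<alpha> \<sigma> (Suc r) \<omega> x) (at x)"
  by (rule DERIV_conga_deriv[OF continuous_paths[OF assms(1)] assms(2,3)])

lemma continuous_on_u_deriv:
  assumes "\<omega> \<in> space M" "0 < \<sigma>" "0 < a"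
  shows "continuous_on {a..b} (u_deriv \<alpha> \<sigma> r \<omega>)"
  by (rule DERIV_continuous_on[of _ _ "u_deriv \<alpha> \<sigma> (Suc r) \<omega>"])
     (use assms in \<open>auto intro!: has_field_derivative_at_within[OF DERIV_u_deriv]\<close>)

lemma measurable_u_deriv:
  assumes "0 < \<sigma>" "0 < x"
  shows "(\<lambda>\<omega>. u_deriv \<alpha> \<sigma> r \<omega> x) \<in> borel_measurable M"
  unfolding conga_deriv_def by (rule measurable_path_functional[OF continuous_on_conga_kernel[OF assms]])

text \<open>
  Needed for Tonelli's theorem. The increment sums are finite sums of products of a function of
  \<open>x\<close> and a function of \<open>\<omega>\<close>, so their limit is jointly measurable.
\<close>

lemma joint_measurable_u_deriv:
  assumes \<sigma>: "0 < \<sigma>" and a: "0 < a"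
  shows "(\<lambda>(\<omega>, x). indicator {a..b} x * u_deriv \<alpha> \<sigma> (Suc r) \<omega> x) \<in> borel_measurable (M \<Otimes>\<^sub>M lborel)"
proof (rule borel_measurable_LIMSEQ_real)
  let ?S = "\<lambda>n (\<omega>, x). \<Sum>i<n. (indicator {a..b} x * wiener_kernel \<alpha> \<sigma> r x (1 - real i / n)) *
      (W (real (Suc i) / n) \<omega> - W (real i / n) \<omega>)"
  show "(\<lambda>n. ?S n p) \<longlonglongrightarrow> (case p of (\<omega>, x) \<Rightarrow> indicator {a..b} x * u_deriv \<alpha> \<sigma> (Suc r) \<omega> x)"
    if "p \<in> space (M \<Otimes>\<^sub>M lborel)" for p
  proof -
    obtain \<omega> x where p1: "p = (\<omega>, x)" by (cases p)
    with that have "\<omega> \<in> space M" by (simp add: space_pair_measure)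
    note p = p1 this
    show ?thesis
    proof (cases "x \<in> {a..b}")
      case True
      then have x: "0 < x" using a by auto
      have "(\<lambda>n. increment_sum W (wiener_kernel \<alpha> \<sigma> r x) n \<omega>) \<longlonglongrightarrow> u_deriv \<alpha> \<sigma> (Suc r) \<omega> x"
        unfolding conga_deriv_def
        by (rule increment_sum_tendsto[OF continuous_on_conga_kernel[OF \<sigma> x] wiener_kernel_eq_integral[OF \<sigma> x] p(2)])
      then show ?thesis using True by (simp add: p increment_sum_def)
    qed (simp add: p)
  qed
  show "?S n \<in> borel_measurable (M \<Otimes>\<^sub>M lborel)" for n
    unfolding case_prod_beta'
  proof (rule borel_measurable_sum)
    fix i assume i: "i \<in> {..<n}"
    then have i1: "1 - real i / n \<in> {0..1}" by (auto simp: divide_le_eq)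
    have "continuous_on {a..b} (\<lambda>x. atom_deriv \<alpha> \<sigma> r 0 1 x (1 - real i / n))"
      by (rule DERIV_continuous_on)
         (use i1 \<sigma> a in \<open>auto intro!: has_field_derivative_at_within[OF has_derivative_atom_deriv]\<close>)
    then have "continuous_on {a..b} (\<lambda>x. wiener_kernel \<alpha> \<sigma> r x (1 - real i / n))"
      unfolding wiener_kernel_def using \<sigma> by (intro continuous_intros) auto
    then have "(\<lambda>x. indicator {a..b} x *\<^sub>R wiener_kernel \<alpha> \<sigma> r x (1 - real i / n)) \<in> borel_measurable lborel"
      using borel_measurable_continuous_on_indicator[of "{a..b}"] by (simp del: real_scaleR_def)
    then have "(\<lambda>p. indicator {a..b} (snd p) *\<^sub>R wiener_kernel \<alpha> \<sigma> r (snd p) (1 - real i / n))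
        \<in> borel_measurable (M \<Otimes>\<^sub>M lborel)"
      by measurable
    then have 1: "(\<lambda>p. indicator {a..b} (snd p) * wiener_kernel \<alpha> \<sigma> r (snd p) (1 - real i / n))
        \<in> borel_measurable (M \<Otimes>\<^sub>M lborel)"
      by simp
    have "W (real (Suc i) / n) \<in> borel_measurable M" "W (real i / n) \<in> borel_measurable M"
      using i by (auto intro!: measurable_W simp: divide_le_eq)
    then have 2: "(\<lambda>p. W (real (Suc i) / n) (fst p) - W (real i / n) (fst p)) \<in> borel_measurable (M \<Otimes>\<^sub>M lborel)"
      by measurable
    show "(\<lambda>p. indicator {a..b} (snd p) * wiener_kernel \<alpha> \<sigma> r (snd p) (1 - real i / n) *
        (W (real (Suc i) / n) (fst p) - W (real i / n) (fst p))) \<in> borel_measurable (M \<Otimes>\<^sub>M lborel)"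
      by (rule borel_measurable_times[OF 1 2])
  qed
qed

text \<open>
  The factor \<open>\<sigma>^(5/2)\<close> normalises \<open>u'''(y)\<close> to a variance bounded by \<open>V\<close>, and the product of the two
  lower variance bounds is \<open>(c / \<sigma>\<^sup>2)\<^sup>2\<close>, whence \<open>\<sigma>\<^sup>2\<close> on the right. The absolute value in the
  exponent is handled by adding the bounds for both signs of the tilt.
\<close>

lemma conga_tilted_small_ball:
  assumes \<sigma>: "0 < \<sigma>" and x: "0 < x" and y: "0 < y" and c: "0 < c" and AB: "0 < A" "0 < B"
    and lower: "\<And>u v. c / \<sigma> * u\<^sup>2 + c / \<sigma> ^ 3 * v\<^sup>2
      \<le> integral {0..1} (\<lambda>z. (u * wiener_kernel \<alpha> \<sigma> 0 x z + v * wiener_kernel \<alpha> \<sigma> 1 x z)\<^sup>2)"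
    and upper: "integral {0..1} (\<lambda>z. (wiener_kernel \<alpha> \<sigma> 2 y z)\<^sup>2) \<le> V / \<sigma> ^ 5"
  shows "(\<integral>\<^sup>+\<omega>. ennreal (exp (- ((u_deriv \<alpha> \<sigma> 1 \<omega> x / A)\<^sup>2 / 2)) * exp (- ((u_deriv \<alpha> \<sigma> 2 \<omega> x / B)\<^sup>2 / 2))
        * exp (sqrt \<sigma> ^ 5 * \<bar>u_deriv \<alpha> \<sigma> 3 \<omega> y\<bar>)) \<partial>M)
    \<le> ennreal (4 * exp ((V + 1) / 2) / c * A * B * \<sigma>\<^sup>2)"
proof -
  let ?w = "\<lambda>\<omega>. exp (- ((u_deriv \<alpha> \<sigma> 1 \<omega> x / A)\<^sup>2 / 2)) * exp (- ((u_deriv \<alpha> \<sigma> 2 \<omega> x / B)\<^sup>2 / 2))"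
  let ?D = "2 * exp ((V + 1) / 2) * A * B * \<sigma>\<^sup>2 / c"
  have sb: "(\<integral>\<^sup>+\<omega>. ennreal (?w \<omega> * exp (s * sqrt \<sigma> ^ 5 * u_deriv \<alpha> \<sigma> 3 \<omega> y)) \<partial>M) \<le> ennreal ?D"
    if s: "s\<^sup>2 = 1" for s :: real
  proof -
    let ?\<theta> = "s * sqrt \<sigma> ^ 5"
    have \<theta>: "?\<theta>\<^sup>2 = \<sigma> ^ 5"
    proof -
      have "(sqrt \<sigma> ^ 5)\<^sup>2 = ((sqrt \<sigma>)\<^sup>2) ^ 5" by (simp only: power_mult[symmetric] mult.commute)
      then show ?thesis using s \<sigma> by (simp add: power_mult_distrib)
    qed
    have main: "(\<integral>\<^sup>+\<omega>. ennreal (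
        exp (- ((integral {0..1} (\<lambda>z. W (1 - z) \<omega> * conga_kernel \<alpha> \<sigma> (Suc 0) x z) / A)\<^sup>2 / 2)) *
        exp (- ((integral {0..1} (\<lambda>z. W (1 - z) \<omega> * conga_kernel \<alpha> \<sigma> (Suc 1) x z) / B)\<^sup>2 / 2)) *
        exp (integral {0..1} (\<lambda>z. W (1 - z) \<omega> * (?\<theta> * conga_kernel \<alpha> \<sigma> (Suc 2) y z)))) \<partial>M)
      \<le> ennreal (2 * exp ((V + 1) / 2) * A * B / sqrt (c / \<sigma> * (c / \<sigma> ^ 3)))"
    proof (rule brownian_small_ball[where ?K1.0 = "wiener_kernel \<alpha> \<sigma> 0 x" and ?K2.0 = "wiener_kernel \<alpha> \<sigma> 1 x"
          and ?K3.0 = "\<lambda>z. ?\<theta> * wiener_kernel \<alpha> \<sigma> 2 y z", OF _ _ _ _ _ _ AB _ _ lower])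
      show "continuous_on {0..1} (\<lambda>z. ?\<theta> * conga_kernel \<alpha> \<sigma> (Suc 2) y z)"
        by (intro continuous_intros continuous_on_conga_kernel \<sigma> y)
      show "?\<theta> * wiener_kernel \<alpha> \<sigma> 2 y z = integral {0..z} (\<lambda>z. ?\<theta> * conga_kernel \<alpha> \<sigma> (Suc 2) y z)"
        if "z \<in> {0..1}" for z
        using wiener_kernel_eq_integral[OF \<sigma> y that, of \<alpha> 2] by simp
      have "integral {0..1} (\<lambda>z. (?\<theta> * wiener_kernel \<alpha> \<sigma> 2 y z)\<^sup>2)
          = \<sigma> ^ 5 * integral {0..1} (\<lambda>z. (wiener_kernel \<alpha> \<sigma> 2 y z)\<^sup>2)"
        unfolding power_mult_distrib[of ?\<theta>] \<theta> by (rule Henstock_Kurzweil_Integration.integral_mult_right)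
      also have "\<dots> \<le> \<sigma> ^ 5 * (V / \<sigma> ^ 5)" using \<sigma> by (intro mult_left_mono upper) auto
      finally show "integral {0..1} (\<lambda>z. (?\<theta> * wiener_kernel \<alpha> \<sigma> 2 y z)\<^sup>2) \<le> V" using \<sigma> by simp
      show "wiener_kernel \<alpha> \<sigma> 0 x z = integral {0..z} (conga_kernel \<alpha> \<sigma> (Suc 0) x)"
        and "wiener_kernel \<alpha> \<sigma> 1 x z = integral {0..z} (conga_kernel \<alpha> \<sigma> (Suc 1) x)"
        if "z \<in> {0..1}" for z
        using wiener_kernel_eq_integral[OF \<sigma> x that] by blast+
    qed (use c \<sigma> x in \<open>auto intro!: continuous_on_conga_kernel\<close>)
    have sq: "sqrt (c / \<sigma> * (c / \<sigma> ^ 3)) = c / \<sigma>\<^sup>2"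
    proof -
      have "c / \<sigma> * (c / \<sigma> ^ 3) = (c / \<sigma>\<^sup>2)\<^sup>2" by (simp add: power2_eq_square power3_eq_cube)
      then show ?thesis using c by simp
    qed
    have e12: "integral {0..1} (\<lambda>z. W (1 - z) \<omega> * conga_kernel \<alpha> \<sigma> (Suc 0) x z) = u_deriv \<alpha> \<sigma> 1 \<omega> x"
      "integral {0..1} (\<lambda>z. W (1 - z) \<omega> * conga_kernel \<alpha> \<sigma> (Suc 1) x z) = u_deriv \<alpha> \<sigma> 2 \<omega> x" for \<omega>
      by (simp_all add: conga_deriv_def numeral_2_eq_2)
    have e3: "integral {0..1} (\<lambda>z. W (1 - z) \<omega> * (?\<theta> * conga_kernel \<alpha> \<sigma> (Suc 2) y z)) = ?\<theta> * u_deriv \<alpha> \<sigma> 3 \<omega> y" for \<omega>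
      unfolding conga_deriv_def Henstock_Kurzweil_Integration.integral_mult_right[symmetric]
      by (simp add: mult_ac)
    show ?thesis using main unfolding sq e12 e3 by simp
  qed
  have [measurable]: "(\<lambda>\<omega>. u_deriv \<alpha> \<sigma> r \<omega> x) \<in> borel_measurable M" "(\<lambda>\<omega>. u_deriv \<alpha> \<sigma> r \<omega> y) \<in> borel_measurable M" for r
    by (intro measurable_u_deriv \<sigma> x y)+
  have "(\<integral>\<^sup>+\<omega>. ennreal (?w \<omega> * exp (sqrt \<sigma> ^ 5 * \<bar>u_deriv \<alpha> \<sigma> 3 \<omega> y\<bar>)) \<partial>M)
      \<le> (\<integral>\<^sup>+\<omega>. ennreal (?w \<omega> * exp (1 * sqrt \<sigma> ^ 5 * u_deriv \<alpha> \<sigma> 3 \<omega> y))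
          + ennreal (?w \<omega> * exp (- 1 * sqrt \<sigma> ^ 5 * u_deriv \<alpha> \<sigma> 3 \<omega> y)) \<partial>M)"
  proof (rule nn_integral_mono)
    fix \<omega>
    have "?w \<omega> * exp (sqrt \<sigma> ^ 5 * \<bar>u_deriv \<alpha> \<sigma> 3 \<omega> y\<bar>)
        \<le> ?w \<omega> * (exp (1 * sqrt \<sigma> ^ 5 * u_deriv \<alpha> \<sigma> 3 \<omega> y) + exp (- 1 * sqrt \<sigma> ^ 5 * u_deriv \<alpha> \<sigma> 3 \<omega> y))"
      by (intro mult_left_mono) (auto simp: abs_if)
    also have "\<dots> = ?w \<omega> * exp (1 * sqrt \<sigma> ^ 5 * u_deriv \<alpha> \<sigma> 3 \<omega> y)
        + ?w \<omega> * exp (- 1 * sqrt \<sigma> ^ 5 * u_deriv \<alpha> \<sigma> 3 \<omega> y)"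
      by (rule distrib_left)
    finally have "ennreal (?w \<omega> * exp (sqrt \<sigma> ^ 5 * \<bar>u_deriv \<alpha> \<sigma> 3 \<omega> y\<bar>)) \<le> ennreal \<dots>"
      by (rule ennreal_leI)
    also have "\<dots> = ennreal (?w \<omega> * exp (1 * sqrt \<sigma> ^ 5 * u_deriv \<alpha> \<sigma> 3 \<omega> y))
          + ennreal (?w \<omega> * exp (- 1 * sqrt \<sigma> ^ 5 * u_deriv \<alpha> \<sigma> 3 \<omega> y))"
      by (rule ennreal_plus) auto
    finally show "ennreal (?w \<omega> * exp (sqrt \<sigma> ^ 5 * \<bar>u_deriv \<alpha> \<sigma> 3 \<omega> y\<bar>))
      \<le> ennreal (?w \<omega> * exp (1 * sqrt \<sigma> ^ 5 * u_deriv \<alpha> \<sigma> 3 \<omega> y))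
          + ennreal (?w \<omega> * exp (- 1 * sqrt \<sigma> ^ 5 * u_deriv \<alpha> \<sigma> 3 \<omega> y))" .
  qed
  also have "\<dots> = (\<integral>\<^sup>+\<omega>. ennreal (?w \<omega> * exp (1 * sqrt \<sigma> ^ 5 * u_deriv \<alpha> \<sigma> 3 \<omega> y)) \<partial>M)
          + (\<integral>\<^sup>+\<omega>. ennreal (?w \<omega> * exp (- 1 * sqrt \<sigma> ^ 5 * u_deriv \<alpha> \<sigma> 3 \<omega> y)) \<partial>M)"
    by (intro nn_integral_add) measurable
  also have "\<dots> \<le> ennreal ?D + ennreal ?D"
    by (intro add_mono sb) auto
  also have "\<dots> = ennreal (4 * exp ((V + 1) / 2) / c * A * B * \<sigma>\<^sup>2)"
    using AB c by (subst ennreal_plus[symmetric]) (auto simp: field_simps)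
  finally show ?thesis .
qed

end

section \<open>Two zeros in a short interval\<close>

text \<open>
  By Rolle's theorem \<open>g'\<close> vanishes somewhere in the interval, so it is bounded by the integral of
  \<open>|g''|\<close> throughout, and the mean value theorem transfers this to \<open>g\<close>. The integral of \<open>|g''|\<close>,
  rather than its supremum, is used because its exponential moments reduce to those of
  \<open>g''\<close> at single points.
\<close>

lemma two_zeros_bound:
  fixes g g' g'' :: "real \<Rightarrow> real"
  assumes g: "\<And>x. x \<in> {a..b} \<Longrightarrow> (g has_real_derivative g' x) (at x)"
    and g': "\<And>x. x \<in> {a..b} \<Longrightarrow> (g' has_real_derivative g'' x) (at x)"
    and g'': "continuous_on {a..b} g''"
    and z: "y \<in> {a..b}" "z \<in> {a..b}" "y < z" "g y = 0" "g z = 0"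
  defines "J \<equiv> integral {a..b} (\<lambda>x. \<bar>g'' x\<bar>)"
  shows "\<bar>g a\<bar> \<le> (b - a) * J" and "\<bar>g' a\<bar> \<le> J"
proof -
  have "\<exists>\<xi>. y < \<xi> \<and> \<xi> < z \<and> (\<lambda>h. g' \<xi> * h) = (\<lambda>v. 0)"
  proof (rule Rolle_deriv[OF z(3)])
    show "g y = g z" using z by simp
    show "continuous_on {y..z} g"
      by (rule DERIV_continuous_on[of _ _ g']) (use z g in \<open>auto intro: has_field_derivative_at_within\<close>)
    show "(g has_derivative (\<lambda>h. g' x * h)) (at x)" if "y < x" "x < z" for x
      using g[of x] that z unfolding has_field_derivative_def by auto
  qed
  then obtain \<xi> where \<xi>: "y < \<xi>" "\<xi> < z" "g' \<xi> = 0" by (metis mult.right_neutral)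
  have abs_int: "(\<lambda>x. \<bar>g'' x\<bar>) integrable_on {a..b}"
    by (intro integrable_continuous_interval continuous_intros g'')
  have incr: "\<bar>g' q - g' p\<bar> \<le> J" if "a \<le> p" "p \<le> q" "q \<le> b" for p q
  proof -
    have sub: "{p..q} \<subseteq> {a..b}" using that by auto
    have i: "g'' integrable_on {p..q}" "(\<lambda>x. \<bar>g'' x\<bar>) integrable_on {p..q}"
      using continuous_on_subset[OF g'' sub] by (auto intro!: integrable_continuous_interval continuous_intros)
    have "(g'' has_integral g' q - g' p) {p..q}"
    proof (rule fundamental_theorem_of_calculus[OF that(2)])
      show "(g' has_vector_derivative g'' x) (at x within {p..q})" if "x \<in> {p..q}" for x
        using has_field_derivative_at_within[OF g'[of x]] that sub
        unfolding has_real_derivative_iff_has_vector_derivative by blast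
    qed
    then have "\<bar>g' q - g' p\<bar> = norm (integral {p..q} g'')" by (simp add: integral_unique)
    also have "\<dots> \<le> integral {p..q} (\<lambda>x. \<bar>g'' x\<bar>)"
      by (rule integral_norm_bound_integral[OF i]) simp
    also have "\<dots> \<le> J"
      unfolding J_def by (rule integral_subset_le[OF sub i(2) abs_int]) simp
    finally show ?thesis .
  qed
  have g'_bound: "\<bar>g' x\<bar> \<le> J" if "x \<in> {a..b}" for x
  proof (cases "x \<le> \<xi>")
    case True
    then show ?thesis using incr[of x \<xi>] that \<xi> z by simp
  next
    case False
    then show ?thesis using incr[of \<xi> x] that \<xi> z by simp
  qed
  then show "\<bar>g' a\<bar> \<le> J" using z by simp
  have J: "0 \<le> J" using g'_bound[OF z(1)] by linarith
  show "\<bar>g a\<bar> \<le> (b - a) * J"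
  proof (cases "a = y")
    case True
    then show ?thesis using z J by simp
  next
    case False
    then have "\<exists>x. a < x \<and> x < y \<and> g y - g a = (y - a) * g' x"
      by (intro MVT2) (use z g in auto)
    then obtain x where x: "a < x" "x < y" "g y - g a = (y - a) * g' x" by blast
    have "g a = - ((y - a) * g' x)" using x z by simp
    then have "\<bar>g a\<bar> = (y - a) * \<bar>g' x\<bar>" using x by (simp add: abs_mult)
    also have "\<dots> \<le> (b - a) * J" using x z by (intro mult_mono g'_bound) auto
    finally show ?thesis .
  qed
qed

text \<open>
  Jensen's inequality for the exponential, obtained by integrating the tangent line at the mean.
\<close>

lemma exp_average_le:
  fixes h :: "real \<Rightarrow> real"
  assumes h: "continuous_on {a..b} h" and ab: "a < b"
  shows "(b - a) * exp (integral {a..b} h / (b - a)) \<le> integral {a..b} (\<lambda>x. exp (h x))"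
proof -
  define m where "m = integral {a..b} h / (b - a)"
  have "((\<lambda>x. exp m * ((1 - m) + h x)) has_integral exp m * ((b - a) * (1 - m) + integral {a..b} h)) {a..b}"
    using has_integral_const_real[of "1 - m" a b] ab
    by (intro has_integral_mult_right has_integral_add integrable_integral
        integrable_continuous_interval h) auto
  also have "exp m * ((b - a) * (1 - m) + integral {a..b} h) = (b - a) * exp m"
    using ab by (simp add: m_def field_simps)
  finally have lhs: "((\<lambda>x. exp m * ((1 - m) + h x)) has_integral (b - a) * exp m) {a..b}" .
  have rhs: "((\<lambda>x. exp (h x)) has_integral integral {a..b} (\<lambda>x. exp (h x))) {a..b}"
    by (intro integrable_integral integrable_continuous_interval continuous_intros h)
  have "(b - a) * exp m \<le> integral {a..b} (\<lambda>x. exp (h x))"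
  proof (rule has_integral_le[OF lhs rhs])
    fix x
    have "exp m * (1 + (h x - m)) \<le> exp m * exp (h x - m)" by (intro mult_left_mono) auto
    then show "exp m * ((1 - m) + h x) \<le> exp (h x)" by (simp add: exp_diff algebra_simps)
  qed
  then show ?thesis by (simp add: m_def)
qed

lemma nn_integral_continuous_interval:
  fixes f :: "real \<Rightarrow> real"
  assumes f: "continuous_on {a..b} f" and f0: "\<And>x. x \<in> {a..b} \<Longrightarrow> 0 \<le> f x"
  shows "(\<integral>\<^sup>+x. ennreal (f x) * indicator {a..b} x \<partial>lborel) = ennreal (integral {a..b} f)"
proof -
  have i: "set_integrable lborel {a..b} f" by (rule borel_integrable_atLeastAtMost'[OF f])
  have "(\<integral>\<^sup>+x. ennreal (f x) * indicator {a..b} x \<partial>lborel)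
      = (\<integral>\<^sup>+x. ennreal (indicator {a..b} x *\<^sub>R f x) \<partial>lborel)"
    by (intro nn_integral_cong) (auto simp: indicator_def)
  also have "\<dots> = ennreal (LBINT x:{a..b}. f x)"
    using i f0 unfolding set_lebesgue_integral_def set_integrable_def
    by (intro nn_integral_eq_integral) (auto simp: indicator_def)
  also have "(LBINT x:{a..b}. f x) = integral {a..b} f"
    by (rule set_borel_integral_eq_integral(2)[OF i])
  finally show ?thesis .
qed

lemma square_exp_le_geometric:
  "(real k + 1)\<^sup>2 * exp (- real k) \<le> 16 * exp (- (1 / 2)) ^ k"
proof -
  have "(1 + real k / 4)\<^sup>2 \<le> exp (real k / 4) ^ 2"
    by (intro power_mono) auto
  also have "\<dots> = exp (real k / 2)" by (simp add: power2_eq_square exp_add[symmetric])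
  finally have "16 * (1 + real k / 4)\<^sup>2 \<le> 16 * exp (real k / 2)" by simp
  moreover have "(real k + 1)\<^sup>2 \<le> 16 * (1 + real k / 4)\<^sup>2"
    by (simp add: power2_eq_square algebra_simps)
  ultimately have "(real k + 1)\<^sup>2 * exp (- real k) \<le> 16 * exp (real k / 2) * exp (- real k)"
    by (intro mult_right_mono) auto
  also have "\<dots> = 16 * exp (real k * - (1 / 2))" by (simp add: mult.assoc exp_add[symmetric])
  also have "\<dots> = 16 * exp (- (1 / 2)) ^ k" by (simp only: exp_of_nat_mult)
  finally show ?thesis .
qed

context standard_brownian_motion
begin

text \<open>
  Let \<open>\<theta> = \<sigma>^(5/2)\<close> and let \<open>K\<close> be the mean of \<open>\<theta> |u'''|\<close> over the interval. If \<open>K\<close> lies in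
  \<open>[k, k + 1]\<close>, two zeros force \<open>|u'(a)| \<le> A k\<close> and \<open>|u''(a)| \<le> B k\<close> by \<open>two_zeros_bound\<close>, while the
  mean of \<open>exp(\<theta> |u'''|)\<close> is at least \<open>e\<^sup>k\<close> by Jensen's inequality. A Markov inequality with
  the weight of the small-ball hypothesis, and Tonelli's theorem for the mean over \<open>y\<close>, give
  this event probability at most a constant times \<open>(k + 1)\<^sup>2 e^(-k) (\<epsilon> / \<sigma>)\<^sup>3\<close>.
\<close>

lemma prob_two_zeros_le:
  assumes \<sigma>: "0 < \<sigma>" and a: "0 < a" and ab: "a < b" "b - a \<le> \<epsilon>" and C: "0 \<le> C"
    and small_ball: "\<And>y A B. y \<in> {a..b} \<Longrightarrow> 0 < A \<Longrightarrow> 0 < B \<Longrightarrow>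
      (\<integral>\<^sup>+\<omega>. ennreal (exp (- ((u_deriv \<alpha> \<sigma> 1 \<omega> a / A)\<^sup>2 / 2)) * exp (- ((u_deriv \<alpha> \<sigma> 2 \<omega> a / B)\<^sup>2 / 2))
        * exp (sqrt \<sigma> ^ 5 * \<bar>u_deriv \<alpha> \<sigma> 3 \<omega> y\<bar>)) \<partial>M) \<le> ennreal (C * A * B * \<sigma>\<^sup>2)"
    and E: "E \<subseteq> {\<omega> \<in> space M. \<exists>y\<in>{a..b}. \<exists>z\<in>{a..b}. y < z \<and> u_deriv \<alpha> \<sigma> 1 \<omega> y = 0 \<and> u_deriv \<alpha> \<sigma> 1 \<omega> z = 0}"
  shows "measure M E \<le> exp 1 * (16 / (1 - exp (- (1 / 2)))) * C * (\<epsilon> / \<sigma>) ^ 3"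
proof -
  define \<theta> where "\<theta> = sqrt \<sigma> ^ 5"
  have \<theta>: "0 < \<theta>" using \<sigma> by (simp add: \<theta>_def)
  have \<theta>2: "\<theta>\<^sup>2 = \<sigma> ^ 5"
  proof -
    have "\<theta>\<^sup>2 = ((sqrt \<sigma>)\<^sup>2) ^ 5" unfolding \<theta>_def by (simp only: power_mult[symmetric] mult.commute)
    then show ?thesis using \<sigma> by simp
  qed
  have \<epsilon>: "0 < \<epsilon>" using ab by simp
  define A B where "A = (\<lambda>k::nat. \<epsilon>\<^sup>2 * (real k + 1) / \<theta>)" and "B = (\<lambda>k::nat. \<epsilon> * (real k + 1) / \<theta>)"
  have AB: "0 < A k" "0 < B k" for k using \<epsilon> \<theta> by (auto simp: A_def B_def)
  let ?X = "\<lambda>\<omega>. u_deriv \<alpha> \<sigma> 1 \<omega> a" and ?Y = "\<lambda>\<omega>. u_deriv \<alpha> \<sigma> 2 \<omega> a"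
  let ?Z = "\<lambda>\<omega> y. exp (\<theta> * \<bar>u_deriv \<alpha> \<sigma> 3 \<omega> y\<bar>)"
  \<comment> \<open>The indicator inside the exponent changes nothing on \<open>[a, b]\<close> but makes the integrand jointly measurable.\<close>
  define T where "T = (\<lambda>\<omega>. \<integral>\<^sup>+y. ennreal (exp (\<theta> * \<bar>indicator {a..b} y * u_deriv \<alpha> \<sigma> (Suc 2) \<omega> y\<bar>)) * indicator {a..b} y \<partial>lborel)"
  have [measurable]: "?X \<in> borel_measurable M" "?Y \<in> borel_measurable M"
    by (intro measurable_u_deriv \<sigma> a)+
  note joint [measurable] = joint_measurable_u_deriv[OF \<sigma> a, of b \<alpha> 2]
  have T_meas [measurable]: "T \<in> borel_measurable M"
    unfolding T_def by measurable
  have T_eq: "T \<omega> = ennreal (integral {a..b} (?Z \<omega>))" if "\<omega> \<in> space M" for \<omega>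
  proof -
    have "T \<omega> = (\<integral>\<^sup>+y. ennreal (?Z \<omega> y) * indicator {a..b} y \<partial>lborel)"
      unfolding T_def by (intro nn_integral_cong) (auto simp: indicator_def)
    also have "\<dots> = ennreal (integral {a..b} (?Z \<omega>))"
      by (intro nn_integral_continuous_interval continuous_intros continuous_on_u_deriv that \<sigma> a) auto
    finally show ?thesis .
  qed
  define F where "F = (\<lambda>k::nat. {\<omega> \<in> space M. \<bar>?X \<omega>\<bar> \<le> A k \<and> \<bar>?Y \<omega>\<bar> \<le> B k \<and> ennreal ((b - a) * exp k) \<le> T \<omega>})"
  have F_sets: "F k \<in> sets M" for k unfolding F_def by measurable
  have cover: "E \<subseteq> (\<Union>k. F k)"
  proof
    fix \<omega> assume "\<omega> \<in> E"
    then obtain y z where \<omega>: "\<omega> \<in> space M" and yz: "y \<in> {a..b}" "z \<in> {a..b}" "y < z"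
      "u_deriv \<alpha> \<sigma> 1 \<omega> y = 0" "u_deriv \<alpha> \<sigma> 1 \<omega> z = 0" using E by blast
    define J where "J = integral {a..b} (\<lambda>x. \<bar>u_deriv \<alpha> \<sigma> 3 \<omega> x\<bar>)"
    have d1: "(u_deriv \<alpha> \<sigma> 1 \<omega> has_real_derivative u_deriv \<alpha> \<sigma> 2 \<omega> x) (at x)" if "x \<in> {a..b}" for x
      using DERIV_u_deriv[OF \<omega> \<sigma>, of x \<alpha> 1] that a by (simp add: numeral_2_eq_2)
    have d2: "(u_deriv \<alpha> \<sigma> 2 \<omega> has_real_derivative u_deriv \<alpha> \<sigma> 3 \<omega> x) (at x)" if "x \<in> {a..b}" for x
      using DERIV_u_deriv[OF \<omega> \<sigma>, of x \<alpha> 2] that a by simp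
    note bounds = two_zeros_bound[OF d1 d2 continuous_on_u_deriv[OF \<omega> \<sigma> a] yz, folded J_def]
    have J: "0 \<le> J" using bounds(2) by linarith
    define K where "K = \<theta> * J / (b - a)"
    have K: "0 \<le> K" using J \<theta> ab by (simp add: K_def)
    define k where "k = nat \<lfloor>K\<rfloor>"
    have k: "real k \<le> K" "K \<le> real k + 1" using K by (auto simp: k_def)
    have "J = K * (b - a) / \<theta>" using \<theta> ab by (simp add: K_def)
    also have "\<dots> \<le> (real k + 1) * \<epsilon> / \<theta>"
      using k K ab \<theta> by (intro divide_right_mono mult_mono) auto
    finally have JB: "J \<le> B k" by (simp add: B_def mult.commute)
    have "(b - a) * J \<le> \<epsilon> * B k" using ab J JB by (intro mult_mono) auto
    also have "\<dots> = A k" by (simp add: A_def B_def power2_eq_square)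
    finally have JA: "(b - a) * J \<le> A k" .
    have "(b - a) * exp k \<le> (b - a) * exp (integral {a..b} (\<lambda>x. \<theta> * \<bar>u_deriv \<alpha> \<sigma> 3 \<omega> x\<bar>) / (b - a))"
      using k ab by (simp add: K_def J_def)
    also have "\<dots> \<le> integral {a..b} (?Z \<omega>)"
      by (intro exp_average_le ab continuous_intros continuous_on_u_deriv \<omega> \<sigma> a)
    finally have "ennreal ((b - a) * exp k) \<le> T \<omega>" unfolding T_eq[OF \<omega>] by (rule ennreal_leI)
    then have "\<omega> \<in> F k" using bounds JA JB \<omega> by (simp add: F_def)
    then show "\<omega> \<in> (\<Union>k. F k)" by blast
  qed
  have F_le: "emeasure M (F k) \<le> ennreal (exp 1 * C * (\<epsilon> / \<sigma>) ^ 3 * (16 * exp (- (1 / 2)) ^ k))" for k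
  proof -
    let ?w = "\<lambda>\<omega>. exp (- ((?X \<omega> / A k)\<^sup>2 / 2)) * exp (- ((?Y \<omega> / B k)\<^sup>2 / 2))"
    \<comment> \<open>The constant of the Markov inequality, the reciprocal of the least value of the weighted integral on \<open>F k\<close>.\<close>
    define D where "D = exp 1 / ((b - a) * exp k)"
    have D: "0 < D" using ab by (simp add: D_def)
    have "emeasure M (F k) = (\<integral>\<^sup>+\<omega>. indicator (F k) \<omega> \<partial>M)" using F_sets by simp
    also have "\<dots> \<le> (\<integral>\<^sup>+\<omega>. ennreal D * (ennreal (?w \<omega>) * T \<omega>) \<partial>M)"
    proof (rule nn_integral_mono)
      fix \<omega> assume \<omega>: "\<omega> \<in> space M"
      show "indicator (F k) \<omega> \<le> ennreal D * (ennreal (?w \<omega>) * T \<omega>)"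
      proof (cases "\<omega> \<in> F k")
        case True
        have half: "exp (- (1 / 2)) \<le> exp (- ((v / c)\<^sup>2 / 2))" if "\<bar>v\<bar> \<le> c" "0 < c" for v c :: real
        proof -
          have "\<bar>v / c\<bar> \<le> 1" using that by simp
          then have "(v / c)\<^sup>2 \<le> 1" by (simp add: abs_square_le_1)
          then show ?thesis by simp
        qed
        have "exp (- 1 :: real) = exp (- (1 / 2)) * exp (- (1 / 2))" by (simp add: exp_add[symmetric])
        also have "\<dots> \<le> ?w \<omega>"
          using True AB by (intro mult_mono half) (auto simp: F_def)
        finally have w: "exp (- 1) \<le> ?w \<omega>" .
        \<comment> \<open>On \<open>F k\<close> the weight is at least \<open>exp (- 1)\<close> and \<open>T\<close> at least \<open>(b - a) exp k\<close>.\<close>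
        have int: "(b - a) * exp k \<le> integral {a..b} (?Z \<omega>)"
        proof -
          have "ennreal ((b - a) * exp k) \<le> ennreal (integral {a..b} (?Z \<omega>))"
            using True unfolding T_eq[OF \<omega>, symmetric] by (simp add: F_def)
          moreover have "0 < (b - a) * exp k" using ab by simp
          ultimately show ?thesis by (auto simp: ennreal_le_iff2)
        qed
        have "exp (- 1) * ((b - a) * exp k) \<le> ?w \<omega> * integral {a..b} (?Z \<omega>)"
          using ab by (intro mult_mono[OF w int]) auto
        then have "D * (exp (- 1) * ((b - a) * exp k)) \<le> D * (?w \<omega> * integral {a..b} (?Z \<omega>))"
          using D by (intro mult_left_mono) auto
        moreover have "D * (exp (- 1) * ((b - a) * exp k)) = 1"
          using ab by (simp add: D_def exp_minus field_simps)
        ultimately have "1 \<le> D * (?w \<omega> * integral {a..b} (?Z \<omega>))" by simp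
        then have "ennreal 1 \<le> ennreal (D * (?w \<omega> * integral {a..b} (?Z \<omega>)))" by (rule ennreal_leI)
        also have "\<dots> = ennreal D * (ennreal (?w \<omega>) * T \<omega>)"
          unfolding T_eq[OF \<omega>] using D
          by (simp add: ennreal_mult' ennreal_mult'' mult.assoc del: times_divide_eq_right)
        finally show ?thesis using True by simp
      qed simp
    qed
    also have "\<dots> = ennreal D * (\<integral>\<^sup>+\<omega>. ennreal (?w \<omega>) * T \<omega> \<partial>M)"
      by (rule nn_integral_cmult) measurable
    also have "(\<integral>\<^sup>+\<omega>. ennreal (?w \<omega>) * T \<omega> \<partial>M)
        = (\<integral>\<^sup>+\<omega>. \<integral>\<^sup>+y. ennreal (?w \<omega>) *
            (ennreal (exp (\<theta> * \<bar>indicator {a..b} y * u_deriv \<alpha> \<sigma> (Suc 2) \<omega> y\<bar>)) * indicator {a..b} y) \<partial>lborel \<partial>M)"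
      unfolding T_def by (intro nn_integral_cong nn_integral_cmult[symmetric]) measurable
    also have "\<dots> = (\<integral>\<^sup>+y. \<integral>\<^sup>+\<omega>. ennreal (?w \<omega>) *
            (ennreal (exp (\<theta> * \<bar>indicator {a..b} y * u_deriv \<alpha> \<sigma> (Suc 2) \<omega> y\<bar>)) * indicator {a..b} y) \<partial>M \<partial>lborel)"
    proof -
      interpret P: pair_sigma_finite M lborel ..
      show ?thesis by (rule P.Fubini'[symmetric]) measurable
    qed
    also have "\<dots> \<le> (\<integral>\<^sup>+y. ennreal (C * A k * B k * \<sigma>\<^sup>2) * indicator {a..b} y \<partial>lborel)"
    proof (rule nn_integral_mono)
      fix y
      show "(\<integral>\<^sup>+\<omega>. ennreal (?w \<omega>) *
            (ennreal (exp (\<theta> * \<bar>indicator {a..b} y * u_deriv \<alpha> \<sigma> (Suc 2) \<omega> y\<bar>)) * indicator {a..b} y) \<partial>M)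
          \<le> ennreal (C * A k * B k * \<sigma>\<^sup>2) * indicator {a..b} y"
      proof (cases "y \<in> {a..b}")
        case True
        then show ?thesis
          using small_ball[OF True AB(1)[of k] AB(2)[of k]] by (simp add: ennreal_mult \<theta>_def)
      qed simp
    qed
    also have "\<dots> = ennreal (C * A k * B k * \<sigma>\<^sup>2) * ennreal (b - a)"
      using ab by (simp add: nn_integral_cmult_indicator)
    also have "ennreal D * (ennreal (C * A k * B k * \<sigma>\<^sup>2) * ennreal (b - a))
        = ennreal (D * (C * A k * B k * \<sigma>\<^sup>2 * (b - a)))"
      using D C AB[of k] ab by (simp add: ennreal_mult'[symmetric] ennreal_mult''[symmetric])
    also have "D * (C * A k * B k * \<sigma>\<^sup>2 * (b - a))
        = exp 1 * C * (\<epsilon> / \<sigma>) ^ 3 * ((real k + 1)\<^sup>2 * exp (- real k))"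
    proof -
      have 1: "A k * B k = \<epsilon> ^ 3 * (real k + 1)\<^sup>2 / \<sigma> ^ 5"
        unfolding \<theta>2[symmetric] by (simp add: A_def B_def power2_eq_square power3_eq_cube)
      have 2: "D * (C * A k * B k * \<sigma>\<^sup>2 * (b - a)) = exp 1 * exp (- real k) * C * (A k * B k) * \<sigma>\<^sup>2"
        using ab by (simp add: D_def exp_minus field_simps)
      have 3: "e * C * (\<epsilon> ^ 3 * r / \<sigma> ^ 5) * \<sigma>\<^sup>2 = C * (\<epsilon> / \<sigma>) ^ 3 * (r * e)" for r e
        using \<sigma> by (simp add: power_divide field_simps power_numeral_reduce)
      show ?thesis unfolding 2 1 3 by (simp add: mult_ac)
    qed
    also have "ennreal \<dots> \<le> ennreal (exp 1 * C * (\<epsilon> / \<sigma>) ^ 3 * (16 * exp (- (1 / 2)) ^ k))"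
      using C \<epsilon> \<sigma> by (intro ennreal_leI mult_left_mono square_exp_le_geometric) auto
    finally show ?thesis by (simp add: mult_left_mono)
  qed
  have "(\<lambda>k. exp 1 * C * (\<epsilon> / \<sigma>) ^ 3 * (16 * exp (- (1 / 2)) ^ k)) sums
      (exp 1 * C * (\<epsilon> / \<sigma>) ^ 3 * (16 * (1 / (1 - exp (- (1 / 2))))))"
    by (intro sums_mult geometric_sums) simp
  then have sum: "(\<Sum>k. ennreal (exp 1 * C * (\<epsilon> / \<sigma>) ^ 3 * (16 * exp (- (1 / 2)) ^ k)))
      = ennreal (exp 1 * C * (\<epsilon> / \<sigma>) ^ 3 * (16 * (1 / (1 - exp (- (1 / 2))))))"
    using C \<epsilon> \<sigma> by (subst suminf_ennreal_eq) auto
  have "emeasure M E \<le> emeasure M (\<Union>k. F k)"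
    by (rule emeasure_mono[OF cover]) (use F_sets in auto)
  also have "\<dots> \<le> (\<Sum>k. emeasure M (F k))"
    by (rule emeasure_subadditive_countably) (use F_sets in auto)
  also have "\<dots> \<le> (\<Sum>k. ennreal (exp 1 * C * (\<epsilon> / \<sigma>) ^ 3 * (16 * exp (- (1 / 2)) ^ k)))"
    by (intro suminf_le F_le) auto
  also note sum
  finally have "measure M E \<le> exp 1 * C * (\<epsilon> / \<sigma>) ^ 3 * (16 * (1 / (1 - exp (- (1 / 2)))))"
    using C \<epsilon> \<sigma> by (simp add: emeasure_eq_measure)
  then show ?thesis by (simp add: mult_ac)
qed

end

section \<open>Measurability of the event of two zeros\<close>

text \<open>
  By compactness a continuous function without zeros on \<open>[p, q]\<close> is bounded away from \<open>0\<close>. Rational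
  convex coordinates \<open>r\<close> are used, so that the countable index set is the same for all \<open>p\<close> and \<open>q\<close>
  and no separate case is needed for \<open>p = q\<close>.
\<close>

lemma exists_zero_iff_rational:
  fixes f :: "real \<Rightarrow> real"
  assumes f: "continuous_on {p..q} f" and pq: "p \<le> q"
  shows "(\<exists>x\<in>{p..q}. f x = 0) \<longleftrightarrow>
    (\<forall>n::nat. \<exists>r\<in>\<rat> \<inter> {0..1}. \<bar>f (p + r * (q - p))\<bar> < 1 / real (Suc n))"
proof -
  let ?g = "\<lambda>s. f (p + s * (q - p))"
  have range: "p + s * (q - p) \<in> {p..q}" if "s \<in> {0..1}" for s
  proof -
    have "0 \<le> s * (q - p)" "s * (q - p) \<le> q - p"
      using that pq by (auto intro!: mult_left_le_one_le)
    then show ?thesis by simp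
  qed
  have g: "continuous_on {0..1} ?g"
    by (rule continuous_on_compose2[OF f]) (use range in \<open>auto intro!: continuous_intros\<close>)
  show ?thesis
  proof
    assume "\<exists>x\<in>{p..q}. f x = 0"
    then obtain x where x: "x \<in> {p..q}" "f x = 0" by blast
    obtain s where s: "s \<in> {0..1}" "p + s * (q - p) = x"
    proof (cases "p = q")
      case True
      then show ?thesis using x that[of 0] by auto
    next
      case False
      then show ?thesis using x pq that[of "(x - p) / (q - p)"] by auto
    qed
    show "\<forall>n::nat. \<exists>r\<in>\<rat> \<inter> {0..1}. \<bar>?g r\<bar> < 1 / real (Suc n)"
    proof
      fix n
      have "\<exists>d>0. \<forall>r\<in>{0..1}. dist r s < d \<longrightarrow> dist (?g r) (?g s) < 1 / real (Suc n)"
        using g s(1) unfolding continuous_on_iff by simp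
      then obtain d where d: "0 < d" "\<And>r. r \<in> {0..1} \<Longrightarrow> dist r s < d \<Longrightarrow> dist (?g r) (?g s) < 1 / real (Suc n)"
        by blast
      have "max 0 (s - d) < min 1 (s + d)" using d(1) s(1) by auto
      then obtain r where "r \<in> \<rat>" "max 0 (s - d) < r" "r < min 1 (s + d)"
        using Rats_dense_in_real by blast
      then show "\<exists>r\<in>\<rat> \<inter> {0..1}. \<bar>?g r\<bar> < 1 / real (Suc n)"
        using d(2)[of r] s(2) x(2) by (intro bexI[of _ r]) (auto simp: dist_real_def)
    qed
  next
    assume R: "\<forall>n::nat. \<exists>r\<in>\<rat> \<inter> {0..1}. \<bar>?g r\<bar> < 1 / real (Suc n)"
    have "\<exists>s\<in>{0..1}. \<forall>r\<in>{0..1}. \<bar>?g s\<bar> \<le> \<bar>?g r\<bar>"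
      by (rule continuous_attains_inf) (auto intro!: continuous_intros g)
    then obtain s where s: "s \<in> {0..1}" "\<And>r. r \<in> {0..1} \<Longrightarrow> \<bar>?g s\<bar> \<le> \<bar>?g r\<bar>" by blast
    have "?g s = 0"
    proof (rule ccontr)
      assume "?g s \<noteq> 0"
      then obtain n where "inverse (real (Suc n)) < \<bar>?g s\<bar>"
        using reals_Archimedean[of "\<bar>?g s\<bar>"] by auto
      moreover obtain r where "r \<in> \<rat> \<inter> {0..1}" "\<bar>?g r\<bar> < 1 / real (Suc n)" using R by blast
      ultimately show False using s(2)[of r] by (auto simp: inverse_eq_divide)
    qed
    then show "\<exists>x\<in>{p..q}. f x = 0" using range[OF s(1)] by blast
  qed
qed

lemma measurable_zero_event:
  fixes f :: "'a \<Rightarrow> real \<Rightarrow> real"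
  assumes cont: "\<And>\<omega>. \<omega> \<in> space M \<Longrightarrow> continuous_on {p..q} (f \<omega>)"
    and meas: "\<And>x. x \<in> {p..q} \<Longrightarrow> (\<lambda>\<omega>. f \<omega> x) \<in> borel_measurable M"
    and pq: "p \<le> q"
  shows "{\<omega> \<in> space M. \<exists>x\<in>{p..q}. f \<omega> x = 0} \<in> sets M"
proof -
  have "{\<omega> \<in> space M. \<exists>x\<in>{p..q}. f \<omega> x = 0}
      = {\<omega> \<in> space M. \<forall>n::nat. \<exists>r\<in>\<rat> \<inter> {0..1}. \<bar>f \<omega> (p + r * (q - p))\<bar> < 1 / real (Suc n)}"
    using exists_zero_iff_rational[OF cont pq] by blast
  also have "\<dots> \<in> sets M"
  proof (intro sets.sets_Collect_countable_All sets.sets_Collect_countable_Ex')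
    show "countable (\<rat> \<inter> {0..1::real})" by (simp add: countable_rat countable_Int1)
    fix n :: nat and r :: real assume r: "r \<in> \<rat> \<inter> {0..1}"
    have "0 \<le> r * (q - p)" "r * (q - p) \<le> q - p"
      using r pq by (auto intro!: mult_left_le_one_le)
    then have [measurable]: "(\<lambda>\<omega>. f \<omega> (p + r * (q - p))) \<in> borel_measurable M" by (intro meas) auto
    show "{\<omega> \<in> space M. \<bar>f \<omega> (p + r * (q - p))\<bar> < 1 / real (Suc n)} \<in> sets M" by measurable
  qed
  finally show ?thesis .
qed

text \<open>
  Two distinct zeros can be enclosed in disjoint compact intervals \<open>[p, q]\<close> and \<open>[r, s]\<close> with endpoints
  in a fixed countable subset \<open>D\<close> of the interval. Besides the rationals, \<open>D\<close> contains the endpoints of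
  the interval that belong to it, since a zero may be located there.
\<close>

lemma measurable_two_zeros_event:
  fixes f :: "'a \<Rightarrow> real \<Rightarrow> real"
  assumes I: "is_interval I"
    and cont: "\<And>\<omega>. \<omega> \<in> space M \<Longrightarrow> continuous_on I (f \<omega>)"
    and meas: "\<And>x. x \<in> I \<Longrightarrow> (\<lambda>\<omega>. f \<omega> x) \<in> borel_measurable M"
  shows "{\<omega> \<in> space M. \<exists>y\<in>I. \<exists>z\<in>I. y < z \<and> f \<omega> y = 0 \<and> f \<omega> z = 0} \<in> sets M"
proof -
  have between: "{x..y} \<subseteq> I" if "x \<in> I" "y \<in> I" for x y
    using I that unfolding is_interval_1 by (meson atLeastAtMost_iff subsetI)
  define D where "D = (\<rat> \<inter> I) \<union> (I \<inter> {Inf I, Sup I})"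
  have D: "countable D" "D \<subseteq> I"
    unfolding D_def by (auto simp: countable_rat countable_Int1)
  have below: "\<exists>p\<in>D. p \<le> y" if y: "y \<in> I" for y
  proof (cases "\<exists>x\<in>I. x < y")
    case True
    then obtain x where x: "x \<in> I" "x < y" by blast
    then obtain p where "p \<in> \<rat>" "x < p" "p < y" using Rats_dense_in_real by blast
    moreover from this have "p \<in> I" using between[OF x(1) y] by auto
    ultimately show ?thesis by (intro bexI[of _ p]) (auto simp: D_def)
  next
    case False
    then have "Inf I = y" using y by (intro cInf_eq_minimum) auto
    then show ?thesis using y by (auto simp: D_def)
  qed
  have above: "\<exists>p\<in>D. y \<le> p" if y: "y \<in> I" for y
  proof (cases "\<exists>x\<in>I. y < x")
    case True
    then obtain x where x: "x \<in> I" "y < x" by blast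
    then obtain p where "p \<in> \<rat>" "y < p" "p < x" using Rats_dense_in_real by blast
    moreover from this have "p \<in> I" using between[OF y x(1)] by auto
    ultimately show ?thesis by (intro bexI[of _ p]) (auto simp: D_def)
  next
    case False
    then have "Sup I = y" using y by (intro cSup_eq_maximum) auto
    then show ?thesis using y by (auto simp: D_def)
  qed
  let ?Z = "\<lambda>p q. {\<omega> \<in> space M. \<exists>x\<in>{p..q}. f \<omega> x = 0}"
  let ?Q = "{(p, q, r, s) \<in> D \<times> D \<times> D \<times> D. p \<le> q \<and> q < r \<and> r \<le> s}"
  have "{\<omega> \<in> space M. \<exists>y\<in>I. \<exists>z\<in>I. y < z \<and> f \<omega> y = 0 \<and> f \<omega> z = 0}
      = (\<Union>(p, q, r, s)\<in>?Q. ?Z p q \<inter> ?Z r s)" (is "?L = ?R")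
  proof (intro equalityI subsetI)
    fix \<omega> assume "\<omega> \<in> ?L"
    then obtain y z where \<omega>: "\<omega> \<in> space M" and yz: "y \<in> I" "z \<in> I" "y < z" "f \<omega> y = 0" "f \<omega> z = 0"
      by blast
    obtain p s where ps: "p \<in> D" "p \<le> y" "s \<in> D" "z \<le> s" using below above yz by metis
    obtain q where q: "q \<in> \<rat>" "y < q" "q < z" using Rats_dense_in_real yz(3) by blast
    obtain r where r: "r \<in> \<rat>" "q < r" "r < z" using Rats_dense_in_real q(3) by blast
    have "q \<in> {y..z}" "r \<in> {y..z}" using q r by auto
    then have "q \<in> D" "r \<in> D" using between[OF yz(1,2)] q(1) r(1) by (auto simp: D_def)
    then have "(p, q, r, s) \<in> ?Q" using ps q r by auto
    moreover have "\<omega> \<in> ?Z p q \<inter> ?Z r s"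
    proof -
      have "y \<in> {p..q}" "z \<in> {r..s}" using ps q r by auto
      then show ?thesis using \<omega> yz by blast
    qed
    ultimately show "\<omega> \<in> ?R" by blast
  next
    fix \<omega> assume "\<omega> \<in> ?R"
    then obtain p q r s x y where *: "p \<in> D" "q \<in> D" "r \<in> D" "s \<in> D" "q < r" "\<omega> \<in> space M"
      "x \<in> {p..q}" "f \<omega> x = 0" "y \<in> {r..s}" "f \<omega> y = 0" by blast
    then have "x \<in> I" "y \<in> I" using between D(2) by (metis subsetD)+
    moreover have "x < y" using * by auto
    ultimately show "\<omega> \<in> ?L" using * by blast
  qed
  also have "\<dots> \<in> sets M"
  proof (rule sets.countable_UN'')
    show "countable ?Q" by (rule countable_subset[of _ "D \<times> D \<times> D \<times> D"]) (auto intro: D(1))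
    fix i assume i: "i \<in> ?Q"
    have "?Z p q \<in> sets M" if "p \<in> D" "q \<in> D" "p \<le> q" for p q
    proof (rule measurable_zero_event[OF _ _ that(3)])
      have "{p..q} \<subseteq> I" using between D(2) that by blast
      then show "continuous_on {p..q} (f \<omega>)" if "\<omega> \<in> space M" for \<omega>
        using cont[OF that] continuous_on_subset by blast
      show "(\<lambda>\<omega>. f \<omega> x) \<in> borel_measurable M" if "x \<in> {p..q}" for x
        using \<open>{p..q} \<subseteq> I\<close> that by (intro meas) auto
    qed
    then show "(case i of (p, q, r, s) \<Rightarrow> ?Z p q \<inter> ?Z r s) \<in> sets M" using i by auto
  qed
  finally show ?thesis .
qed

section \<open>Critical points in a division of the interval\<close>

lemma two_le_card_iff:
  fixes S :: "real set"
  shows "(2 \<le> (if finite S then enat (card S) else \<infinity>)) \<longleftrightarrow> (\<exists>y\<in>S. \<exists>z\<in>S. y < z)"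
proof -
  have "(\<exists>y\<in>S. \<exists>z\<in>S. y < z) \<longleftrightarrow> \<not> (\<forall>y\<in>S. \<forall>z\<in>S. y = z)"
    by (metis linorder_less_linear less_irrefl)
  moreover have "infinite S \<Longrightarrow> \<not> (\<forall>y\<in>S. \<forall>z\<in>S. y = z)"
    by (metis finite.emptyI finite_insert finite_subset insertI1 subsetI equals0I)
  moreover have "finite S \<Longrightarrow> \<not> (\<forall>y\<in>S. \<forall>z\<in>S. y = z) \<longleftrightarrow> 2 \<le> card S"
    using card_le_Suc0_iff_eq[of S] by auto
  moreover have "(2 \<le> enat n) \<longleftrightarrow> 2 \<le> n" for n
    by (simp flip: numeral_eq_enat)
  ultimately show ?thesis by auto
qed

text \<open>
  The two given points exclude degenerate intervals, so that the closed hull is a proper interval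
  to which the estimate for two zeros applies; the possibly missing endpoints have measure zero.
\<close>

lemma interval_within_endpoints:
  fixes I :: "real set"
  assumes I: "is_interval I" "I \<subseteq> {l..u}" and yz: "y \<in> I" "z \<in> I" "y < z"
  obtains a b where "a < b" "l \<le> a" "b \<le> u" "I \<subseteq> {a..b}" "b - a \<le> measure lborel I"
proof -
  have bdd: "bdd_below I" "bdd_above I"
    using I(2) by (meson bdd_below_Icc bdd_above_Icc bdd_below_mono bdd_above_mono)+
  define a b where "a = Inf I" and "b = Sup I"
  have sub: "I \<subseteq> {a..b}" using bdd by (auto simp: a_def b_def cInf_lower cSup_upper)
  have "a \<le> y" "z \<le> b" using sub yz by auto
  then have ab: "a < b" using yz(3) by linarith
  have "l \<le> a" "b \<le> u" unfolding a_def b_def using I(2) yz by (auto intro!: cInf_greatest cSup_least)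
  moreover have "{a<..<b} \<subseteq> I"
  proof
    fix x assume x: "x \<in> {a<..<b}"
    obtain p where p: "p \<in> I" "p < x" using x cInf_lessD[of I x] yz by (auto simp: a_def)
    obtain q where q: "q \<in> I" "x < q" using x less_cSupD[of I x] yz by (auto simp: b_def)
    show "x \<in> I" using I(1) p q unfolding is_interval_1 by (meson less_imp_le)
  qed
  then have "measure lborel {a<..<b} \<le> measure lborel I"
  proof (rule measure_mono_fmeasurable)
    have "I \<in> sets borel" using I(1) by (rule real_interval_borel_measurable)
    moreover have "emeasure lborel I \<le> emeasure lborel {a..b}"
      by (rule emeasure_mono[OF sub]) simp
    ultimately show "I \<in> fmeasurable lborel"
      using ab by (intro fmeasurableI) (auto simp: less_top[symmetric] top_unique)
  qed simp
  ultimately show ?thesis using that[of a b] ab sub by simp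
qed

context standard_brownian_motion
begin

lemma two_critical_points_iff:
  assumes \<omega>: "\<omega> \<in> space M" and \<sigma>: "0 < \<sigma>\<^sub>t \<alpha> t" and I: "I \<subseteq> {l..u}" "0 < l"
  shows "2 \<le> num_critical_points (conga_line \<alpha> t (\<lambda>s. W s \<omega>)) I \<longleftrightarrow>
    (\<exists>y\<in>I. \<exists>z\<in>I. y < z \<and> u_deriv \<alpha> (\<sigma>\<^sub>t \<alpha> t) 1 \<omega> y = 0 \<and> u_deriv \<alpha> (\<sigma>\<^sub>t \<alpha> t) 1 \<omega> z = 0)"
proof -
  let ?u = "conga_line \<alpha> t (\<lambda>s. W s \<omega>)"
  have D: "(?u has_real_derivative u_deriv \<alpha> (\<sigma>\<^sub>t \<alpha> t) 1 \<omega> x) (at x)" if "x \<in> I" for x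
  proof -
    have x: "0 < x" using that I by auto
    have "(u_deriv \<alpha> (\<sigma>\<^sub>t \<alpha> t) 0 \<omega> has_real_derivative u_deriv \<alpha> (\<sigma>\<^sub>t \<alpha> t) 1 \<omega> x) (at x)"
      using DERIV_u_deriv[OF \<omega> \<sigma> x, of \<alpha> 0] by simp
    then show ?thesis
      by (rule has_field_derivative_transform_within_open[of _ _ _ "{0<..}"])
         (use x conga_line_eq_conga_deriv[OF continuous_paths[OF \<omega>] \<sigma>] in auto)
  qed
  have "critical_points ?u I = {x \<in> I. u_deriv \<alpha> (\<sigma>\<^sub>t \<alpha> t) 1 \<omega> x = 0}"
    unfolding critical_points_def using D DERIV_unique by fastforce
  then show ?thesis
    unfolding num_critical_points_def two_le_card_iff by auto
qed

lemma prob_some_piece_le: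
  assumes \<sigma>: "0 < \<sigma>\<^sub>t \<alpha> t" and \<delta>: "0 < \<delta>" and n: "0 < n"
    and I: "divides_interval I n \<delta> \<alpha> \<epsilon>" and p: "0 \<le> p"
    and piece: "\<And>a b E. \<delta> \<le> a \<Longrightarrow> a < b \<Longrightarrow> b \<le> \<alpha> \<Longrightarrow> b - a \<le> \<epsilon> \<Longrightarrow>
      E \<subseteq> {\<omega> \<in> space M. \<exists>y\<in>{a..b}. \<exists>z\<in>{a..b}. y < z \<and> u_deriv \<alpha> (\<sigma>\<^sub>t \<alpha> t) 1 \<omega> y = 0 \<and> u_deriv \<alpha> (\<sigma>\<^sub>t \<alpha> t) 1 \<omega> z = 0} \<Longrightarrow>
      measure M E \<le> p"
  defines "E \<equiv> {\<omega> \<in> space M.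
      Max ((\<lambda>j. num_critical_points (conga_line \<alpha> t (\<lambda>s. W s \<omega>)) (I j)) ` {1..n}) \<ge> 2}"
  shows "E \<in> sets M" and "measure M E \<le> real n * p"
proof -
  have Ij: "is_interval (I j)" "measure lborel (I j) \<le> \<epsilon>" "I j \<subseteq> {\<delta>..\<alpha>}" if "j \<in> {1..n}" for j
    using I that unfolding divides_interval_def by auto
  let ?P = "\<lambda>\<omega> j. \<exists>y\<in>I j. \<exists>z\<in>I j. y < z \<and> u_deriv \<alpha> (\<sigma>\<^sub>t \<alpha> t) 1 \<omega> y = 0 \<and> u_deriv \<alpha> (\<sigma>\<^sub>t \<alpha> t) 1 \<omega> z = 0"
  define A where "A = (\<lambda>j. {\<omega> \<in> space M. ?P \<omega> j})"
  have A_sets: "A j \<in> sets M" if j: "j \<in> {1..n}" for j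
    unfolding A_def
  proof (rule measurable_two_zeros_event[OF Ij(1)[OF j]])
    show "continuous_on (I j) (u_deriv \<alpha> (\<sigma>\<^sub>t \<alpha> t) 1 \<omega>)" if "\<omega> \<in> space M" for \<omega>
      by (rule continuous_on_subset[OF continuous_on_u_deriv[OF that \<sigma> \<delta>] Ij(3)[OF j]])
    show "(\<lambda>\<omega>. u_deriv \<alpha> (\<sigma>\<^sub>t \<alpha> t) 1 \<omega> x) \<in> borel_measurable M" if "x \<in> I j" for x
      using that Ij(3)[OF j] \<delta> by (intro measurable_u_deriv \<sigma>) auto
  qed
  have E: "E = (\<Union>j\<in>{1..n}. A j)"
  proof -
    have "Max ((\<lambda>j. num_critical_points (conga_line \<alpha> t (\<lambda>s. W s \<omega>)) (I j)) ` {1..n}) \<ge> 2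
        \<longleftrightarrow> (\<exists>j\<in>{1..n}. ?P \<omega> j)" if "\<omega> \<in> space M" for \<omega>
      using two_critical_points_iff[OF that \<sigma> Ij(3) \<delta>] n by (subst Max_ge_iff) auto
    then show ?thesis unfolding E_def A_def by blast
  qed
  show "E \<in> sets M" unfolding E using A_sets by blast
  have "measure M (A j) \<le> p" if j: "j \<in> {1..n}" for j
  proof (cases "\<exists>y\<in>I j. \<exists>z\<in>I j. y < z")
    case True
    then obtain y z where "y \<in> I j" "z \<in> I j" "y < z" by blast
    then obtain a b where ab: "a < b" "\<delta> \<le> a" "b \<le> \<alpha>" "I j \<subseteq> {a..b}" "b - a \<le> measure lborel (I j)"
      using interval_within_endpoints[OF Ij(1,3)[OF j]] by metis
    then have "b - a \<le> \<epsilon>" using Ij(2)[OF j] by simp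
    then show ?thesis by (rule piece[OF ab(2,1,3)]) (use ab(4) in \<open>auto simp: A_def\<close>)
  next
    case False
    then have "A j = {}" by (auto simp: A_def)
    then show ?thesis using p by simp
  qed
  moreover have "measure M E \<le> (\<Sum>j\<in>{1..n}. measure M (A j))"
    unfolding E by (rule finite_measure_subadditive_finite) (use A_sets in auto)
  ultimately show "measure M E \<le> real n * p"
    using sum_bounded_above[of "{1..n}" "\<lambda>j. measure M (A j)" p] by simp
qed

end

theorem corollary3p4:
  fixes \<alpha> \<delta> :: real
  assumes "0 < \<alpha>" and "\<alpha> < 1"
    and "0 < \<delta>" and "\<delta> < \<alpha>"
  shows "\<exists>C :: real. \<forall>(M :: 'a measure) (W :: real \<Rightarrow> 'a \<Rightarrow> real) (a :: real \<Rightarrow> real).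
    standard_brownian_motion M W \<longrightarrow>
    (\<forall>t>0. 0 < a t) \<longrightarrow>
    a \<in> o[at_top](\<lambda>t. t powr (- (1 / 4))) \<longrightarrow>
    (\<forall>\<^sub>F t in at_top. \<forall>I :: nat \<Rightarrow> real set.
      divides_interval I (num_pieces a t) \<delta> \<alpha> (a t / sqrt t) \<longrightarrow>
      (let E = {\<omega> \<in> space M.
          Max ((\<lambda>j. num_critical_points (conga_line \<alpha> t (\<lambda>s. W s \<omega>)) (I j)) ` {1..num_pieces a t}) \<ge> 2}
       in E \<in> sets M \<and> measure M E \<le> C * (a t)\<^sup>2 * t powr (1 / 2))) \<and>
    ((\<lambda>t. C * (a t)\<^sup>2 * t powr (1 / 2)) \<longlongrightarrow> 0) at_top"
proof -
  obtain c where c: "0 < c" and lower: "\<And>\<sigma> x u v. 0 < \<sigma> \<Longrightarrow> \<sigma> \<le> \<delta> / 2 \<Longrightarrow> x \<in> {\<delta>..\<alpha>} \<Longrightarrow>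
    c / \<sigma> * u\<^sup>2 + c / \<sigma> ^ 3 * v\<^sup>2
      \<le> integral {0..1} (\<lambda>y. (u * wiener_kernel \<alpha> \<sigma> 0 x y + v * wiener_kernel \<alpha> \<sigma> 1 x y)\<^sup>2)"
    using variance_lower_bound[OF assms(3,4)] by blast
  obtain V where upper: "\<And>\<sigma> x. 0 < \<sigma> \<Longrightarrow> \<sigma> \<le> 1 \<Longrightarrow> x \<in> {\<delta>..\<alpha>} \<Longrightarrow>
    integral {0..1} (\<lambda>y. (wiener_kernel \<alpha> \<sigma> 2 x y)\<^sup>2) \<le> V / \<sigma> ^ 5"
    using variance_upper_bound[OF assms(3,4)] by blast
  define C0 where "C0 = 4 * exp ((V + 1) / 2) / c"
  define S where "S = exp 1 * (16 / (1 - exp (- (1 / 2)))) * C0"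
  define s where "s = sqrt (\<alpha> * (1 - \<alpha>))"
  have C0: "0 \<le> C0" using c by (simp add: C0_def)
  have S: "0 \<le> S" using C0 by (simp add: S_def)
  have s: "0 < s" using assms by (simp add: s_def)
  define C where "C = 2 * S / s ^ 3"
  show ?thesis
  proof (intro exI[of _ C] allI impI conjI)
    fix M :: "'a measure" and W :: "real \<Rightarrow> 'a \<Rightarrow> real" and a :: "real \<Rightarrow> real"
    assume bm: "standard_brownian_motion M W" and a0: "\<forall>t>0. 0 < a t"
      and ao: "a \<in> o[at_top](\<lambda>t. t powr (- (1 / 4)))"
    interpret standard_brownian_motion M W by (rule bm)
    have "\<forall>\<^sub>F t in at_top. (1::real) \<le> t" by (rule eventually_ge_at_top)
    moreover have "\<forall>\<^sub>F t in at_top. (s / (\<delta> / 2))\<^sup>2 \<le> t" by (rule eventually_ge_at_top)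
    moreover have "\<forall>\<^sub>F t in at_top. s\<^sup>2 \<le> t" by (rule eventually_ge_at_top)
    moreover have "\<forall>\<^sub>F t in at_top. norm (a t) \<le> 1 * norm (t powr (- (1 / 4)))"
      by (rule landau_o.smallD[OF ao]) simp
    ultimately show "\<forall>\<^sub>F t in at_top. \<forall>I :: nat \<Rightarrow> real set.
      divides_interval I (num_pieces a t) \<delta> \<alpha> (a t / sqrt t) \<longrightarrow>
      (let E = {\<omega> \<in> space M.
          Max ((\<lambda>j. num_critical_points (conga_line \<alpha> t (\<lambda>s. W s \<omega>)) (I j)) ` {1..num_pieces a t}) \<ge> 2}
       in E \<in> sets M \<and> measure M E \<le> C * (a t)\<^sup>2 * t powr (1 / 2))"
    proof eventually_elim
      case (elim t)
      have t: "0 < t" "1 \<le> sqrt t" using elim by auto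
      have at: "0 < a t" using a0 t by simp
      \<comment> \<open>This absorbs the one piece by which \<open>num_pieces\<close> may exceed \<open>sqrt t / a t\<close>.\<close>
      have a_le: "a t \<le> sqrt t"
      proof -
        have "a t \<le> t powr (- (1 / 4))" using elim(4) at by simp
        also have "\<dots> \<le> 1" using elim(1) by (simp add: powr_le_one_le powr_minus inverse_le_1_iff ge_one_powr_ge_zero)
        finally show ?thesis using t(2) by linarith
      qed
      define \<sigma> where "\<sigma> = \<sigma>\<^sub>t \<alpha> t"
      have \<sigma>_eq: "\<sigma> = s / sqrt t" by (simp add: \<sigma>_def \<sigma>\<^sub>t_def s_def)
      have \<sigma>: "0 < \<sigma>" using s t by (simp add: \<sigma>_eq)
      have "s / (\<delta> / 2) \<le> sqrt t" using elim(2) by (rule real_le_rsqrt)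
      then have \<sigma>1: "\<sigma> \<le> \<delta> / 2" using t assms by (simp add: \<sigma>_eq field_simps)
      have "s \<le> sqrt t" using elim(3) by (rule real_le_rsqrt)
      then have \<sigma>2: "\<sigma> \<le> 1" using t by (simp add: \<sigma>_eq)
      define \<epsilon> where "\<epsilon> = a t / sqrt t"
      have ratio: "\<epsilon> / \<sigma> = a t / s" using t s by (simp add: \<epsilon>_def \<sigma>_eq)
      define n where "n = num_pieces a t"
      have n: "0 < n" by (simp add: n_def num_pieces_def)
      have n_le: "real n \<le> sqrt t / a t + 1"
        using at t by (simp add: n_def num_pieces_def)
      have piece: "measure M E \<le> S * (a t / s) ^ 3"
        if ab: "\<delta> \<le> p" "p < q" "q \<le> \<alpha>" "q - p \<le> \<epsilon>"
          and E: "E \<subseteq> {\<omega> \<in> space M. \<exists>y\<in>{p..q}. \<exists>z\<in>{p..q}. y < z \<and> u_deriv \<alpha> \<sigma> 1 \<omega> y = 0 \<and> u_deriv \<alpha> \<sigma> 1 \<omega> z = 0}" for p q E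
      proof -
        have "measure M E \<le> exp 1 * (16 / (1 - exp (- (1 / 2)))) * C0 * (\<epsilon> / \<sigma>) ^ 3"
        proof (rule prob_two_zeros_le[OF \<sigma> _ ab(2,4) C0 _ E])
          show "0 < p" using ab assms by simp
          fix y A B :: real assume y: "y \<in> {p..q}" and AB: "0 < A" "0 < B"
          show "(\<integral>\<^sup>+\<omega>. ennreal (exp (- ((u_deriv \<alpha> \<sigma> 1 \<omega> p / A)\<^sup>2 / 2)) * exp (- ((u_deriv \<alpha> \<sigma> 2 \<omega> p / B)\<^sup>2 / 2))
            * exp (sqrt \<sigma> ^ 5 * \<bar>u_deriv \<alpha> \<sigma> 3 \<omega> y\<bar>)) \<partial>M) \<le> ennreal (C0 * A * B * \<sigma>\<^sup>2)"
            unfolding C0_def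
            by (rule conga_tilted_small_ball[OF \<sigma> _ _ c AB lower[OF \<sigma> \<sigma>1] upper[OF \<sigma> \<sigma>2]])
               (use ab y assms in auto)
        qed
        then show ?thesis by (simp add: S_def ratio)
      qed
      have p0: "0 \<le> S * (a t / s) ^ 3" using S at s by simp
      have total: "real n * (S * (a t / s) ^ 3) \<le> C * (a t)\<^sup>2 * t powr (1 / 2)"
      proof -
        have "real n * a t \<le> sqrt t + a t"
          using mult_right_mono[OF n_le, of "a t"] at by (simp add: distrib_right)
        also have "\<dots> \<le> 2 * sqrt t" using a_le by simp
        finally have "(real n * a t) * (S / s ^ 3 * (a t)\<^sup>2) \<le> (2 * sqrt t) * (S / s ^ 3 * (a t)\<^sup>2)"
          using S s by (intro mult_right_mono) auto
        then show ?thesis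
          using t by (simp add: C_def powr_half_sqrt power_divide power3_eq_cube power2_eq_square mult_ac)
      qed
      show ?case
      proof (intro allI impI)
        fix I :: "nat \<Rightarrow> real set"
        assume "divides_interval I (num_pieces a t) \<delta> \<alpha> (a t / sqrt t)"
        then have I: "divides_interval I n \<delta> \<alpha> \<epsilon>" by (simp only: n_def \<epsilon>_def)
        have "0 < \<sigma>\<^sub>t \<alpha> t" using \<sigma> by (simp only: \<sigma>_def)
        note some = prob_some_piece_le[OF this assms(3) n I p0 piece[unfolded \<sigma>_def]]
        show "let E = {\<omega> \<in> space M.
            Max ((\<lambda>j. num_critical_points (conga_line \<alpha> t (\<lambda>s. W s \<omega>)) (I j)) ` {1..num_pieces a t}) \<ge> 2}
          in E \<in> sets M \<and> measure M E \<le> C * (a t)\<^sup>2 * t powr (1 / 2)"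
          unfolding Let_def n_def[symmetric]
          using some(1) order_trans[OF some(2) total] by (rule conjI)
      qed
    qed
    have "((\<lambda>t. a t / t powr (- (1 / 4))) \<longlongrightarrow> 0) at_top"
      by (rule smalloD_tendsto[OF ao])
    from tendsto_mult[OF tendsto_const[of C] tendsto_power[OF this, of 2]]
    have lim: "((\<lambda>t. C * (a t / t powr (- (1 / 4)))\<^sup>2) \<longlongrightarrow> 0) at_top" by simp
    have ev: "\<forall>\<^sub>F t in at_top. C * (a t / t powr (- (1 / 4)))\<^sup>2 = C * (a t)\<^sup>2 * t powr (1 / 2)"
      using eventually_gt_at_top[of "0::real"]
    proof eventually_elim
      case (elim t)
      have sq: "(t powr (- (1 / 4)))\<^sup>2 = t powr (- (1 / 2))"
        using elim by (simp add: powr_power)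
      have "C * (a t / t powr (- (1 / 4)))\<^sup>2 = C * ((a t)\<^sup>2 / t powr (- (1 / 2)))"
        by (simp only: power_divide sq)
      also have "\<dots> = C * (a t)\<^sup>2 * t powr (1 / 2)"
        by (simp only: powr_minus_divide[of t] divide_divide_eq_right div_by_1 mult.assoc)
      finally show ?case .
    qed
    show "((\<lambda>t. C * (a t)\<^sup>2 * t powr (1 / 2)) \<longlongrightarrow> 0) at_top"
      by (rule Lim_transform_eventually[OF lim ev])
  qed
qed

end
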